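(* Let $\Omega\subset\mathbb{R}^2$ be open and bounded with Lipschitz boundary, let $0<\gamma<1$, let $\rho$ and $I$ be as in the context, let $u_0\in W^{1,2}(\Omega,\mathbb{R}^2)$, and let $u\in\mathcal{A}_{u_0}$ be a stationary point of $I$. Then $u\in W^{2,2}_{loc}(\Omega,\mathbb{R}^2)$.
   Context: Fix constants $\gamma>0$, $s_0\ge 0$, $\kappa\ge-\gamma s_0$. Let $\rho\in C^\infty(\mathbb{R})$ be convex with $\rho(s)=0$ for $s\le 0$, $\rho(s)=\gamma s+\kappa$ for $s\ge s_0$, and $\rho=\rho_1$ on $[0,s_0]$ where $\rho_1$ is smooth and convex with $\rho_1(0)=0$, $\rho_1(s_0)=\gamma s_0+\kappa$ (the pieces joined so that $\rho$ is smooth). In particular $0\le\rho'\le\gamma$. For $A\in\mathbb{R}^{2\times 2}$, $\operatorname{cof}A=\begin{pmatrix}a_{22}&-a_{21}\\-a_{12}&a_{11}\end{pmatrix}$, and $|\cdot|$ and $\cdot$ are the Frobenius norm and inner product. The functional is $I(u)=\int_\Omega \tfrac12|\nabla u|^2+\rho(\det\nabla u)\,dx$ for $u\in W^{1,2}(\Omega,\mathbb{R}^2)$. The admissible class is $\mathcal{A}_{u_0}=\{u\in W^{1,2}(\Omega,\mathbb{R}^2): u=u_0 \text{ on }\partial\Omega \text{ in the trace sense}\}$. A stationary point is $u\in\mathcal{A}_{u_0}$ with $\int_\Omega(\nabla u+\rho'(\det\nabla u)\operatorname{cof}\nabla u)\cdot\nabla\varphi\,dx=0$ for all $\varphi\in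 W^{1,2}_0(\Omega,\mathbb{R}^2)$. *)

theory Defs
  imports "HOL-Analysis.Analysis"
begin

type_synonym vec2 = "real^2"
type_synonym mat2 = "real^2^2"

definition pdiff :: "(vec2 \<Rightarrow> real) \<Rightarrow> 2 \<Rightarrow> vec2 \<Rightarrow> real" where
  "pdiff f j x = frechet_derivative f (at x) (axis j 1)"

coinductive smooth2 :: "(vec2 \<Rightarrow> real) \<Rightarrow> bool" where
  "(\<forall>x. f differentiable (at x)) \<Longrightarrow> (\<forall>j. smooth2 (\<lambda>x. pdiff f j x)) \<Longrightarrow> smooth2 f"

definition smooth1 :: "(real \<Rightarrow> real) \<Rightarrow> bool" where
  "smooth1 f \<longleftrightarrow> (\<forall>n x. ((deriv ^^ n) f) differentiable (at x))"

definition test_fun :: "vec2 set \<Rightarrow> (vec2 \<Rightarrow> real) \<Rightarrow> bool" where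
  "test_fun \<Omega> \<phi> \<longleftrightarrow> smooth2 \<phi> \<and> compact (closure {x. \<phi> x \<noteq> 0}) \<and> closure {x. \<phi> x \<noteq> 0} \<subseteq> \<Omega>"

definition test_vec :: "vec2 set \<Rightarrow> (vec2 \<Rightarrow> vec2) \<Rightarrow> bool" where
  "test_vec \<Omega> \<psi> \<longleftrightarrow> (\<forall>i. test_fun \<Omega> (\<lambda>x. \<psi> x $ i))"

definition loc_integrable :: "vec2 set \<Rightarrow> (vec2 \<Rightarrow> real) \<Rightarrow> bool" where
  "loc_integrable \<Omega> f \<longleftrightarrow> (\<forall>K. compact K \<and> K \<subseteq> \<Omega> \<longrightarrow> set_integrable lborel K f)"

definition weak_partial :: "vec2 set \<Rightarrow> (vec2 \<Rightarrow> real) \<Rightarrow> 2 \<Rightarrow> (vec2 \<Rightarrow> real) \<Rightarrow> bool" where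
  "weak_partial \<Omega> f j g \<longleftrightarrow> loc_integrable \<Omega> f \<and> loc_integrable \<Omega> g \<and>
     (\<forall>\<phi>. test_fun \<Omega> \<phi> \<longrightarrow>
        (LINT x:\<Omega>|lborel. f x * pdiff \<phi> j x) = - (LINT x:\<Omega>|lborel. g x * \<phi> x))"

definition L2_on :: "vec2 set \<Rightarrow> (vec2 \<Rightarrow> real) \<Rightarrow> bool" where
  "L2_on \<Omega> f \<longleftrightarrow> set_borel_measurable lborel \<Omega> f \<and> set_integrable lborel \<Omega> (\<lambda>x. (f x)\<^sup>2)"

definition W12s :: "vec2 set \<Rightarrow> (vec2 \<Rightarrow> real) \<Rightarrow> bool" where
  "W12s \<Omega> f \<longleftrightarrow> L2_on \<Omega> f \<and> (\<forall>j. \<exists>g. weak_partial \<Omega> f j g \<and> L2_on \<Omega> g)"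

definition weak_grad :: "vec2 set \<Rightarrow> (vec2 \<Rightarrow> vec2) \<Rightarrow> (vec2 \<Rightarrow> mat2) \<Rightarrow> bool" where
  "weak_grad \<Omega> u Du \<longleftrightarrow> (\<forall>i j. weak_partial \<Omega> (\<lambda>x. u x $ i) j (\<lambda>x. Du x $ i $ j))"

definition wgrad :: "vec2 set \<Rightarrow> (vec2 \<Rightarrow> vec2) \<Rightarrow> vec2 \<Rightarrow> mat2" where
  "wgrad \<Omega> u = (SOME Du. weak_grad \<Omega> u Du)"

definition W12 :: "vec2 set \<Rightarrow> (vec2 \<Rightarrow> vec2) \<Rightarrow> bool" where
  "W12 \<Omega> u \<longleftrightarrow> (\<forall>i. W12s \<Omega> (\<lambda>x. u x $ i))"

definition W12_dist2 :: "vec2 set \<Rightarrow> (vec2 \<Rightarrow> vec2) \<Rightarrow> (vec2 \<Rightarrow> vec2) \<Rightarrow> real" where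
  "W12_dist2 \<Omega> u v = (LINT x:\<Omega>|lborel. (norm (u x - v x))\<^sup>2 + (norm (wgrad \<Omega> u x - wgrad \<Omega> v x))\<^sup>2)"

definition W012 :: "vec2 set \<Rightarrow> (vec2 \<Rightarrow> vec2) \<Rightarrow> bool" where
  "W012 \<Omega> \<phi> \<longleftrightarrow> W12 \<Omega> \<phi> \<and>
     (\<exists>\<psi>::nat \<Rightarrow> vec2 \<Rightarrow> vec2. (\<forall>n. test_vec \<Omega> (\<psi> n)) \<and> (\<lambda>n. W12_dist2 \<Omega> (\<psi> n) \<phi>) \<longlonglongrightarrow> 0)"

text \<open>Admissible class A_{u0}: u = u0 on the boundary in the trace sense.\<close>
definition admissible :: "vec2 set \<Rightarrow> (vec2 \<Rightarrow> vec2) \<Rightarrow> (vec2 \<Rightarrow> vec2) \<Rightarrow> bool" where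
  "admissible \<Omega> u0 u \<longleftrightarrow> W12 \<Omega> u \<and> W012 \<Omega> (\<lambda>x. u x - u0 x)"

definition cof2 :: "mat2 \<Rightarrow> mat2" where
  "cof2 A = (\<chi> i j. if i = 1 \<and> j = 1 then A $ 2 $ 2
                     else if i = 1 \<and> j = 2 then - A $ 2 $ 1
                     else if i = 2 \<and> j = 1 then - A $ 1 $ 2
                     else A $ 1 $ 1)"

text \<open>Stationary point of I(u) = int 1/2|Du|^2 + rho(det Du).\<close>
definition stationary :: "vec2 set \<Rightarrow> (real \<Rightarrow> real) \<Rightarrow> (vec2 \<Rightarrow> vec2) \<Rightarrow> (vec2 \<Rightarrow> vec2) \<Rightarrow> bool" where
  "stationary \<Omega> \<rho> u0 u \<longleftrightarrow> admissible \<Omega> u0 u \<and>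
     (\<forall>\<phi>. W012 \<Omega> \<phi> \<longrightarrow>
        (LINT x:\<Omega>|lborel. (wgrad \<Omega> u x + deriv \<rho> (det (wgrad \<Omega> u x)) *\<^sub>R cof2 (wgrad \<Omega> u x))
                              \<bullet> wgrad \<Omega> \<phi> x) = 0)"

definition lipschitz_boundary :: "vec2 set \<Rightarrow> bool" where
  "lipschitz_boundary \<Omega> \<longleftrightarrow> (\<forall>x\<in>frontier \<Omega>. \<exists>r>0. \<exists>R::mat2. \<exists>L. \<exists>g::real \<Rightarrow> real.
      orthogonal_matrix R \<and> L-lipschitz_on UNIV g \<and>
      \<Omega> \<inter> ball x r = {y \<in> ball x r. (R *v (y - x)) $ 2 < g ((R *v (y - x)) $ 1)})"

definition W22 :: "vec2 set \<Rightarrow> (vec2 \<Rightarrow> vec2) \<Rightarrow> bool" where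
  "W22 V u \<longleftrightarrow> W12 V u \<and> (\<exists>Du. weak_grad V u Du \<and> (\<forall>i j. W12s V (\<lambda>x. Du x $ i $ j)))"

definition W22_loc :: "vec2 set \<Rightarrow> (vec2 \<Rightarrow> vec2) \<Rightarrow> bool" where
  "W22_loc \<Omega> u \<longleftrightarrow> (\<forall>V. open V \<and> compact (closure V) \<and> closure V \<subseteq> \<Omega> \<longrightarrow> W22 V u)"

end

theory Submission
  imports Defs
begin

text \<open>The map \<open>A \<mapsto> A + \<rho>'(det A) cof A\<close> has linear growth and is strongly monotone with constant
  \<open>1 - \<gamma>\<close>, because \<open>\<rho>'\<close> is nondecreasing with values in \<open>[0, \<gamma>]\<close> and \<open>2 \<bar>det M\<bar> \<le> |M|\<^sup>2\<close>.
  Testing the equation with \<open>\<Delta>\<^sub>-\<^sub>h(\<eta>\<^sup>2 \<Delta>\<^sub>h u)\<close> bounds \<open>\<parallel>\<eta> \<Delta>\<^sub>h \<nabla>u\<parallel>\<close>. Since the map is not Lipschitz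
  (\<open>\<rho>''(det A) |A|\<^sup>2\<close> may be unbounded), the term with \<open>\<nabla>(\<eta>\<^sup>2)\<close> is not estimated directly: the
  difference is moved back onto \<open>\<nabla>(\<eta>\<^sup>2) \<otimes> \<Delta>\<^sub>h u\<close>, whose difference quotient is
  controlled by \<open>\<parallel>\<eta> \<Delta>\<^sub>h \<nabla>u\<parallel>\<close> and \<open>\<parallel>\<nabla>u\<parallel>\<close>, and can be absorbed. To stay
  within classical calculus, \<open>u\<close> is replaced by mollifications and the limit is taken for fixed \<open>h\<close>.
  The bound on the difference quotients of \<open>\<nabla>u\<close> yields the second weak derivatives by Riesz representation.\<close>

subsection \<open>Smooth functions on the plane\<close>

text \<open>All estimates live on the whole plane, where translations preserve integrals. For this
  \<open>u\<close> is multiplied by a cutoff that is 1 near the region of interest. The nonlinear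
  map is applied to the gradient of the product, so strong monotonicity holds for every pair of
  points \<open>x + h\<close>, \<open>x\<close>, while the equation is available only for test
  functions supported where the cutoff is 1. Mollification enters only through the test function;
  the stress stays as it is. For fixed \<open>h\<close> the passage to the limit is therefore linear
  in the mollified gradient, and monotonicity is used after it. Absorption works because the
  gradient of \<open>\<eta>\<^sup>2\<close> still contains a factor \<open>\<eta>\<close>: one more
  derivative leaves \<open>\<eta> \<Delta>\<^sub>h \<nabla>u\<close>, the quantity being estimated.
  A second obstacle is that \<open>wgrad\<close> picks an arbitrary weak gradient. Its square
  integrability, and its agreement almost everywhere with the classical gradient of a test function,
  rest on the fundamental lemma of the calculus of variations.\<close>

primrec Ck :: "nat \<Rightarrow> (vec2 \<Rightarrow> real) \<Rightarrow> bool" where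
  "Ck 0 f = True"
| "Ck (Suc n) f = ((\<forall>x. f differentiable (at x)) \<and> (\<forall>j. Ck n (pdiff f j)))"

text \<open>The partial derivatives of a product are sums of products, so a direct coinduction for
  products would need an invariant closed under sums. On the finite levels \<open>Ck n\<close> the
  closure properties follow by ordinary induction.\<close>

lemma smooth2_iff_Ck: "smooth2 f \<longleftrightarrow> (\<forall>n. Ck n f)"
proof
  assume "smooth2 f"
  then have "Ck n f" for n
  proof (induction n arbitrary: f)
    case (Suc n)
    from Suc.prems show ?case
      by (cases rule: smooth2.cases) (auto intro!: Suc.IH)
  qed simp
  then show "\<forall>n. Ck n f" ..
next
  assume "\<forall>n. Ck n f"
  then show "smooth2 f"
  proof (coinduction arbitrary: f)
    case smooth2
    then have "\<And>n. Ck (Suc n) f" by blast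
    then show ?case by auto
  qed
qed

lemma Ck_Suc_imp_Ck: "Ck (Suc n) f \<Longrightarrow> Ck n f"
proof (induction n arbitrary: f)
  case (Suc n)
  then show ?case by (metis Ck.simps(2))
qed simp

lemma smooth2_differentiable: "smooth2 f \<Longrightarrow> f differentiable (at x)"
  by (auto elim: smooth2.cases)

lemma smooth2_pdiff: "smooth2 f \<Longrightarrow> smooth2 (pdiff f j)"
  by (erule smooth2.cases) simp

lemma smooth2_has_derivative:
  "smooth2 f \<Longrightarrow> (f has_derivative frechet_derivative f (at x)) (at x)"
  using smooth2_differentiable frechet_derivative_works by blast

lemma smooth2_continuous_on: "smooth2 f \<Longrightarrow> continuous_on S f"
  by (meson differentiable_imp_continuous_within differentiable_at_withinI continuous_on_eq_continuous_within
      smooth2_differentiable)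

lemma smooth2_measurable: "smooth2 f \<Longrightarrow> f \<in> borel_measurable borel"
  by (intro borel_measurable_continuous_onI smooth2_continuous_on)

lemma pdiff_eqI: "(f has_derivative f') (at x) \<Longrightarrow> pdiff f j x = f' (axis j 1)"
  unfolding pdiff_def by (metis frechet_derivative_at)

lemma frechet_derivative_pdiff:
  assumes "f differentiable (at x)"
  shows "frechet_derivative f (at x) h = (\<Sum>j\<in>UNIV. h $ j * pdiff f j x)"
proof -
  have lin: "linear (frechet_derivative f (at x))"
    using assms linear_frechet_derivative by blast
  have "h = (\<Sum>j\<in>UNIV. (h $ j) *\<^sub>R axis j 1)"
    by (simp add: vec_eq_iff axis_def if_distrib cong: if_cong)
  then have "frechet_derivative f (at x) h = frechet_derivative f (at x) (\<Sum>j\<in>UNIV. (h $ j) *\<^sub>R axis j 1)"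
    by simp
  also have "\<dots> = (\<Sum>j\<in>UNIV. h $ j * pdiff f j x)"
    by (simp add: linear_sum[OF lin] linear_cmul[OF lin] pdiff_def)
  finally show ?thesis .
qed

lemma has_derivative_pdiff:
  assumes "f differentiable (at x)"
  shows "(f has_derivative (\<lambda>h. \<Sum>j\<in>UNIV. h $ j * pdiff f j x)) (at x)"
  using assms frechet_derivative_pdiff[OF assms] by (metis (no_types, lifting) ext frechet_derivative_works)

lemma pdiff_const [simp]: "pdiff (\<lambda>x. c) j = (\<lambda>x. 0)"
  by (rule ext, subst pdiff_eqI[of _ "\<lambda>h. 0"]) auto

lemma pdiff_add:
  assumes "\<And>x. f differentiable (at x)" "\<And>x. g differentiable (at x)"
  shows "pdiff (\<lambda>x. f x + g x) j = (\<lambda>x. pdiff f j x + pdiff g j x)"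
proof
  fix x
  show "pdiff (\<lambda>x. f x + g x) j x = pdiff f j x + pdiff g j x"
    using pdiff_eqI[OF has_derivative_add[OF assms(1)[unfolded frechet_derivative_works] assms(2)[unfolded frechet_derivative_works]]]
    by (simp add: pdiff_def)
qed

lemma pdiff_mult:
  assumes "\<And>x. f differentiable (at x)" "\<And>x. g differentiable (at x)"
  shows "pdiff (\<lambda>x. f x * g x) j = (\<lambda>x. f x * pdiff g j x + pdiff f j x * g x)"
proof
  fix x
  show "pdiff (\<lambda>x. f x * g x) j x = f x * pdiff g j x + pdiff f j x * g x"
    using pdiff_eqI[OF has_derivative_mult[OF assms(1)[unfolded frechet_derivative_works] assms(2)[unfolded frechet_derivative_works]]]
    by (simp add: pdiff_def)
qed

text \<open>The form \<open>a + c *\<^sub>R x\<close> covers two uses: \<open>c = 1\<close> gives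
  translates, \<open>c = - 1\<close> the reflected kernel in a convolution.\<close>

lemma has_derivative_affine_arg:
  fixes f :: "vec2 \<Rightarrow> real"
  assumes "f differentiable (at (a + c *\<^sub>R x))"
  shows "((\<lambda>x. f (a + c *\<^sub>R x)) has_derivative
      (\<lambda>h. frechet_derivative f (at (a + c *\<^sub>R x)) (c *\<^sub>R h))) (at x)"
proof -
  have 1: "((\<lambda>x. a + c *\<^sub>R x) has_derivative (\<lambda>h. c *\<^sub>R h)) (at x)"
    by (auto intro!: derivative_eq_intros)
  from assms have "(f has_derivative frechet_derivative f (at (a + c *\<^sub>R x))) (at (a + c *\<^sub>R x))"
    using frechet_derivative_works by blast
  from has_derivative_compose[OF 1 this] show ?thesis .
qed

lemma pdiff_affine_arg:
  fixes f :: "vec2 \<Rightarrow> real"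
  assumes "\<And>x. f differentiable (at x)"
  shows "pdiff (\<lambda>x. f (a + c *\<^sub>R x)) j = (\<lambda>x. c * pdiff f j (a + c *\<^sub>R x))"
proof
  fix x
  have lin: "linear (frechet_derivative f (at (a + c *\<^sub>R x)))"
    using assms linear_frechet_derivative by blast
  show "pdiff (\<lambda>x. f (a + c *\<^sub>R x)) j x = c * pdiff f j (a + c *\<^sub>R x)"
    by (subst pdiff_eqI[OF has_derivative_affine_arg[OF assms]])
      (simp add: linear_cmul[OF lin] pdiff_def)
qed

lemma Ck_const: "Ck n (\<lambda>x. c)"
  by (induction n arbitrary: c) auto

lemma Ck_add: "Ck n f \<Longrightarrow> Ck n g \<Longrightarrow> Ck n (\<lambda>x. f x + g x)"
  by (induction n arbitrary: f g) (auto simp: pdiff_add)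

lemma Ck_mult: "Ck n f \<Longrightarrow> Ck n g \<Longrightarrow> Ck n (\<lambda>x. f x * g x)"
proof (induction n arbitrary: f g)
  case (Suc n)
  then have "Ck n f" "Ck n g" by (blast dest: Ck_Suc_imp_Ck)+
  with Suc show ?case by (auto simp: pdiff_mult intro!: Ck_add Suc.IH)
qed simp

lemma smooth2_const: "smooth2 (\<lambda>x. c)"
  by (simp add: smooth2_iff_Ck Ck_const)

lemma smooth2_add: "smooth2 f \<Longrightarrow> smooth2 g \<Longrightarrow> smooth2 (\<lambda>x. f x + g x)"
  by (simp add: smooth2_iff_Ck Ck_add)

lemma smooth2_mult: "smooth2 f \<Longrightarrow> smooth2 g \<Longrightarrow> smooth2 (\<lambda>x. f x * g x)"
  by (simp add: smooth2_iff_Ck Ck_mult)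

lemma smooth2_diff: "smooth2 f \<Longrightarrow> smooth2 g \<Longrightarrow> smooth2 (\<lambda>x. f x - g x)"
  using smooth2_add[of f "\<lambda>x. (-1) * g x"] smooth2_mult[OF smooth2_const[of "-1"]] by simp

lemma Ck_affine_arg: "Ck n f \<Longrightarrow> Ck n (\<lambda>x. f (a + c *\<^sub>R x))"
proof (induction n arbitrary: f)
  case (Suc n)
  then have "\<And>x. (\<lambda>x. f (a + c *\<^sub>R x)) differentiable (at x)"
    using has_derivative_affine_arg differentiable_def by (metis Ck.simps(2))
  with Suc show ?case
    by (auto simp: pdiff_affine_arg intro!: Ck_mult Ck_const)
qed simp

lemma smooth2_affine_arg: "smooth2 f \<Longrightarrow> smooth2 (\<lambda>x. f (a + c *\<^sub>R x))"
  by (simp add: smooth2_iff_Ck Ck_affine_arg)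

lemmas pdiff_smooth2_add = pdiff_add[OF smooth2_differentiable smooth2_differentiable]
lemmas pdiff_smooth2_mult = pdiff_mult[OF smooth2_differentiable smooth2_differentiable]
lemmas pdiff_smooth2_affine_arg = pdiff_affine_arg[OF smooth2_differentiable]

lemma pdiff_smooth2_diff:
  assumes "smooth2 f" "smooth2 g"
  shows "pdiff (\<lambda>x. f x - g x) j = (\<lambda>x. pdiff f j x - pdiff g j x)"
proof -
  have "pdiff (\<lambda>x. f x + (-1) * g x) j = (\<lambda>x. pdiff f j x + (-1) * pdiff g j x)"
    using assms by (simp only: pdiff_smooth2_add pdiff_smooth2_mult smooth2_mult smooth2_const pdiff_const) simp
  then show ?thesis by simp
qed

lemma smooth2_component: "smooth2 (\<lambda>x. x $ j)"
proof -
  have d: "((\<lambda>x::vec2. x $ j) has_derivative (\<lambda>h. h $ j)) (at x)" for x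
    by (rule bounded_linear_imp_has_derivative) (rule bounded_linear_vec_nth)
  have "pdiff (\<lambda>x. x $ j) k = (\<lambda>x. axis k 1 $ j)" for k
    by (rule ext) (rule pdiff_eqI[OF d])
  then have "Ck n (\<lambda>x. x $ j)" for n
    using d by (cases n) (auto simp: Ck_const differentiable_def)
  then show ?thesis by (simp add: smooth2_iff_Ck)
qed

text \<open>The classical function exp(-1/t), extended by 0 to the left half-line. The polynomial
  factor in 1/t makes the family closed under differentiation.\<close>

definition flat :: "real poly \<Rightarrow> real \<Rightarrow> real" where
  "flat p t = (if t \<le> 0 then 0 else poly p (1 / t) * exp (- (1 / t)))"

lemma poly_exp_minus_tendsto_0: "((\<lambda>y::real. poly p y * exp (- y)) \<longlongrightarrow> 0) at_top"
proof -
  have "((\<lambda>y. \<Sum>i\<le>degree p. coeff p i * (y ^ i / exp y)) \<longlongrightarrow> (\<Sum>i\<le>degree p. coeff p i * 0)) at_top"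
    by (intro tendsto_intros tendsto_power_div_exp_0)
  moreover have "(\<lambda>y. \<Sum>i\<le>degree p. coeff p i * (y ^ i / exp y)) = (\<lambda>y. poly p y * exp (- y))"
    by (simp add: poly_altdef sum_distrib_right exp_minus divide_inverse mult.assoc)
  ultimately show ?thesis by simp
qed

text \<open>With s = 1/t the chain rule gives -s^2 (p'(s) - p(s)) exp(-s), hence the polynomial X^2
  (p - p'), where \<open>[:0, 0, 1:]\<close> is X^2. At \<open>t = 0\<close> the right difference
  quotient is \<open>(pCons 0 p)\<close> at 1/h times exp(-1/h), and exponential decay beats the
  polynomial.\<close>

lemma flat_has_derivative:
  "(flat p has_real_derivative flat ([:0, 0, 1:] * (p - pderiv p)) t) (at t)"
proof -
  consider "t < 0" | "t = 0" | "t > 0" by linarith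
  then show ?thesis
  proof cases
    case 1
    have "((\<lambda>x. 0) has_real_derivative 0) (at t)" by simp
    then have "(flat p has_real_derivative 0) (at t)"
      by (rule has_field_derivative_transform_within_open[where S="{..<0}"]) (use 1 in \<open>auto simp: flat_def\<close>)
    with 1 show ?thesis by (simp add: flat_def)
  next
    case 2
    have "((\<lambda>h. flat p h / h) \<longlongrightarrow> 0) (at_right 0)"
    proof -
      have "((\<lambda>h. poly (pCons 0 p) (inverse h) * exp (- inverse h)) \<longlongrightarrow> 0) (at_right (0::real))"
        by (rule filterlim_compose[OF poly_exp_minus_tendsto_0 filterlim_inverse_at_top_right])
      then show ?thesis
        by (rule Lim_transform_eventually)
          (auto simp: eventually_at_right_less flat_def field_simps intro!: eventually_at_rightI[of 0 1])
    qed
    moreover have "((\<lambda>h. flat p h / h) \<longlongrightarrow> 0) (at_left 0)"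
      by (rule tendsto_eventually) (auto simp: flat_def intro!: eventually_at_leftI[of "-1" 0])
    ultimately have "((\<lambda>h. flat p h / h) \<longlongrightarrow> 0) (at 0)"
      by (rule filterlim_split_at[rotated])
    with 2 show ?thesis by (simp add: has_field_derivative_iff flat_def)
  next
    case 3
    have "((\<lambda>t. poly p (1 / t) * exp (- (1 / t))) has_real_derivative
        poly ([:0, 0, 1:] * (p - pderiv p)) (1 / t) * exp (- (1 / t))) (at t)"
      using 3 by (auto intro!: derivative_eq_intros simp: field_simps power2_eq_square)
    then have "(flat p has_real_derivative
        poly ([:0, 0, 1:] * (p - pderiv p)) (1 / t) * exp (- (1 / t))) (at t)"
      by (rule has_field_derivative_transform_within_open[where S="{0<..}"]) (use 3 in \<open>auto simp: flat_def\<close>)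
    with 3 show ?thesis by (simp add: flat_def)
  qed
qed

lemma Ck_flat_comp:
  assumes "smooth2 q"
  shows "Ck n (\<lambda>x. flat p (q x))"
proof (induction n arbitrary: p)
  case (Suc n)
  have d: "((\<lambda>x. flat p (q x)) has_derivative
      (\<lambda>h. frechet_derivative q (at x) h * flat ([:0, 0, 1:] * (p - pderiv p)) (q x))) (at x)" for x
    using has_derivative_compose[OF smooth2_has_derivative[OF assms]
        flat_has_derivative[of p "q x", unfolded has_field_derivative_def]]
    by (simp add: mult.commute)
  have "pdiff (\<lambda>x. flat p (q x)) j = (\<lambda>x. pdiff q j x * flat ([:0, 0, 1:] * (p - pderiv p)) (q x))" for j
    by (rule ext) (simp add: pdiff_eqI[OF d] pdiff_def[of q])
  moreover have "Ck n (pdiff q j)" for j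
    using smooth2_pdiff[OF assms] by (auto simp: smooth2_iff_Ck)
  ultimately show ?case
    using d Suc by (auto simp: differentiable_def simp del: mult_pCons_left intro!: Ck_mult)
qed simp

section \<open>Test functions and their closure properties\<close>

text \<open>Any compact set outside which the function vanishes may take the place of the support,
  so closures need not be computed in later constructions.\<close>

lemma test_fun_iff:
  "test_fun \<Omega> \<phi> \<longleftrightarrow> smooth2 \<phi> \<and> (\<exists>S. compact S \<and> S \<subseteq> \<Omega> \<and> (\<forall>x. x \<notin> S \<longrightarrow> \<phi> x = 0))"
proof
  assume "test_fun \<Omega> \<phi>"
  then show "smooth2 \<phi> \<and> (\<exists>S. compact S \<and> S \<subseteq> \<Omega> \<and> (\<forall>x. x \<notin> S \<longrightarrow> \<phi> x = 0))"
    unfolding test_fun_def using closure_subset[of "{x. \<phi> x \<noteq> 0}"]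
    by (intro conjI exI[of _ "closure {x. \<phi> x \<noteq> 0}"]) auto
next
  assume "smooth2 \<phi> \<and> (\<exists>S. compact S \<and> S \<subseteq> \<Omega> \<and> (\<forall>x. x \<notin> S \<longrightarrow> \<phi> x = 0))"
  then obtain S where S: "smooth2 \<phi>" "compact S" "S \<subseteq> \<Omega>" "\<And>x. x \<notin> S \<Longrightarrow> \<phi> x = 0" by blast
  then have "closure {x. \<phi> x \<noteq> 0} \<subseteq> S"
    by (intro closure_minimal) (auto simp: compact_imp_closed)
  with S show "test_fun \<Omega> \<phi>"
    unfolding test_fun_def using compact_Int_closed[OF S(2) closed_closure[of "{x. \<phi> x \<noteq> 0}"]]
    by (simp add: inf.absorb2)
qed

lemma test_funI:
  "smooth2 \<phi> \<Longrightarrow> compact S \<Longrightarrow> S \<subseteq> \<Omega> \<Longrightarrow> (\<And>x. x \<notin> S \<Longrightarrow> \<phi> x = 0) \<Longrightarrow> test_fun \<Omega> \<phi>"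
  by (auto simp: test_fun_iff)

lemma test_funE:
  assumes "test_fun \<Omega> \<phi>"
  obtains S where "smooth2 \<phi>" "compact S" "S \<subseteq> \<Omega>" "\<And>x. x \<notin> S \<Longrightarrow> \<phi> x = 0"
  using assms unfolding test_fun_iff by blast

lemma test_fun_smooth2: "test_fun \<Omega> \<phi> \<Longrightarrow> smooth2 \<phi>"
  by (simp add: test_fun_def)

lemma test_fun_mono: "test_fun \<Omega> \<phi> \<Longrightarrow> \<Omega> \<subseteq> \<Omega>' \<Longrightarrow> test_fun \<Omega>' \<phi>"
  by (auto simp: test_fun_def)

lemma test_fun_outside: "test_fun \<Omega> \<phi> \<Longrightarrow> x \<notin> \<Omega> \<Longrightarrow> \<phi> x = 0"
  by (auto simp: test_fun_iff)

lemma pdiff_eq_0_if_open: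
  assumes "open U" "x \<in> U" "\<And>y. y \<in> U \<Longrightarrow> f y = c"
  shows "pdiff f j x = 0"
proof -
  have "((\<lambda>x. c) has_derivative (\<lambda>h. 0)) (at x)" by simp
  then have "(f has_derivative (\<lambda>h. 0)) (at x)"
    by (rule has_derivative_transform_within_open[OF _ assms(1,2)]) (simp add: assms(3))
  then show ?thesis by (rule pdiff_eqI)
qed

lemma test_fun_pdiff:
  assumes "test_fun \<Omega> \<phi>"
  shows "test_fun \<Omega> (pdiff \<phi> j)"
proof -
  from assms obtain S where S: "smooth2 \<phi>" "compact S" "S \<subseteq> \<Omega>" "\<And>x. x \<notin> S \<Longrightarrow> \<phi> x = 0"
    by (auto simp: test_fun_iff)
  show ?thesis
  proof (rule test_funI[OF smooth2_pdiff[OF S(1)] S(2,3)])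
    fix x assume "x \<notin> S"
    then show "pdiff \<phi> j x = 0"
      by (intro pdiff_eq_0_if_open[of "- S"]) (auto simp: S compact_imp_closed)
  qed
qed

lemma test_fun_smooth2_mult:
  assumes "smooth2 f" "test_fun \<Omega> \<phi>"
  shows "test_fun \<Omega> (\<lambda>x. f x * \<phi> x)"
  using assms(2)
proof (rule test_funE)
  fix S assume "smooth2 \<phi>" "compact S" "S \<subseteq> \<Omega>" "\<And>x. x \<notin> S \<Longrightarrow> \<phi> x = 0"
  then show ?thesis using assms by (intro test_funI[of _ S]) (auto intro: smooth2_mult)
qed

lemma test_fun_cmult: "test_fun \<Omega> \<phi> \<Longrightarrow> test_fun \<Omega> (\<lambda>x. c * \<phi> x)"
  by (rule test_fun_smooth2_mult[OF smooth2_const])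

lemma test_fun_add:
  assumes "test_fun \<Omega> \<phi>" "test_fun \<Omega> \<psi>"
  shows "test_fun \<Omega> (\<lambda>x. \<phi> x + \<psi> x)"
proof -
  from assms obtain S T where "smooth2 \<phi>" "compact S" "S \<subseteq> \<Omega>" "\<And>x. x \<notin> S \<Longrightarrow> \<phi> x = 0"
    "smooth2 \<psi>" "compact T" "T \<subseteq> \<Omega>" "\<And>x. x \<notin> T \<Longrightarrow> \<psi> x = 0"
    by (auto simp: test_fun_iff)
  then show ?thesis by (intro test_funI[of _ "S \<union> T"]) (auto intro: smooth2_add)
qed

lemma test_fun_diff:
  "test_fun \<Omega> \<phi> \<Longrightarrow> test_fun \<Omega> \<psi> \<Longrightarrow> test_fun \<Omega> (\<lambda>x. \<phi> x - \<psi> x)"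
  using test_fun_add[of \<Omega> \<phi> "\<lambda>x. (-1) * \<psi> x"] test_fun_cmult[of \<Omega> \<psi> "-1"] by simp

lemma test_fun_affine_arg:
  assumes "test_fun UNIV \<phi>" "c \<noteq> 0"
  shows "test_fun UNIV (\<lambda>x. \<phi> (a + c *\<^sub>R x))"
proof -
  from assms(1) obtain S where S: "smooth2 \<phi>" "compact S" "S \<subseteq> UNIV" "\<And>x. x \<notin> S \<Longrightarrow> \<phi> x = 0"
    by (auto simp: test_fun_iff)
  show ?thesis
  proof (rule test_funI[of _ "(\<lambda>y. (1 / c) *\<^sub>R (y - a)) ` S"])
    show "compact ((\<lambda>y. (1 / c) *\<^sub>R (y - a)) ` S)"
      by (intro compact_continuous_image continuous_intros S)
    fix x assume "x \<notin> (\<lambda>y. (1 / c) *\<^sub>R (y - a)) ` S"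
    then have "a + c *\<^sub>R x \<notin> S"
      using assms(2) by (auto simp: image_iff dest!: bspec[of _ _ "a + c *\<^sub>R x"])
    then show "\<phi> (a + c *\<^sub>R x) = 0" by (rule S)
  qed (auto intro: smooth2_affine_arg S)
qed

lemma test_fun_shift: "test_fun UNIV \<phi> \<Longrightarrow> test_fun UNIV (\<lambda>x. \<phi> (x + a))"
  using test_fun_affine_arg[of \<phi> 1 a] by (simp add: add.commute)

lemma test_fun_bounded:
  assumes "test_fun \<Omega> \<phi>"
  obtains M where "M > 0" "\<And>x. \<bar>\<phi> x\<bar> \<le> M"
proof -
  from assms obtain S where S: "smooth2 \<phi>" "compact S" "S \<subseteq> \<Omega>" "\<And>x. x \<notin> S \<Longrightarrow> \<phi> x = 0"
    by (auto simp: test_fun_iff)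
  have "bounded (\<phi> ` S)"
    by (intro compact_imp_bounded compact_continuous_image S smooth2_continuous_on)
  then obtain M where "M > 0" "\<And>x. x \<in> S \<Longrightarrow> \<bar>\<phi> x\<bar> \<le> M" by (auto simp: bounded_pos)
  then have "\<bar>\<phi> x\<bar> \<le> M" for x using S(4)[of x] by (cases "x \<in> S") auto
  with \<open>M > 0\<close> that show thesis by blast
qed

lemma test_fun_measurable: "test_fun \<Omega> \<phi> \<Longrightarrow> \<phi> \<in> borel_measurable borel"
  by (simp add: smooth2_measurable test_fun_def)

lemma test_fun_integrable:
  assumes "test_fun \<Omega> \<phi>"
  shows "integrable lborel \<phi>"
proof -
  from assms obtain S where S: "smooth2 \<phi>" "compact S" "S \<subseteq> \<Omega>" "\<And>x. x \<notin> S \<Longrightarrow> \<phi> x = 0"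
    by (auto simp: test_fun_iff)
  have "integrable lborel (\<lambda>x. indicator S x *\<^sub>R \<phi> x)"
    using borel_integrable_compact[OF S(2), of \<phi>] S(1)
    by (simp add: smooth2_continuous_on indicator_def if_distrib cong: if_cong)
  moreover have "(\<lambda>x. indicator S x *\<^sub>R \<phi> x) = \<phi>"
    using S(4) by (auto simp: indicator_def fun_eq_iff)
  ultimately show ?thesis by simp
qed

text \<open>Mean value inequality with the bounded partial derivatives. The constant later dominates
  difference quotients under the integral sign.\<close>

lemma test_fun_lipschitz:
  assumes "test_fun \<Omega> \<phi>"
  obtains L where "L > 0" "\<And>x y. \<bar>\<phi> x - \<phi> y\<bar> \<le> L * norm (x - y)"
proof -
  have "\<exists>M. M > 0 \<and> (\<forall>x. \<bar>pdiff \<phi> j x\<bar> \<le> M)" for j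
    using test_fun_bounded[OF test_fun_pdiff[OF assms]] by metis
  then obtain M where M: "\<And>j. M j > 0" "\<And>j x. \<bar>pdiff \<phi> j x\<bar> \<le> M j" by metis
  define L where "L = (\<Sum>j\<in>UNIV. M j)"
  have d: "(\<phi> has_derivative (\<lambda>h. \<Sum>j\<in>UNIV. h $ j * pdiff \<phi> j x)) (at x)" for x
    using has_derivative_pdiff[OF smooth2_differentiable[OF test_fun_smooth2[OF assms]]] .
  have b: "onorm (\<lambda>h. \<Sum>j\<in>UNIV. h $ j * pdiff \<phi> j x) \<le> L" for x
  proof (rule onorm_le)
    fix h :: vec2
    have "norm (\<Sum>j\<in>UNIV. h $ j * pdiff \<phi> j x) \<le> (\<Sum>j\<in>UNIV. norm (h $ j * pdiff \<phi> j x))"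
      by (rule norm_sum)
    also have "\<dots> \<le> (\<Sum>j\<in>UNIV. norm h * M j)"
      by (intro sum_mono) (auto simp: abs_mult intro!: mult_mono component_le_norm_cart M)
    finally show "norm (\<Sum>j\<in>UNIV. h $ j * pdiff \<phi> j x) \<le> L * norm h"
      by (simp add: L_def sum_distrib_left mult.commute)
  qed
  have "\<bar>\<phi> x - \<phi> y\<bar> \<le> L * norm (x - y)" for x y
    using differentiable_bound[of UNIV \<phi> "\<lambda>x h. \<Sum>j\<in>UNIV. h $ j * pdiff \<phi> j x" L x y] d b
    by (auto simp: has_derivative_at_withinI)
  moreover have "L > 0" unfolding L_def by (rule sum_pos) (auto simp: M)
  ultimately show thesis using that by blast
qed

subsection \<open>Square integrable functions\<close>

definition sqint :: "'a measure \<Rightarrow> ('a \<Rightarrow> real) \<Rightarrow> bool" where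
  "sqint M f \<longleftrightarrow> f \<in> borel_measurable M \<and> integrable M (\<lambda>x. (f x)\<^sup>2)"

text \<open>Functions are not identified up to null sets, so this is only a seminorm.\<close>

definition l2 :: "'a measure \<Rightarrow> ('a \<Rightarrow> real) \<Rightarrow> real" where
  "l2 M f = sqrt (\<integral>x. (f x)\<^sup>2 \<partial>M)"

lemma sqint_measurable: "sqint M f \<Longrightarrow> f \<in> borel_measurable M"
  by (simp add: sqint_def)

lemma sqint_bound:
  assumes "sqint M f" "g \<in> borel_measurable M" "\<And>x. \<bar>g x\<bar> \<le> C * \<bar>f x\<bar>"
  shows "sqint M g"
  unfolding sqint_def
proof
  have "integrable M (\<lambda>x. C\<^sup>2 * (f x)\<^sup>2)" using assms(1) by (simp add: sqint_def)
  then show "integrable M (\<lambda>x. (g x)\<^sup>2)"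
  proof (rule Bochner_Integration.integrable_bound)
    have "(g x)\<^sup>2 \<le> (C * f x)\<^sup>2" for x
      by (rule abs_le_square_iff[THEN iffD1], rule order_trans[OF assms(3)])
        (simp add: abs_mult mult_right_mono)
    then show "AE x in M. norm ((g x)\<^sup>2) \<le> norm (C\<^sup>2 * (f x)\<^sup>2)"
      by (auto simp: power_mult_distrib)
  qed (use assms in measurable)
qed fact

lemma sqint_mult_integrable:
  assumes "sqint M f" "sqint M g"
  shows "integrable M (\<lambda>x. f x * g x)"
proof (rule Bochner_Integration.integrable_bound)
  show "integrable M (\<lambda>x. (f x)\<^sup>2 + (g x)\<^sup>2)" using assms by (simp add: sqint_def)
  show "(\<lambda>x. f x * g x) \<in> borel_measurable M" using assms by (auto simp: sqint_def)
  have "\<bar>a * b\<bar> \<le> a\<^sup>2 + b\<^sup>2" for a b :: real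
  proof -
    have "2 * \<bar>a * b\<bar> \<le> a\<^sup>2 + b\<^sup>2"
      using sum_squares_bound[of "\<bar>a\<bar>" "\<bar>b\<bar>"] by (simp add: abs_mult mult.assoc)
    then show ?thesis using abs_ge_zero[of "a * b"] by linarith
  qed
  then show "AE x in M. norm (f x * g x) \<le> norm ((f x)\<^sup>2 + (g x)\<^sup>2)" by auto
qed

lemma sqint_cmult: "sqint M f \<Longrightarrow> sqint M (\<lambda>x. c * f x)"
  by (auto simp: sqint_def power_mult_distrib)

lemma sqint_add:
  assumes "sqint M f" "sqint M g"
  shows "sqint M (\<lambda>x. f x + g x)"
  unfolding sqint_def
proof
  have "integrable M (\<lambda>x. (f x)\<^sup>2 + (g x)\<^sup>2 + 2 * (f x * g x))"
    using assms sqint_mult_integrable[OF assms] by (simp add: sqint_def)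
  then show "integrable M (\<lambda>x. (f x + g x)\<^sup>2)" by (simp add: power2_sum mult.assoc)
qed (use assms in \<open>auto simp: sqint_def intro: borel_measurable_add\<close>)

lemma sqint_diff:
  "sqint M f \<Longrightarrow> sqint M g \<Longrightarrow> sqint M (\<lambda>x. f x - g x)"
  using sqint_add[of M f "\<lambda>x. (-1) * g x"] sqint_cmult[of M g "-1"] by simp

lemma sqint_bounded_mult:
  assumes "sqint M f" "h \<in> borel_measurable M" "\<And>x. \<bar>h x\<bar> \<le> C"
  shows "sqint M (\<lambda>x. h x * f x)"
proof (rule sqint_bound[OF assms(1)])
  show "(\<lambda>x. h x * f x) \<in> borel_measurable M"
    using assms(2) sqint_measurable[OF assms(1)] by (rule borel_measurable_times)
  show "\<bar>h x * f x\<bar> \<le> C * \<bar>f x\<bar>" for x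
    by (simp add: abs_mult assms(3) mult_right_mono)
qed

lemma l2_nonneg [simp]: "0 \<le> l2 M f"
  by (simp add: l2_def)

lemma l2_power2: "(l2 M f)\<^sup>2 = (\<integral>x. (f x)\<^sup>2 \<partial>M)"
  by (simp add: l2_def)

lemma l2_cmult: "l2 M (\<lambda>x. c * f x) = \<bar>c\<bar> * l2 M f"
  by (simp add: l2_def power_mult_distrib real_sqrt_mult)

lemma l2_minus_commute: "l2 M (\<lambda>x. f x - g x) = l2 M (\<lambda>x. g x - f x)"
  by (simp add: l2_def power2_commute)

lemma l2_bound:
  assumes "sqint M f" "sqint M g" "\<And>x. \<bar>g x\<bar> \<le> C * \<bar>f x\<bar>" "C \<ge> 0"
  shows "l2 M g \<le> C * l2 M f"
proof -
  have "(g x)\<^sup>2 \<le> (C * f x)\<^sup>2" for x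
    by (rule abs_le_square_iff[THEN iffD1]) (use assms in \<open>simp add: abs_mult\<close>)
  then have "(\<integral>x. (g x)\<^sup>2 \<partial>M) \<le> (\<integral>x. (C * f x)\<^sup>2 \<partial>M)"
    using assms by (intro integral_mono) (auto simp: sqint_def power_mult_distrib)
  then have "l2 M g \<le> l2 M (\<lambda>x. C * f x)" by (simp add: l2_def)
  with assms(4) show ?thesis by (simp add: l2_cmult)
qed

text \<open>For \<open>c > 0\<close> evaluate at the minimiser \<open>t = - b / c\<close>; for
  \<open>c = 0\<close> an affine function bounded below has slope zero. This yields Cauchy-Schwarz
  and, with \<open>a = 0\<close>, the first-order condition in the Riesz argument.\<close>

lemma nonneg_quadratic_imp:
  fixes a b c :: real
  assumes "\<And>t. 0 \<le> a + 2 * t * b + t\<^sup>2 * c" "c \<ge> 0"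
  shows "b\<^sup>2 \<le> a * c"
proof (cases "c = 0")
  case True
  have "b = 0"
  proof (rule ccontr)
    assume "b \<noteq> 0"
    \<comment> \<open>At this \<open>t\<close> the affine expression takes the value -1.\<close>
    then show False using assms(1)[of "- (a + 1) / (2 * b)"] True by (simp add: field_simps)
  qed
  with True show ?thesis by simp
next
  case False
  then have "0 \<le> (a + 2 * (- b / c) * b + (- b / c)\<^sup>2 * c) * c"
    using assms(1)[of "- b / c"] assms(2) by (intro mult_nonneg_nonneg) auto
  also have "\<dots> = a * c - b\<^sup>2" using False by (simp add: field_simps power2_eq_square)
  finally show ?thesis by simp
qed

lemma l2_Cauchy_Schwarz:
  assumes "sqint M f" "sqint M g"
  shows "\<bar>\<integral>x. f x * g x \<partial>M\<bar> \<le> l2 M f * l2 M g"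
proof -
  have fg: "integrable M (\<lambda>x. f x * g x)" by (rule sqint_mult_integrable[OF assms])
  have "(\<integral>x. f x * g x \<partial>M)\<^sup>2 \<le> (\<integral>x. (f x)\<^sup>2 \<partial>M) * (\<integral>x. (g x)\<^sup>2 \<partial>M)"
  proof (rule nonneg_quadratic_imp)
    fix t :: real
    have "0 \<le> (\<integral>x. (f x + t * g x)\<^sup>2 \<partial>M)" by simp
    also have "\<dots> = (\<integral>x. (f x)\<^sup>2 + 2 * t * (f x * g x) + t\<^sup>2 * (g x)\<^sup>2 \<partial>M)"
      by (rule Bochner_Integration.integral_cong) (auto simp: power2_eq_square algebra_simps)
    also have "\<dots> = (\<integral>x. (f x)\<^sup>2 \<partial>M) + 2 * t * (\<integral>x. f x * g x \<partial>M) + t\<^sup>2 * (\<integral>x. (g x)\<^sup>2 \<partial>M)"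
      using assms fg by (simp add: sqint_def)
    finally show "0 \<le> (\<integral>x. (f x)\<^sup>2 \<partial>M) + 2 * t * (\<integral>x. f x * g x \<partial>M) + t\<^sup>2 * (\<integral>x. (g x)\<^sup>2 \<partial>M)" .
  qed simp
  then have "\<bar>\<integral>x. f x * g x \<partial>M\<bar>\<^sup>2 \<le> (l2 M f * l2 M g)\<^sup>2"
    by (simp add: power_mult_distrib l2_power2)
  then show ?thesis by (rule power2_le_imp_le) simp
qed

lemma l2_triangle:
  assumes "sqint M f" "sqint M g"
  shows "l2 M (\<lambda>x. f x + g x) \<le> l2 M f + l2 M g"
proof -
  have fg: "integrable M (\<lambda>x. f x * g x)" by (rule sqint_mult_integrable[OF assms])
  have "(l2 M (\<lambda>x. f x + g x))\<^sup>2 = (\<integral>x. (f x)\<^sup>2 + 2 * (f x * g x) + (g x)\<^sup>2 \<partial>M)"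
    unfolding l2_power2 by (rule Bochner_Integration.integral_cong) (auto simp: power2_eq_square algebra_simps)
  also have "\<dots> = (l2 M f)\<^sup>2 + 2 * (\<integral>x. f x * g x \<partial>M) + (l2 M g)\<^sup>2"
    using assms fg by (simp add: sqint_def l2_power2)
  also have "\<dots> \<le> (l2 M f)\<^sup>2 + 2 * (l2 M f * l2 M g) + (l2 M g)\<^sup>2"
    using l2_Cauchy_Schwarz[OF assms] by simp
  also have "\<dots> = (l2 M f + l2 M g)\<^sup>2" by (simp add: power2_sum)
  finally show ?thesis by (rule power2_le_imp_le) simp
qed

lemma l2_triangle_diff:
  assumes "sqint M f" "sqint M g"
  shows "l2 M (\<lambda>x. f x - g x) \<le> l2 M f + l2 M g"
  using l2_triangle[OF assms(1) sqint_cmult[OF assms(2), of "-1"]] l2_cmult[of M "-1" g] by simp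

lemma test_fun_sqint: "test_fun \<Omega> \<phi> \<Longrightarrow> sqint lborel \<phi>"
  using test_fun_smooth2_mult[of \<phi> \<Omega> \<phi>, THEN test_fun_integrable]
  by (simp add: sqint_def test_fun_measurable test_fun_smooth2 power2_eq_square)

section \<open>Translation invariance\<close>

lemma integrable_lborel_shift_iff:
  fixes f :: "vec2 \<Rightarrow> real"
  assumes [measurable]: "f \<in> borel_measurable borel"
  shows "integrable lborel (\<lambda>x. f (x + a)) \<longleftrightarrow> integrable lborel f"
proof -
  have "integrable lborel f \<longleftrightarrow> integrable (distr lborel borel ((+) a)) f"
    by (simp add: lborel_distr_plus)
  also have "\<dots> \<longleftrightarrow> integrable lborel (\<lambda>x. f (a + x))" by (subst integrable_distr_eq) auto
  finally show ?thesis by (simp add: add.commute)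
qed

lemma integral_lborel_shift:
  fixes f :: "vec2 \<Rightarrow> real"
  assumes [measurable]: "f \<in> borel_measurable borel"
  shows "(\<integral>x. f (x + a) \<partial>lborel) = (\<integral>x. f x \<partial>lborel)"
proof -
  have "(\<integral>x. f x \<partial>lborel) = (\<integral>x. f x \<partial>distr lborel borel ((+) a))"
    by (simp add: lborel_distr_plus)
  also have "\<dots> = (\<integral>x. f (a + x) \<partial>lborel)" by (subst integral_distr) auto
  finally show ?thesis by (simp add: add.commute)
qed

lemma sqint_shift:
  fixes f :: "vec2 \<Rightarrow> real"
  assumes "sqint lborel f"
  shows "sqint lborel (\<lambda>x. f (x + a))"
  using assms integrable_lborel_shift_iff[of "\<lambda>x. (f x)\<^sup>2" a] by (auto simp: sqint_def)

lemma l2_shift: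
  fixes f :: "vec2 \<Rightarrow> real"
  assumes "sqint lborel f"
  shows "l2 lborel (\<lambda>x. f (x + a)) = l2 lborel f"
  using assms integral_lborel_shift[of "\<lambda>x. (f x)\<^sup>2" a] by (auto simp: sqint_def l2_def)

subsection \<open>Convolution and mollification\<close>

lemma integrable_mult_bounded:
  fixes f g :: "'a \<Rightarrow> real"
  assumes "integrable M f" "g \<in> borel_measurable M" "\<And>x. \<bar>g x\<bar> \<le> C"
  shows "integrable M (\<lambda>x. f x * g x)"
proof (rule Bochner_Integration.integrable_bound)
  show "integrable M (\<lambda>x. C * f x)" using assms(1) by simp
  show "(\<lambda>x. f x * g x) \<in> borel_measurable M"
    by (rule borel_measurable_times[OF borel_measurable_integrable[OF assms(1)] assms(2)])
  have "\<bar>f x * g x\<bar> \<le> \<bar>C * f x\<bar>" for x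
    using mult_right_mono[OF order_trans[OF assms(3)[of x] abs_ge_self[of C]] abs_ge_zero[of "f x"]]
    by (simp add: abs_mult mult.commute)
  then show "AE x in M. norm (f x * g x) \<le> norm (C * f x)" by simp
qed

text \<open>For \<open>c = - 1\<close> this is the convolution of \<open>f\<close> and
  \<open>J\<close>. For \<open>c = 1\<close> it is the pairing of \<open>f\<close> with the
  translate of \<open>J\<close> by \<open>x\<close>, whose derivative in \<open>x\<close> controls
  difference quotients.\<close>

definition kint :: "real \<Rightarrow> (vec2 \<Rightarrow> real) \<Rightarrow> (vec2 \<Rightarrow> real) \<Rightarrow> vec2 \<Rightarrow> real" where
  "kint c f J x = (\<integral>y. f y * J (x + c *\<^sub>R y) \<partial>lborel)"

lemma kint_integrable:
  assumes "integrable lborel f" "test_fun UNIV J"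
  shows "integrable lborel (\<lambda>y. f y * J (x + c *\<^sub>R y))"
proof -
  obtain M where "\<And>x. \<bar>J x\<bar> \<le> M" using test_fun_bounded[OF assms(2)] by metis
  moreover have "(\<lambda>y. J (x + c *\<^sub>R y)) \<in> borel_measurable lborel"
    using smooth2_measurable[OF smooth2_affine_arg[OF test_fun_smooth2[OF assms(2)]]] by simp
  ultimately show ?thesis by (intro integrable_mult_bounded[OF assms(1)])
qed

text \<open>Differentiation under the integral sign: the Taylor remainder \<open>R\<close> of
  \<open>J\<close>, already divided by the distance, tends to 0 pointwise and is bounded by the
  Lipschitz constant plus the bounds of the partial derivatives. Dominated convergence then applies
  with a multiple of \<open>\<bar>f y\<bar>\<close>.\<close>

lemma kint_has_derivative:
  assumes "integrable lborel f" "test_fun UNIV J"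
  shows "(kint c f J has_derivative (\<lambda>h. \<Sum>j\<in>UNIV. h $ j * kint c f (pdiff J j) x)) (at x)"
  unfolding has_derivative_iff_norm
proof
  show "bounded_linear (\<lambda>h::vec2. \<Sum>j\<in>UNIV. h $ j * kint c f (pdiff J j) x)"
    by (intro bounded_linear_sum bounded_linear_mult_const bounded_linear_vec_nth)
  obtain L where L: "L > 0" "\<And>x y. \<bar>J x - J y\<bar> \<le> L * norm (x - y)"
    using test_fun_lipschitz[OF assms(2)] by metis
  have "\<exists>M. M > 0 \<and> (\<forall>x. \<bar>pdiff J j x\<bar> \<le> M)" for j
    using test_fun_bounded[OF test_fun_pdiff[OF assms(2)]] by metis
  then obtain M where M: "\<And>j. M j > 0" "\<And>j x. \<bar>pdiff J j x\<bar> \<le> M j" by metis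
  note dJ = has_derivative_pdiff[OF smooth2_differentiable[OF test_fun_smooth2[OF assms(2)]],
      unfolded has_derivative_iff_norm, THEN conjunct2]
  define R where "R x' y = (J (x' + c *\<^sub>R y) - J (x + c *\<^sub>R y) -
    (\<Sum>j\<in>UNIV. (x' - x) $ j * pdiff J j (x + c *\<^sub>R y))) / norm (x' - x)" for x' y
  note int = kint_integrable[OF assms(1)]
  have R_int: "(\<integral>y. f y * R x' y \<partial>lborel) = (kint c f J x' - kint c f J x -
    (\<Sum>j\<in>UNIV. (x' - x) $ j * kint c f (pdiff J j) x)) / norm (x' - x)" for x'
  proof -
    have "(\<integral>y. f y * R x' y \<partial>lborel) = (\<integral>y. (f y * J (x' + c *\<^sub>R y) - f y * J (x + c *\<^sub>R y) -
       (\<Sum>j\<in>UNIV. (x' - x) $ j * (f y * pdiff J j (x + c *\<^sub>R y)))) / norm (x' - x) \<partial>lborel)"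
      by (rule Bochner_Integration.integral_cong)
        (simp_all add: R_def right_diff_distrib sum_distrib_left mult.left_commute)
    also have "\<dots> = (kint c f J x' - kint c f J x -
      (\<Sum>j\<in>UNIV. (x' - x) $ j * kint c f (pdiff J j) x)) / norm (x' - x)"
      unfolding kint_def using int[OF assms(2)] int[OF test_fun_pdiff[OF assms(2)]]
      by (simp add: Bochner_Integration.integral_sum)
    finally show ?thesis .
  qed
  have R_bound: "\<bar>R x' y\<bar> \<le> L + (\<Sum>j\<in>UNIV. M j)" if "x' \<noteq> x" for x' y
  proof -
    have "\<bar>\<Sum>j\<in>UNIV. (x' - x) $ j * pdiff J j (x + c *\<^sub>R y)\<bar>
        \<le> (\<Sum>j\<in>UNIV. \<bar>(x' - x) $ j * pdiff J j (x + c *\<^sub>R y)\<bar>)"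
      by (rule sum_abs)
    also have "\<dots> \<le> (\<Sum>j\<in>UNIV. norm (x' - x) * M j)"
      unfolding abs_mult
      by (intro sum_mono mult_mono component_le_norm_cart M) auto
    finally have "\<bar>\<Sum>j\<in>UNIV. (x' - x) $ j * pdiff J j (x + c *\<^sub>R y)\<bar> \<le> (\<Sum>j\<in>UNIV. M j) * norm (x' - x)"
      by (simp add: sum_distrib_right mult.commute)
    moreover have "\<bar>J (x' + c *\<^sub>R y) - J (x + c *\<^sub>R y)\<bar> \<le> L * norm (x' - x)"
      using L(2)[of "x' + c *\<^sub>R y" "x + c *\<^sub>R y"] by simp
    ultimately have "\<bar>J (x' + c *\<^sub>R y) - J (x + c *\<^sub>R y) -
        (\<Sum>j\<in>UNIV. (x' - x) $ j * pdiff J j (x + c *\<^sub>R y))\<bar> \<le> (L + (\<Sum>j\<in>UNIV. M j)) * norm (x' - x)"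
      by (simp only: distrib_right)
    with that show ?thesis by (simp add: R_def abs_divide divide_le_eq)
  qed
  show "((\<lambda>x'. norm (kint c f J x' - kint c f J x -
      (\<Sum>j\<in>UNIV. (x' - x) $ j * kint c f (pdiff J j) x)) / norm (x' - x)) \<longlongrightarrow> 0) (at x)"
    unfolding tendsto_at_iff_sequentially
  proof (intro allI impI)
    fix X :: "nat \<Rightarrow> vec2" assume X: "\<forall>i. X i \<in> UNIV - {x}" "X \<longlonglongrightarrow> x"
    have "(\<lambda>n. \<integral>y. f y * R (X n) y \<partial>lborel) \<longlonglongrightarrow> (\<integral>y. 0 \<partial>(lborel :: vec2 measure))"
    proof (rule integral_dominated_convergence)
      show "integrable lborel (\<lambda>y. (L + (\<Sum>j\<in>UNIV. M j)) * \<bar>f y\<bar>)"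
        using assms(1) by simp
      have m: "(\<lambda>y. J' (x' + c *\<^sub>R y)) \<in> borel_measurable borel" if "test_fun UNIV J'" for J' x'
        using smooth2_measurable[OF smooth2_affine_arg[OF test_fun_smooth2[OF that]]] .
      have "(\<lambda>y. R (X n) y) \<in> borel_measurable borel" for n
        unfolding R_def
        by (intro borel_measurable_divide borel_measurable_diff borel_measurable_sum borel_measurable_times
            m assms test_fun_pdiff borel_measurable_const)
      then show "(\<lambda>y. f y * R (X n) y) \<in> borel_measurable lborel" for n
        using assms(1) by auto
      show "AE y in lborel. norm (f y * R (X n) y) \<le> (L + (\<Sum>j\<in>UNIV. M j)) * \<bar>f y\<bar>" for n
        using X R_bound by (auto simp: abs_mult mult.commute intro!: mult_mono)
      have "(\<lambda>n. f y * R (X n) y) \<longlonglongrightarrow> f y * 0" for y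
      proof (rule tendsto_mult_left)
        have l: "(\<lambda>n. X n + c *\<^sub>R y) \<longlonglongrightarrow> x + c *\<^sub>R y" using X by (intro tendsto_intros)
        have "((\<lambda>n. norm (J (X n + c *\<^sub>R y) - J (x + c *\<^sub>R y) -
              (\<Sum>j\<in>UNIV. (X n + c *\<^sub>R y - (x + c *\<^sub>R y)) $ j * pdiff J j (x + c *\<^sub>R y))) /
              norm (X n + c *\<^sub>R y - (x + c *\<^sub>R y))) \<longlongrightarrow> 0) sequentially"
          by (rule filterlim_compose[OF dJ]) (use l X in \<open>auto simp: filterlim_at\<close>)
        then have "(\<lambda>n. norm (R (X n) y)) \<longlonglongrightarrow> 0" by (simp add: R_def abs_divide)
        then show "(\<lambda>n. R (X n) y) \<longlonglongrightarrow> 0" by (rule tendsto_norm_zero_cancel)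
      qed
      then show "AE y in lborel. (\<lambda>n. f y * R (X n) y) \<longlonglongrightarrow> 0" by simp
    qed simp
    then have "(\<lambda>n. norm (\<integral>y. f y * R (X n) y \<partial>lborel)) \<longlonglongrightarrow> 0"
      using tendsto_norm_zero by fastforce
    then show "((\<lambda>x'. norm (kint c f J x' - kint c f J x -
      (\<Sum>j\<in>UNIV. (x' - x) $ j * kint c f (pdiff J j) x)) / norm (x' - x)) \<circ> X) \<longlonglongrightarrow> 0"
      by (simp add: R_int o_def abs_divide)
  qed
qed

lemma pdiff_kint:
  assumes "integrable lborel f" "test_fun UNIV J"
  shows "pdiff (kint c f J) j = kint c f (pdiff J j)"
proof
  fix x
  show "pdiff (kint c f J) j x = kint c f (pdiff J j) x"
    by (subst pdiff_eqI[OF kint_has_derivative[OF assms]])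
      (simp add: axis_def if_distrib[of "\<lambda>z. z * _"] cong: if_cong)
qed

lemma smooth2_kint:
  assumes "integrable lborel f" "test_fun UNIV J"
  shows "smooth2 (kint c f J)"
proof -
  have "Ck n (kint c f J)" for n
    using assms(2)
  proof (induction n arbitrary: J)
    case (Suc n)
    then show ?case
      using kint_has_derivative[OF assms(1) Suc.prems]
      by (auto simp: pdiff_kint[OF assms(1)] differentiable_def intro!: Suc.IH test_fun_pdiff)
  qed simp
  then show ?thesis by (simp add: smooth2_iff_Ck)
qed

lemma kint_outside:
  assumes "\<And>y. y \<notin> S \<Longrightarrow> f y = 0" "\<And>z. r \<le> norm z \<Longrightarrow> J z = 0" "\<And>y. y \<in> S \<Longrightarrow> r \<le> dist x y"
  shows "kint (-1) f J x = 0"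
proof -
  have "(\<lambda>y. f y * J (x + (-1) *\<^sub>R y)) = (\<lambda>y. 0)"
  proof
    fix y
    show "f y * J (x + (-1) *\<^sub>R y) = 0"
      using assms(1)[of y] assms(2)[of "x - y"] assms(3)[of y] by (cases "y \<in> S") (auto simp: dist_norm)
  qed
  then show ?thesis by (simp only: kint_def Bochner_Integration.integral_zero)
qed

text \<open>Evenness turns the convolution into the average of the translates
  \<open>f (z + x)\<close> with weight \<open>J z\<close>.\<close>

definition mollifier :: "real \<Rightarrow> (vec2 \<Rightarrow> real) \<Rightarrow> bool" where
  "mollifier r J \<longleftrightarrow> test_fun UNIV J \<and> (\<forall>x. 0 \<le> J x) \<and> (\<forall>x. r \<le> norm x \<longrightarrow> J x = 0) \<and>
     (\<forall>x. J (- x) = J x) \<and> (\<integral>x. J x \<partial>lborel) = 1"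

text \<open>The bump exp(-1/(r^2 - |x|^2)), divided by its integral. That integral is positive
  because the bump is positive on a ball of positive measure.\<close>

lemma ex_mollifier:
  assumes "r > 0"
  obtains J where "mollifier r J"
proof -
  define B where "B x = flat 1 (r\<^sup>2 - x \<bullet> x)" for x :: vec2
  have "smooth2 (\<lambda>x. r\<^sup>2 - (x $ 1 * x $ 1 + x $ 2 * x $ 2))"
    by (intro smooth2_diff smooth2_const smooth2_add smooth2_mult smooth2_component)
  moreover have "B = (\<lambda>x. flat 1 (r\<^sup>2 - (x $ 1 * x $ 1 + x $ 2 * x $ 2)))"
    by (rule ext) (simp add: B_def inner_vec_def sum_2)
  ultimately have sm: "smooth2 B"
    using Ck_flat_comp by (simp only: smooth2_iff_Ck) simp
  have out: "B x = 0" if "r \<le> norm x" for x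
    using that assms power_mono[of r "norm x" 2] by (simp add: B_def flat_def power2_norm_eq_inner)
  have pos: "B x > 0" if "norm x < r" for x
    using that power_strict_mono[of "norm x" r 2] by (simp add: B_def flat_def power2_norm_eq_inner)
  have nn: "B x \<ge> 0" for x by (simp add: B_def flat_def)
  have tf: "test_fun UNIV B"
    by (rule test_funI[OF sm compact_cball[of 0 r]]) (auto intro: out)
  have I: "(\<integral>x. B x \<partial>lborel) > 0"
  proof (rule ccontr)
    assume "\<not> ?thesis"
    moreover have "(\<integral>x. B x \<partial>lborel) \<ge> 0"
      by (rule Bochner_Integration.integral_nonneg) (rule nn)
    ultimately have "(\<integral>x. B x \<partial>lborel) = 0" by linarith
    then have "AE x in lborel. B x = 0"
      using integral_nonneg_eq_0_iff_AE[OF test_fun_integrable[OF tf]] nn by auto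
    then have "AE x in lborel. x \<notin> ball (0::vec2) r" by eventually_elim (use pos in force)
    then have "emeasure lborel (ball (0::vec2) r) = 0"
      by (subst (asm) AE_iff_measurable[of "ball 0 r"]) auto
    moreover have "emeasure lborel (ball (0::vec2) r) \<noteq> 0"
      using assms content_ball_pos[of r "0::vec2"] by (auto simp: measure_def)
    ultimately show False by simp
  qed
  define J where "J x = (1 / (\<integral>x. B x \<partial>lborel)) * B x" for x
  have "mollifier r J"
    unfolding mollifier_def
  proof (intro conjI allI impI)
    show "test_fun UNIV J" unfolding J_def by (rule test_fun_cmult[OF tf])
    show "(\<integral>x. J x \<partial>lborel) = 1" unfolding J_def using I by simp
  qed (use I nn out in \<open>auto simp: J_def B_def\<close>)
  with that show thesis .
qed

lemma integrable_shift:
  fixes f :: "vec2 \<Rightarrow> real"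
  shows "integrable lborel f \<Longrightarrow> integrable lborel (\<lambda>x. f (x + a))"
  using integrable_lborel_shift_iff[of f a] by auto

section \<open>Continuity of translations in L1 and L2\<close>

text \<open>Openness gives \<open>x + z \<in> U\<close> for fixed \<open>x \<in> U\<close> and small
  \<open>z\<close>, so the set of points that leave \<open>U\<close> has measure tending to 0,
  dominated by the indicator of \<open>U\<close>. The points that enter \<open>U\<close> have no
  such dominating function, but by translation invariance they have the same measure; hence the
  factor 2 in \<open>eq\<close>.\<close>

lemma indicator_open_shift_tendsto:
  fixes U :: "vec2 set"
  assumes "open U" "emeasure lborel U < \<infinity>"
  shows "((\<lambda>z. \<integral>x. \<bar>indicator U (x + z) - indicator U x :: real\<bar> \<partial>lborel) \<longlongrightarrow> 0) (at 0)"
proof -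
  have [measurable]: "U \<in> sets borel" using assms(1) by simp
  have iU: "integrable lborel (indicator U :: vec2 \<Rightarrow> real)"
    using assms by (simp add: integrable_indicator_iff)
  have eq: "(\<integral>x. \<bar>indicator U (x + z) - indicator U x :: real\<bar> \<partial>lborel) =
      2 * (\<integral>x. indicator U x * (1 - indicator U (x + z)) \<partial>lborel)" for z
  proof -
    have i: "integrable lborel (\<lambda>x. indicator U x * (1 - indicator U (x + z)) :: real)"
      by (rule integrable_mult_bounded[OF iU, of _ 1]) (auto simp: indicator_def)
    have "(\<integral>x. \<bar>indicator U (x + z) - indicator U x :: real\<bar> \<partial>lborel) =
      (\<integral>x. (indicator U (x + z) - indicator U x) + 2 * (indicator U x * (1 - indicator U (x + z))) \<partial>lborel)"
      by (rule Bochner_Integration.integral_cong) (auto simp: indicator_def)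
    also have "\<dots> = 2 * (\<integral>x. indicator U x * (1 - indicator U (x + z)) \<partial>lborel)"
      using i iU integrable_shift[OF iU, of z] integral_lborel_shift[of "indicator U :: vec2 \<Rightarrow> real" z]
      by simp
    finally show ?thesis .
  qed
  have "((\<lambda>z. \<integral>x. indicator U x * (1 - indicator U (x + z) :: real) \<partial>lborel) \<longlongrightarrow> 0) (at 0)"
    unfolding tendsto_at_iff_sequentially
  proof (intro allI impI)
    fix X :: "nat \<Rightarrow> vec2" assume X: "\<forall>i. X i \<in> UNIV - {0}" "X \<longlonglongrightarrow> 0"
    have "(\<lambda>n. \<integral>x. indicator U x * (1 - indicator U (x + X n) :: real) \<partial>lborel) \<longlonglongrightarrow> (\<integral>x. 0 \<partial>(lborel :: vec2 measure))"
    proof (rule integral_dominated_convergence[where w="indicator U"])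
      have "(\<lambda>n. indicator U x * (1 - indicator U (x + X n) :: real)) \<longlonglongrightarrow> 0" for x
      proof (cases "x \<in> U")
        case True
        have "(\<lambda>n. x + X n) \<longlonglongrightarrow> x" using tendsto_add[OF tendsto_const X(2)] by simp
        then have "\<forall>\<^sub>F n in sequentially. x + X n \<in> U"
          using assms(1) True by (rule topological_tendstoD)
        then show ?thesis by (rule tendsto_eventually[OF eventually_mono]) simp
      qed simp
      then show "AE x in lborel. (\<lambda>n. indicator U x * (1 - indicator U (x + X n) :: real)) \<longlonglongrightarrow> 0" by simp
    qed (use iU in \<open>auto simp: indicator_def\<close>)
    then show "((\<lambda>z. \<integral>x. indicator U x * (1 - indicator U (x + z) :: real) \<partial>lborel) \<circ> X) \<longlonglongrightarrow> 0"
      by (simp add: o_def)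
  qed
  then show ?thesis unfolding eq using tendsto_mult_right_zero by blast
qed

text \<open>A Borel set of finite measure is enclosed in an open set, for which the claim is known.
  The choice \<open>e / 4\<close> accounts for \<open>U - A\<close> entering twice, once translated.
  Sums and limits follow from the triangle inequality and translation invariance.\<close>

lemma L1_shift_tendsto:
  fixes f :: "vec2 \<Rightarrow> real"
  assumes "integrable lborel f"
  shows "((\<lambda>z. \<integral>x. \<bar>f (x + z) - f x\<bar> \<partial>lborel) \<longlongrightarrow> 0) (at 0)"
  using assms
proof (induction rule: integrable_induct)
  case (base A c)
  have [measurable]: "A \<in> sets borel" using base by simp
  have iA: "integrable lborel (indicator A :: vec2 \<Rightarrow> real)"
    using base by (simp add: integrable_indicator_iff)
  have "((\<lambda>z. \<integral>x. \<bar>indicator A (x + z) - indicator A x :: real\<bar> \<partial>lborel) \<longlongrightarrow> 0) (at 0)"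
  proof (rule tendstoI)
    fix e :: real assume "e > 0"
    have "A \<in> sets lebesgue" using base by simp
    then obtain U where U: "open U" "A \<subseteq> U" "emeasure lebesgue (U - A) < ennreal (e / 4)"
      using sets_lebesgue_outer_open[of A "e / 4"] \<open>e > 0\<close> by auto
    have [measurable]: "U \<in> sets borel" using U by simp
    have UA: "emeasure lborel (U - A) < ennreal (e / 4)" using U(3) by simp
    have UAfin: "emeasure lborel (U - A) < \<infinity>"
      using less_trans[OF UA ennreal_less_top] by simp
    have iUA: "integrable lborel (indicator (U - A) :: vec2 \<Rightarrow> real)"
      using UAfin by (simp add: integrable_indicator_iff)
    have mUA: "measure lborel (U - A) < e / 4"
      using UA UAfin \<open>e > 0\<close> by (simp add: emeasure_eq_ennreal_measure ennreal_less_iff)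
    have "emeasure lborel U = emeasure lborel A + emeasure lborel (U - A)"
      using U(2) by (subst plus_emeasure) (auto simp: Un_absorb1)
    then have "emeasure lborel U < \<infinity>"
      using base UAfin by simp
    then have t: "((\<lambda>z. \<integral>x. \<bar>indicator U (x + z) - indicator U x :: real\<bar> \<partial>lborel) \<longlongrightarrow> 0) (at 0)"
      and iU: "integrable lborel (indicator U :: vec2 \<Rightarrow> real)"
      using U by (auto simp: integrable_indicator_iff intro!: indicator_open_shift_tendsto)
    have le: "(\<integral>x. \<bar>indicator A (x + z) - indicator A x :: real\<bar> \<partial>lborel) \<le>
        (\<integral>x. \<bar>indicator U (x + z) - indicator U x :: real\<bar> \<partial>lborel) + 2 * measure lborel (U - A)" for z
    proof -
      have "(\<integral>x. \<bar>indicator A (x + z) - indicator A x :: real\<bar> \<partial>lborel) \<le>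
        (\<integral>x. \<bar>indicator U (x + z) - indicator U x :: real\<bar> + (indicator (U - A) (x + z) + indicator (U - A) x) \<partial>lborel)"
      proof (rule integral_mono)
        show "integrable lborel (\<lambda>x. \<bar>indicator A (x + z) - indicator A x :: real\<bar>)"
          using iA integrable_shift[OF iA, of z] by simp
        show "integrable lborel (\<lambda>x. \<bar>indicator U (x + z) - indicator U x\<bar> +
            (indicator (U - A) (x + z) + indicator (U - A) x) :: real)"
          using iU iUA integrable_shift[OF iU, of z] integrable_shift[OF iUA, of z] by simp
      qed (use U(2) in \<open>auto simp: indicator_def\<close>)
      also have "\<dots> = (\<integral>x. \<bar>indicator U (x + z) - indicator U x :: real\<bar> \<partial>lborel) + 2 * measure lborel (U - A)"
        using iU iUA integrable_shift[OF iU, of z] integrable_shift[OF iUA, of z]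
          integral_lborel_shift[of "indicator (U - A) :: vec2 \<Rightarrow> real" z]
        by simp
      finally show ?thesis .
    qed
    from t have "\<forall>\<^sub>F z in at 0. dist (\<integral>x. \<bar>indicator U (x + z) - indicator U x :: real\<bar> \<partial>lborel) 0 < e / 2"
      using \<open>e > 0\<close> by (intro tendstoD) auto
    then show "\<forall>\<^sub>F z in at 0. dist (\<integral>x. \<bar>indicator A (x + z) - indicator A x :: real\<bar> \<partial>lborel) 0 < e"
    proof eventually_elim
      case (elim z)
      then have "\<bar>\<integral>x. \<bar>indicator U (x + z) - indicator U x :: real\<bar> \<partial>lborel\<bar> < e / 2" by simp
      then have "(\<integral>x. \<bar>indicator A (x + z) - indicator A x :: real\<bar> \<partial>lborel) < e"
        using le[of z] mUA by linarith
      then show ?case by (simp add: abs_of_nonneg)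
    qed
  qed
  then have "((\<lambda>z. (\<integral>x. \<bar>indicator A (x + z) - indicator A x :: real\<bar> \<partial>lborel) * \<bar>c\<bar>) \<longlongrightarrow> 0) (at 0)"
    by (rule tendsto_mult_left_zero)
  moreover have "\<bar>indicator A (x + z) *\<^sub>R c - indicator A x *\<^sub>R c\<bar> = \<bar>indicator A (x + z) - indicator A x\<bar> * \<bar>c\<bar>" for x z
    by (simp add: abs_mult[symmetric] left_diff_distrib)
  ultimately show ?case by simp
next
  case (add f g)
  show ?case
  proof (rule tendsto_sandwich[OF _ _ tendsto_const tendsto_add_zero[OF add.IH]])
    show "\<forall>\<^sub>F z in at 0. (\<integral>x. \<bar>f (x + z) + g (x + z) - (f x + g x)\<bar> \<partial>lborel)
        \<le> (\<integral>x. \<bar>f (x + z) - f x\<bar> \<partial>lborel) + (\<integral>x. \<bar>g (x + z) - g x\<bar> \<partial>lborel)"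
    proof (rule always_eventually, rule allI)
      fix z
      have "(\<integral>x. \<bar>f (x + z) + g (x + z) - (f x + g x)\<bar> \<partial>lborel)
        \<le> (\<integral>x. \<bar>f (x + z) - f x\<bar> + \<bar>g (x + z) - g x\<bar> \<partial>lborel)"
        using add.hyps integrable_shift[OF add.hyps(1), of z] integrable_shift[OF add.hyps(2), of z]
        by (intro integral_mono) auto
      also have "\<dots> = (\<integral>x. \<bar>f (x + z) - f x\<bar> \<partial>lborel) + (\<integral>x. \<bar>g (x + z) - g x\<bar> \<partial>lborel)"
        using add.hyps integrable_shift[OF add.hyps(1), of z] integrable_shift[OF add.hyps(2), of z]
        by (intro Bochner_Integration.integral_add) auto
      finally show "(\<integral>x. \<bar>f (x + z) + g (x + z) - (f x + g x)\<bar> \<partial>lborel)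
        \<le> (\<integral>x. \<bar>f (x + z) - f x\<bar> \<partial>lborel) + (\<integral>x. \<bar>g (x + z) - g x\<bar> \<partial>lborel)" .
    qed
  qed simp
next
  case (lim f s)
  have "(\<lambda>i. \<integral>x. \<bar>s i x - f x\<bar> \<partial>lborel) \<longlonglongrightarrow> (\<integral>x. 0 \<partial>(lborel :: vec2 measure))"
  \<comment> \<open>The induction rule supplies approximants with
    \<open>\<bar>s i x\<bar> \<le> 2 * \<bar>f x\<bar>\<close>, whence the factor 3.\<close>
  proof (rule integral_dominated_convergence[where w="\<lambda>x. 3 * \<bar>f x\<bar>"])
    show "integrable lborel (\<lambda>x. 3 * \<bar>f x\<bar>)" using lim.hyps(4) by simp
    show "(\<lambda>x. \<bar>s i x - f x\<bar>) \<in> borel_measurable lborel" for i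
      using lim.hyps(1)[of i] lim.hyps(4) by auto
    show "AE x in lborel. (\<lambda>i. \<bar>s i x - f x\<bar>) \<longlonglongrightarrow> 0"
      using lim.hyps(2) by (auto intro!: tendsto_rabs_zero simp: LIM_zero_iff)
    have "\<bar>s i x - f x\<bar> \<le> 3 * \<bar>f x\<bar>" for i x
      using lim.hyps(3)[of x i] by simp
    then show "AE x in lborel. norm \<bar>s i x - f x\<bar> \<le> 3 * \<bar>f x\<bar>" for i by simp
  qed simp
  then have s0: "(\<lambda>i. \<integral>x. \<bar>s i x - f x\<bar> \<partial>lborel) \<longlonglongrightarrow> 0" by simp
  show ?case
  proof (rule tendstoI)
    fix e :: real assume "e > 0"
    then obtain i where i: "(\<integral>x. \<bar>s i x - f x\<bar> \<partial>lborel) < e / 4"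
      using s0[THEN order_tendstoD(2), of "e / 4"] by (auto dest: eventually_happens)
    have le: "(\<integral>x. \<bar>f (x + z) - f x\<bar> \<partial>lborel) \<le>
        (\<integral>x. \<bar>s i (x + z) - s i x\<bar> \<partial>lborel) + 2 * (\<integral>x. \<bar>s i x - f x\<bar> \<partial>lborel)" for z
    proof -
      note I = lim.hyps(1)[of i] lim.hyps(4) integrable_shift[OF lim.hyps(1)[of i], of z] integrable_shift[OF lim.hyps(4), of z]
      have "(\<integral>x. \<bar>f (x + z) - f x\<bar> \<partial>lborel) \<le>
        (\<integral>x. \<bar>s i (x + z) - s i x\<bar> + (\<bar>s i (x + z) - f (x + z)\<bar> + \<bar>s i x - f x\<bar>) \<partial>lborel)"
        using I by (intro integral_mono) auto
      also have "\<dots> = (\<integral>x. \<bar>s i (x + z) - s i x\<bar> \<partial>lborel) +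
          ((\<integral>x. \<bar>s i (x + z) - f (x + z)\<bar> \<partial>lborel) + (\<integral>x. \<bar>s i x - f x\<bar> \<partial>lborel))"
        using I by (simp del: integral_diff)
      also have "(\<integral>x. \<bar>s i (x + z) - f (x + z)\<bar> \<partial>lborel) = (\<integral>x. \<bar>s i x - f x\<bar> \<partial>lborel)"
        using lim.hyps(1)[of i] lim.hyps(4) by (intro integral_lborel_shift[of "\<lambda>x. \<bar>s i x - f x\<bar>"]) auto
      finally show ?thesis by simp
    qed
    from lim.IH[of i] have "\<forall>\<^sub>F z in at 0. dist (\<integral>x. \<bar>s i (x + z) - s i x\<bar> \<partial>lborel) 0 < e / 2"
      using \<open>e > 0\<close> by (intro tendstoD) auto
    then show "\<forall>\<^sub>F z in at 0. dist (\<integral>x. \<bar>f (x + z) - f x\<bar> \<partial>lborel) 0 < e"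
    proof eventually_elim
      case (elim z)
      then have "\<bar>\<integral>x. \<bar>s i (x + z) - s i x\<bar> \<partial>lborel\<bar> < e / 2" by simp
      then have "(\<integral>x. \<bar>f (x + z) - f x\<bar> \<partial>lborel) < e" using le[of z] i by linarith
      then show ?case by (simp add: abs_of_nonneg)
    qed
  qed
qed

text \<open>For nonnegative numbers the square of the difference is at most the difference of the
  squares in absolute value, which reduces the claim to L1 continuity of translations for the square
  of \<open>f\<close>. A general \<open>f\<close> is split into positive and negative parts
  afterwards.\<close>

lemma L2_shift_tendsto_nonneg:
  fixes f :: "vec2 \<Rightarrow> real"
  assumes f: "sqint lborel f" and nn: "\<And>x. 0 \<le> f x"
  shows "((\<lambda>z. l2 lborel (\<lambda>x. f (x + z) - f x)) \<longlongrightarrow> 0) (at 0)"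
proof -
  have i: "integrable lborel (\<lambda>x. (f x)\<^sup>2)" using f by (simp add: sqint_def)
  have ineq: "(a - b)\<^sup>2 \<le> \<bar>a\<^sup>2 - b\<^sup>2\<bar>" if "a \<ge> 0" "b \<ge> 0" for a b :: real
  proof -
    have "\<bar>a - b\<bar> * \<bar>a - b\<bar> \<le> \<bar>a - b\<bar> * (a + b)" using that by (intro mult_left_mono) auto
    also have "\<dots> = \<bar>(a - b) * (a + b)\<bar>" using that by (simp add: abs_mult)
    finally show ?thesis by (simp add: power2_eq_square algebra_simps)
  qed
  have "((\<lambda>z. sqrt (\<integral>x. \<bar>(f (x + z))\<^sup>2 - (f x)\<^sup>2\<bar> \<partial>lborel)) \<longlongrightarrow> sqrt 0) (at 0)"
    by (intro tendsto_real_sqrt L1_shift_tendsto[OF i])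
  then have lim: "((\<lambda>z. sqrt (\<integral>x. \<bar>(f (x + z))\<^sup>2 - (f x)\<^sup>2\<bar> \<partial>lborel)) \<longlongrightarrow> 0) (at 0)" by simp
  show ?thesis
  proof (rule tendsto_sandwich[OF _ _ tendsto_const lim])
    have "l2 lborel (\<lambda>x. f (x + z) - f x) \<le> sqrt (\<integral>x. \<bar>(f (x + z))\<^sup>2 - (f x)\<^sup>2\<bar> \<partial>lborel)" for z
      unfolding l2_def real_sqrt_le_iff
    proof (rule integral_mono)
      show "integrable lborel (\<lambda>x. (f (x + z) - f x)\<^sup>2)"
        using sqint_diff[OF sqint_shift[OF f, of z] f] by (simp add: sqint_def)
      show "integrable lborel (\<lambda>x. \<bar>(f (x + z))\<^sup>2 - (f x)\<^sup>2\<bar>)"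
        using i integrable_shift[OF i, of z] by simp
    qed (simp add: ineq nn)
    then show "\<forall>\<^sub>F z in at 0. l2 lborel (\<lambda>x. f (x + z) - f x)
        \<le> sqrt (\<integral>x. \<bar>(f (x + z))\<^sup>2 - (f x)\<^sup>2\<bar> \<partial>lborel)" by simp
  qed simp
qed

lemma L2_shift_tendsto:
  fixes f :: "vec2 \<Rightarrow> real"
  assumes f: "sqint lborel f"
  shows "((\<lambda>z. l2 lborel (\<lambda>x. f (x + z) - f x)) \<longlongrightarrow> 0) (at 0)"
proof -
  define p where "p x = max (f x) 0" for x
  define n where "n x = max (- f x) 0" for x
  have [measurable]: "f \<in> borel_measurable borel" using f by (simp add: sqint_def)
  have [measurable]: "p \<in> borel_measurable borel" "n \<in> borel_measurable borel"
    unfolding p_def[abs_def] n_def[abs_def] by measurable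
  have p: "sqint lborel p" by (rule sqint_bound[OF f, of _ 1]) (auto simp: p_def)
  have n: "sqint lborel n" by (rule sqint_bound[OF f, of _ 1]) (auto simp: n_def)
  have f_eq: "f x = p x - n x" for x by (simp add: p_def n_def)
  have le: "l2 lborel (\<lambda>x. f (x + z) - f x) \<le>
      l2 lborel (\<lambda>x. p (x + z) - p x) + l2 lborel (\<lambda>x. n (x + z) - n x)" for z
    using l2_triangle_diff[OF sqint_diff[OF sqint_shift[OF p, of z] p] sqint_diff[OF sqint_shift[OF n, of z] n]]
    by (simp add: f_eq algebra_simps)
  show ?thesis
  proof (rule tendsto_sandwich[OF _ _ tendsto_const])
    show "((\<lambda>z. l2 lborel (\<lambda>x. p (x + z) - p x) + l2 lborel (\<lambda>x. n (x + z) - n x)) \<longlongrightarrow> 0) (at 0)"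
      by (intro tendsto_add_zero L2_shift_tendsto_nonneg p n) (auto simp: p_def n_def)
  qed (auto simp: le)
qed

text \<open>The variance of \<open>h\<close> under the probability density \<open>J\<close> is
  nonnegative.\<close>

lemma Jensen_square:
  fixes J h :: "'a \<Rightarrow> real"
  assumes "integrable M J" "\<And>x. 0 \<le> J x" "(\<integral>x. J x \<partial>M) = 1"
    and "integrable M (\<lambda>x. h x * J x)" "integrable M (\<lambda>x. (h x)\<^sup>2 * J x)"
  shows "(\<integral>x. h x * J x \<partial>M)\<^sup>2 \<le> (\<integral>x. (h x)\<^sup>2 * J x \<partial>M)"
proof -
  define m where "m = (\<integral>x. h x * J x \<partial>M)"
  have "0 \<le> (\<integral>x. (h x - m)\<^sup>2 * J x \<partial>M)" using assms(2) by simp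
  also have "\<dots> = (\<integral>x. (h x)\<^sup>2 * J x - 2 * m * (h x * J x) + m\<^sup>2 * J x \<partial>M)"
    by (rule Bochner_Integration.integral_cong) (auto simp: power2_eq_square algebra_simps)
  also have "\<dots> = (\<integral>x. (h x)\<^sup>2 * J x \<partial>M) - 2 * m * m + m\<^sup>2"
    using assms by (simp add: m_def)
  finally show ?thesis by (simp add: m_def power2_eq_square)
qed

lemma mollifier_test_fun: "mollifier r J \<Longrightarrow> test_fun UNIV J"
  by (simp add: mollifier_def)

lemma kint_mollifier:
  assumes J: "mollifier r J" and f: "f \<in> borel_measurable borel"
  shows "kint (-1) f J x = (\<integral>z. f (z + x) * J z \<partial>lborel)"
proof -
  note f[measurable]
  have [measurable]: "J \<in> borel_measurable borel"
    using J by (auto simp: mollifier_def intro: test_fun_measurable)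
  have "(\<integral>z. f (z + x) * J (x - (z + x)) \<partial>lborel) = (\<integral>y. f y * J (x - y) \<partial>lborel)"
    by (intro integral_lborel_shift[of "\<lambda>y. f y * J (x - y)"]) measurable
  moreover have "J (x - (z + x)) = J z" for z
    using J by (simp add: mollifier_def)
  ultimately show ?thesis by (simp add: kint_def)
qed

text \<open>The difference from \<open>f\<close> is the \<open>J\<close>-average of
  \<open>f (x + z) - f x\<close> over \<open>z\<close>. Jensen and an exchange of integrals bound
  its squared norm by the average of the squared norms of these increments, and only
  \<open>norm z < r\<close> contributes. Working with nonnegative integrals makes square
  integrability a result of the estimate rather than an assumption.\<close>

lemma mollify_L2_bound:
  assumes f: "sqint lborel f" "integrable lborel f" and J: "mollifier r J"
    and e: "0 \<le> e" "\<And>z. norm z < r \<Longrightarrow> l2 lborel (\<lambda>x. f (x + z) - f x) \<le> e"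
  shows "sqint lborel (kint (-1) f J)" "l2 lborel (\<lambda>x. kint (-1) f J x - f x) \<le> e"
proof -
  have tJ: "test_fun UNIV J" and J0: "\<And>x. 0 \<le> J x" and J1: "(\<integral>x. J x \<partial>lborel) = 1"
    using J by (auto simp: mollifier_def)
  have iJ: "integrable lborel J" by (rule test_fun_integrable[OF tJ])
  have [measurable]: "f \<in> borel_measurable borel" using f by (simp add: sqint_def)
  have [measurable]: "J \<in> borel_measurable borel" by (rule test_fun_measurable[OF tJ])
  obtain B where B: "\<And>x. \<bar>J x\<bar> \<le> B" using test_fun_bounded[OF tJ] by metis
  have i2: "integrable lborel (\<lambda>x. (f x)\<^sup>2)" using f by (simp add: sqint_def)
  have [measurable]: "kint (-1) f J \<in> borel_measurable borel"
    by (rule smooth2_measurable[OF smooth2_kint[OF f(2) tJ]])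
  let ?d = "\<lambda>x. kint (-1) f J x - f x"
  have pw: "ennreal ((?d x)\<^sup>2) \<le> (\<integral>\<^sup>+z. ennreal ((f (x + z) - f x)\<^sup>2 * J z) \<partial>lborel)" for x
  proof -
    have i1J: "integrable lborel (\<lambda>z. f (z + x) * J z)"
      by (rule integrable_mult_bounded[OF integrable_shift[OF f(2)] _ B]) simp
    have i2J: "integrable lborel (\<lambda>z. (f (z + x))\<^sup>2 * J z)"
      by (rule integrable_mult_bounded[OF integrable_shift[OF i2] _ B]) simp
    have ih1: "integrable lborel (\<lambda>z. (f (z + x) - f x) * J z)"
      using i1J iJ by (simp add: left_diff_distrib)
    have "integrable lborel (\<lambda>z. (f (z + x))\<^sup>2 * J z - 2 * f x * (f (z + x) * J z) + (f x)\<^sup>2 * J z)"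
      using i1J i2J iJ by simp
    then have ih2: "integrable lborel (\<lambda>z. (f (z + x) - f x)\<^sup>2 * J z)"
      by (rule Bochner_Integration.integrable_cong[THEN iffD1, rotated -1])
        (auto simp: power2_eq_square algebra_simps)
    have "?d x = (\<integral>z. (f (z + x) - f x) * J z \<partial>lborel)"
      using i1J iJ J1 by (simp add: kint_mollifier[OF J] left_diff_distrib)
    then have "(?d x)\<^sup>2 \<le> (\<integral>z. (f (z + x) - f x)\<^sup>2 * J z \<partial>lborel)"
      using Jensen_square[OF iJ J0 J1 ih1 ih2] by simp
    then have "ennreal ((?d x)\<^sup>2) \<le> ennreal (\<integral>z. (f (z + x) - f x)\<^sup>2 * J z \<partial>lborel)"
      by (rule ennreal_leI)
    also have "\<dots> = (\<integral>\<^sup>+z. ennreal ((f (z + x) - f x)\<^sup>2 * J z) \<partial>lborel)"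
      by (rule nn_integral_eq_integral[symmetric, OF ih2]) (simp add: J0)
    finally show ?thesis by (simp add: add.commute)
  qed
  have "(\<integral>\<^sup>+x. ennreal ((?d x)\<^sup>2) \<partial>lborel) \<le>
      (\<integral>\<^sup>+x. (\<integral>\<^sup>+z. ennreal ((f (x + z) - f x)\<^sup>2 * J z) \<partial>lborel) \<partial>lborel)"
    by (intro nn_integral_mono pw)
  also have "\<dots> = (\<integral>\<^sup>+z. (\<integral>\<^sup>+x. ennreal ((f (x + z) - f x)\<^sup>2 * J z) \<partial>lborel) \<partial>lborel)"
    by (rule lborel_pair.Fubini'[symmetric]) measurable
  also have "\<dots> \<le> (\<integral>\<^sup>+z. ennreal (e\<^sup>2 * J z) \<partial>lborel)"
  proof (rule nn_integral_mono)
    fix z :: vec2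
    have ii: "integrable lborel (\<lambda>x. (f (x + z) - f x)\<^sup>2)"
      using sqint_diff[OF sqint_shift[OF f(1), of z] f(1)] by (simp add: sqint_def)
    have "(\<integral>\<^sup>+x. ennreal ((f (x + z) - f x)\<^sup>2 * J z) \<partial>lborel) =
        ennreal (\<integral>x. (f (x + z) - f x)\<^sup>2 * J z \<partial>lborel)"
      using ii by (intro nn_integral_eq_integral) (auto simp: J0)
    also have "\<dots> = ennreal ((l2 lborel (\<lambda>x. f (x + z) - f x))\<^sup>2 * J z)"
      by (simp add: l2_power2)
    also have "\<dots> \<le> ennreal (e\<^sup>2 * J z)"
    proof (cases "norm z < r")
      case True
      then show ?thesis using e J0 by (intro ennreal_leI mult_right_mono power_mono) auto
    next
      case False
      then show ?thesis using J by (simp add: mollifier_def)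
    qed
    finally show "(\<integral>\<^sup>+x. ennreal ((f (x + z) - f x)\<^sup>2 * J z) \<partial>lborel) \<le> ennreal (e\<^sup>2 * J z)" .
  qed
  also have "\<dots> = ennreal (e\<^sup>2)"
    using iJ J0 J1 by (subst nn_integral_eq_integral) auto
  finally have le: "(\<integral>\<^sup>+x. ennreal ((?d x)\<^sup>2) \<partial>lborel) \<le> ennreal (e\<^sup>2)" .
  have id: "integrable lborel (\<lambda>x. (?d x)\<^sup>2)"
  proof (rule integrableI_bounded)
    show "(\<integral>\<^sup>+x. ennreal (norm ((?d x)\<^sup>2)) \<partial>lborel) < \<infinity>"
      using le_less_trans[OF le ennreal_less_top] by simp
  qed measurable
  then have d: "sqint lborel ?d" by (simp add: sqint_def)
  from sqint_add[OF d f(1)] show "sqint lborel (kint (-1) f J)" by simp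
  have "ennreal (\<integral>x. (?d x)\<^sup>2 \<partial>lborel) \<le> ennreal (e\<^sup>2)"
    using le by (subst nn_integral_eq_integral[symmetric, OF id]) auto
  then have "(l2 lborel ?d)\<^sup>2 \<le> e\<^sup>2" using e(1) by (simp add: l2_power2)
  then show "l2 lborel ?d \<le> e" using e(1) by (rule power2_le_imp_le)
qed

lemma mollify_L2_tendsto:
  assumes f: "sqint lborel f" "integrable lborel f"
    and J: "\<And>n. mollifier (r n) (J n)" and r: "r \<longlonglongrightarrow> 0"
  shows "(\<lambda>n. l2 lborel (\<lambda>x. kint (-1) f (J n) x - f x)) \<longlonglongrightarrow> 0"
proof (rule tendstoI)
  fix e :: real assume "e > 0"
  have "\<forall>\<^sub>F z in at 0. dist (l2 lborel (\<lambda>x. f (x + z) - f x)) 0 < e / 2"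
    using \<open>e > 0\<close> by (intro tendstoD[OF L2_shift_tendsto[OF f(1)]]) auto
  then obtain d where d: "d > 0" "\<And>z. z \<noteq> 0 \<Longrightarrow> norm z < d \<Longrightarrow> l2 lborel (\<lambda>x. f (x + z) - f x) < e / 2"
    unfolding eventually_at by (auto simp: dist_norm)
  have d': "l2 lborel (\<lambda>x. f (x + z) - f x) \<le> e / 2" if "norm z < d" for z
    using d(2)[of z] that \<open>e > 0\<close> by (cases "z = 0") (auto simp: l2_def)
  have "\<forall>\<^sub>F n in sequentially. r n < d" using r d(1) by (rule order_tendstoD)
  then show "\<forall>\<^sub>F n in sequentially. dist (l2 lborel (\<lambda>x. kint (-1) f (J n) x - f x)) 0 < e"
  proof eventually_elim
    case (elim n)
    then have "l2 lborel (\<lambda>x. kint (-1) f (J n) x - f x) \<le> e / 2"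
      using \<open>e > 0\<close> d' by (intro mollify_L2_bound(2)[OF f J]) (simp_all del: le_divide_eq_numeral1)
    with \<open>e > 0\<close> show ?case by simp
  qed
qed

lemma kint_mollifier_bound:
  assumes J: "mollifier r J" and f: "f \<in> borel_measurable borel" "\<And>x. \<bar>f x\<bar> \<le> 1"
  shows "\<bar>kint (-1) f J x\<bar> \<le> 1"
proof -
  have iJ: "integrable lborel J" using J by (auto simp: mollifier_def intro: test_fun_integrable)
  have i: "integrable lborel (\<lambda>z. f (z + x) * J z)"
    using integrable_mult_bounded[OF iJ, of "\<lambda>z. f (z + x)" 1] f by (simp add: mult.commute)
  have "\<bar>kint (-1) f J x\<bar> \<le> (\<integral>z. \<bar>f (z + x) * J z\<bar> \<partial>lborel)"
    unfolding kint_mollifier[OF J f(1)] by (rule integral_abs_bound)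
  also have "\<dots> \<le> (\<integral>z. J z \<partial>lborel)"
    using i J f(2) by (intro integral_mono[OF integrable_abs[OF i] iJ])
      (simp add: abs_mult mollifier_def mult_left_le_one_le)
  finally show ?thesis using J by (simp add: mollifier_def)
qed

text \<open>The indicator of the \<open>e / 2\<close>-neighbourhood of \<open>K\<close>, mollified
  at radius \<open>e / 2\<close>: around a point of \<open>K\<close> the average sees only the value
  1, and the support stays within distance \<open>e\<close> of \<open>K\<close>.\<close>

lemma ex_cutoff:
  assumes "compact K" "open U" "K \<subseteq> U"
  obtains \<eta> where "test_fun U \<eta>" "\<And>x. x \<in> K \<Longrightarrow> \<eta> x = 1" "\<And>x. \<bar>\<eta> x\<bar> \<le> 1"
proof -
  obtain e where e: "e > 0" "(\<Union>x\<in>K. cball x e) \<subseteq> U"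
    using compact_subset_open_imp_cball_epsilon_subset[OF assms] by blast
  define S where "S = {x + z |x z. x \<in> K \<and> z \<in> cball 0 (e / 2)}"
  have S: "compact S" unfolding S_def by (intro compact_sums assms compact_cball)
  then have [measurable]: "S \<in> sets borel" by (simp add: borel_closed compact_imp_closed)
  define f where "f = (indicator S :: vec2 \<Rightarrow> real)"
  have f: "integrable lborel f" "f \<in> borel_measurable borel"
    using emeasure_compact_finite[OF S] by (auto simp: f_def integrable_indicator_iff)
  obtain J where J: "mollifier (e / 2) J" using ex_mollifier[of "e / 2"] e by auto
  define \<eta> where "\<eta> = kint (-1) f J"
  have "compact {x + z |x z. x \<in> S \<and> z \<in> cball 0 (e / 2)}" by (intro compact_sums S compact_cball)
  then have "test_fun U \<eta>"
  proof (rule test_funI[rotated])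
    show "smooth2 \<eta>" unfolding \<eta>_def using J by (intro smooth2_kint f) (simp add: mollifier_def)
    show "{x + z |x z. x \<in> S \<and> z \<in> cball 0 (e / 2)} \<subseteq> U"
    proof safe
      fix x z :: vec2 assume "x \<in> S" "z \<in> cball 0 (e / 2)"
      then obtain k w where k: "k \<in> K" "x = k + w" "norm w \<le> e / 2" "norm z \<le> e / 2" by (auto simp: S_def)
      have "norm (z + w) \<le> e" using norm_triangle_ineq[of z w] k by simp
      then have "x + z \<in> cball k e" using k by (simp add: dist_norm add.assoc norm_minus_commute)
      with e k show "x + z \<in> U" by blast
    qed
    fix x assume x: "x \<notin> {x + z |x z. x \<in> S \<and> z \<in> cball 0 (e / 2)}"
    show "\<eta> x = 0"
      unfolding \<eta>_def
    proof (rule kint_outside[of S])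
      show "e / 2 \<le> dist x y" if "y \<in> S" for y
      proof (rule ccontr)
        assume "\<not> e / 2 \<le> dist x y"
        then have "x = y + (x - y)" "x - y \<in> cball 0 (e / 2)" by (auto simp: dist_norm norm_minus_commute)
        with x that show False by blast
      qed
    qed (use J in \<open>auto simp: f_def mollifier_def\<close>)
  qed
  moreover have "\<eta> x = 1" if "x \<in> K" for x
  proof -
    have "f (z + x) * J z = J z" for z
    proof (cases "norm z < e / 2")
      case True
      then have "x + z \<in> S" using that unfolding S_def by force
      then show ?thesis by (simp add: f_def add.commute)
    qed (use J in \<open>simp add: mollifier_def\<close>)
    then have "(\<lambda>z. f (z + x) * J z) = J" by (rule ext)
    then have "\<eta> x = (\<integral>z. J z \<partial>lborel)" by (simp only: \<eta>_def kint_mollifier[OF J f(2)])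
    with J show ?thesis by (simp add: mollifier_def)
  qed
  moreover have "\<bar>\<eta> x\<bar> \<le> 1" for x
    unfolding \<eta>_def by (rule kint_mollifier_bound[OF J f(2)]) (simp add: f_def indicator_def)
  ultimately show thesis using that by blast
qed

text \<open>The partial derivatives of the mollification are the mollifications of the weak
  derivatives: test with the reflected kernel \<open>y \<mapsto> J (x - y)\<close>, whose reflection
  sign cancels the sign in the weak formula. Convergence of both then follows from one
  statement.\<close>

lemma smooth_approximation:
  fixes f :: "vec2 \<Rightarrow> real" and g :: "2 \<Rightarrow> vec2 \<Rightarrow> real"
  assumes f: "sqint lborel f" "integrable lborel f" and S: "compact S" "\<And>x. x \<notin> S \<Longrightarrow> f x = 0"
    and g: "\<And>j. sqint lborel (g j)" "\<And>j. integrable lborel (g j)"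
    and weak: "\<And>\<phi> j. test_fun UNIV \<phi> \<Longrightarrow>
      (\<integral>x. f x * pdiff \<phi> j x \<partial>lborel) = - (\<integral>x. g j x * \<phi> x \<partial>lborel)"
  obtains F where "\<And>n. test_fun UNIV (F n)" "(\<lambda>n. l2 lborel (\<lambda>x. F n x - f x)) \<longlonglongrightarrow> 0"
    "\<And>j. (\<lambda>n. l2 lborel (\<lambda>x. pdiff (F n) j x - g j x)) \<longlonglongrightarrow> 0"
proof -
  have "\<exists>J. mollifier (1 / real (Suc n)) J" for n
    using ex_mollifier[of "1 / real (Suc n)"] by auto
  then obtain J where J: "\<And>n. mollifier (1 / real (Suc n)) (J n)" by metis
  note tJ = mollifier_test_fun[OF J]
  define F where "F n = kint (-1) f (J n)" for n
  have tF: "test_fun UNIV (F n)" for n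
  proof (rule test_funI)
    show "smooth2 (F n)" unfolding F_def by (rule smooth2_kint[OF f(2) tJ])
    show "compact {x + z |x z. x \<in> S \<and> z \<in> cball 0 (1 / real (Suc n))}"
      by (intro compact_sums S compact_cball)
    fix x assume x: "x \<notin> {x + z |x z. x \<in> S \<and> z \<in> cball 0 (1 / real (Suc n))}"
    show "F n x = 0"
      unfolding F_def
    proof (rule kint_outside[of S])
      show "1 / real (Suc n) \<le> dist x y" if "y \<in> S" for y
      proof (rule ccontr)
        assume "\<not> 1 / real (Suc n) \<le> dist x y"
        then have "x = y + (x - y)" "x - y \<in> cball 0 (1 / real (Suc n))" by (auto simp: dist_norm norm_minus_commute)
        with x that show False by blast
      qed
    qed (use J S in \<open>auto simp: mollifier_def\<close>)
  qed simp
  have pF: "pdiff (F n) j = kint (-1) (g j) (J n)" for n j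
  proof
    fix x
    have s: "smooth2 (\<lambda>y. J n (x + (-1) *\<^sub>R y))"
      by (rule smooth2_affine_arg[OF test_fun_smooth2[OF tJ]])
    have "pdiff (F n) j x = (\<integral>y. f y * pdiff (J n) j (x + (-1) *\<^sub>R y) \<partial>lborel)"
      unfolding F_def pdiff_kint[OF f(2) tJ] kint_def ..
    also have "\<dots> = - (\<integral>y. f y * pdiff (\<lambda>y. J n (x + (-1) *\<^sub>R y)) j y \<partial>lborel)"
      unfolding pdiff_smooth2_affine_arg[OF test_fun_smooth2[OF tJ]] by simp
    also have "\<dots> = (\<integral>y. g j y * J n (x + (-1) *\<^sub>R y) \<partial>lborel)"
      by (subst weak) (auto intro!: test_fun_affine_arg tJ simp del: scaleR_minus_left scaleR_minus1_left)
    finally show "pdiff (F n) j x = kint (-1) (g j) (J n) x" by (simp add: kint_def)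
  qed
  have r: "(\<lambda>n. 1 / real (Suc n)) \<longlonglongrightarrow> 0" by (rule LIMSEQ_Suc[OF lim_1_over_n])
  show thesis
    using that[OF tF] mollify_L2_tendsto[OF f J r] mollify_L2_tendsto[OF g J r]
    unfolding pF by (simp add: F_def)
qed

section \<open>Fundamental lemma of the calculus of variations\<close>

text \<open>The ideal test function is the sign of \<open>g\<close> on \<open>K\<close>. Its
  mollifications are supported in \<open>S\<close> and bounded by 1. As \<open>g\<close> is merely
  locally integrable, their L2 convergence does not suffice; a subsequence converging almost
  everywhere is used under the dominating function \<open>\<bar>gS x\<bar>\<close>. In the limit the
  integral of the absolute value of \<open>g\<close> over \<open>K\<close> vanishes.\<close>

lemma locally_AE_zero_compact:
  assumes "open \<Omega>" "loc_integrable \<Omega> g"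
    and zero: "\<And>\<phi>. test_fun \<Omega> \<phi> \<Longrightarrow> (LINT x:\<Omega>|lborel. g x * \<phi> x) = 0"
    and K: "compact K" "K \<subseteq> \<Omega>"
  shows "AE x in lborel. x \<in> K \<longrightarrow> g x = 0"
proof -
  obtain e where e: "e > 0" "(\<Union>x\<in>K. cball x e) \<subseteq> \<Omega>"
    using compact_subset_open_imp_cball_epsilon_subset[OF K(1) assms(1) K(2)] by blast
  define S where "S = {x + z |x z. x \<in> K \<and> z \<in> cball 0 e}"
  have S: "compact S" unfolding S_def by (intro compact_sums K compact_cball)
  have S\<Omega>: "S \<subseteq> \<Omega>"
  proof
    fix y assume "y \<in> S"
    then obtain k w where "k \<in> K" "y = k + w" "norm w \<le> e" by (auto simp: S_def)
    then have "y \<in> cball k e" by (simp add: dist_norm)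
    with e \<open>k \<in> K\<close> show "y \<in> \<Omega>" by blast
  qed
  have KS: "K \<subseteq> S" unfolding S_def using e(1) by force
  have [measurable]: "K \<in> sets borel" "S \<in> sets borel"
    using K S by (simp_all add: borel_closed compact_imp_closed)
  define gS where "gS x = indicator S x * g x" for x
  define w where "w x = sgn (indicator K x * gS x)" for x
  have gS: "integrable lborel gS"
    using assms(2) S S\<Omega> unfolding loc_integrable_def set_integrable_def gS_def by simp
  then have [measurable]: "gS \<in> borel_measurable borel" by auto
  have [measurable]: "w \<in> borel_measurable borel" unfolding w_def by measurable
  have iK: "integrable lborel (indicator K :: vec2 \<Rightarrow> real)"
    using emeasure_compact_finite[OF K(1)] by (simp add: integrable_indicator_iff)
  have w1: "\<bar>w x\<bar> \<le> 1" for x by (simp add: w_def abs_sgn_eq)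
  have w: "integrable lborel w" "integrable lborel (\<lambda>x. (w x)\<^sup>2)"
    by (rule Bochner_Integration.integrable_bound[OF iK]; simp add: w_def sgn_real_def indicator_def)+
  then have w2: "sqint lborel w" by (simp add: sqint_def)
  have "\<exists>J. mollifier (e / real (Suc n)) J" for n
    using ex_mollifier[of "e / real (Suc n)"] e(1) by auto
  then obtain J where J: "\<And>n. mollifier (e / real (Suc n)) (J n)" by metis
  define F where "F n = kint (-1) w (J n)" for n
  have ers: "e / real (Suc n) \<le> e" for n
    using e(1) by (simp add: divide_le_eq)
  have F0: "F n x = 0" if x: "x \<notin> S" for n x
    unfolding F_def
  proof (rule kint_outside[of K])
    show "e / real (Suc n) \<le> dist x y" if "y \<in> K" for y
    proof (rule ccontr)
      assume "\<not> e / real (Suc n) \<le> dist x y"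
      then have "x = y + (x - y)" "x - y \<in> cball 0 e"
        using ers[of n] by (auto simp: dist_norm norm_minus_commute)
      with x that show False unfolding S_def by blast
    qed
  qed (use J in \<open>auto simp: w_def mollifier_def\<close>)
  have tF: "test_fun \<Omega> (F n)" for n
    using S S\<Omega> F0 by (intro test_funI[of _ S]) (auto simp: F_def intro!: smooth2_kint w mollifier_test_fun[OF J])
  have F1: "\<bar>F n x\<bar> \<le> 1" for n x unfolding F_def by (rule kint_mollifier_bound[OF J _ w1]) simp
  have "(\<lambda>n. e * (1 / real (Suc n))) \<longlonglongrightarrow> e * 0"
    by (intro tendsto_intros LIMSEQ_Suc[OF lim_1_over_n])
  then have r: "(\<lambda>n. e / real (Suc n)) \<longlonglongrightarrow> 0" by simp
  have "(\<lambda>n. (l2 lborel (\<lambda>x. F n x - w x))\<^sup>2) \<longlonglongrightarrow> 0\<^sup>2"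
    unfolding F_def by (intro tendsto_power mollify_L2_tendsto[OF w2 w(1) J r])
  then have l: "(\<lambda>n. \<integral>x. norm ((F n x - w x)\<^sup>2) \<partial>lborel) \<longlonglongrightarrow> 0" by (simp add: l2_power2)
  have id: "integrable lborel (\<lambda>x. (F n x - w x)\<^sup>2)" for n
    using sqint_diff[OF test_fun_sqint[OF tF] w2, of n] by (simp add: sqint_def)
  obtain s :: "nat \<Rightarrow> nat" where s: "strict_mono s" "AE x in lborel. (\<lambda>n. (F (s n) x - w x)\<^sup>2) \<longlonglongrightarrow> 0"
    using tendsto_L1_AE_subseq[OF id l] by blast
  have "(\<lambda>n. \<integral>x. gS x * F (s n) x \<partial>lborel) \<longlonglongrightarrow> (\<integral>x. gS x * w x \<partial>lborel)"
  proof (rule integral_dominated_convergence[where w="\<lambda>x. \<bar>gS x\<bar>"])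
    show "(\<lambda>x. gS x * F (s n) x) \<in> borel_measurable lborel" for n
      using test_fun_measurable[OF tF] by simp
    show "AE x in lborel. (\<lambda>n. gS x * F (s n) x) \<longlonglongrightarrow> gS x * w x"
      using s(2)
    proof eventually_elim
      case (elim x)
      then have "(\<lambda>n. sqrt ((F (s n) x - w x)\<^sup>2)) \<longlonglongrightarrow> sqrt 0" by (rule tendsto_real_sqrt)
      then have "(\<lambda>n. F (s n) x) \<longlonglongrightarrow> w x" by (simp add: tendsto_rabs_zero_iff LIM_zero_iff)
      then show ?case by (rule tendsto_mult_left)
    qed
  qed (use gS F1 in \<open>auto simp: abs_mult intro!: mult_left_le\<close>)
  moreover have "(\<integral>x. gS x * F n x \<partial>lborel) = 0" for n
  proof -
    have "(\<lambda>x. gS x * F n x) = (\<lambda>x. indicator \<Omega> x *\<^sub>R (g x * F n x))"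
    proof
      fix x
      show "gS x * F n x = indicator \<Omega> x *\<^sub>R (g x * F n x)"
        using F0[of x n] S\<Omega> by (auto simp: gS_def indicator_def)
    qed
    then show ?thesis using zero[OF tF[of n]] by (simp only: set_lebesgue_integral_def)
  qed
  ultimately have "(\<integral>x. gS x * w x \<partial>lborel) = 0"
    by (simp add: LIMSEQ_const_iff)
  moreover have gw: "gS x * w x = \<bar>indicator K x * gS x\<bar>" for x
    by (simp add: w_def sgn_real_def indicator_def)
  ultimately have "(\<integral>x. \<bar>indicator K x * gS x\<bar> \<partial>lborel) = 0" by simp
  moreover have "integrable lborel (\<lambda>x. \<bar>indicator K x * gS x\<bar>)"
    using integrable_mult_bounded[OF gS _ w1] by (simp add: gw[symmetric])
  ultimately have "AE x in lborel. \<bar>indicator K x * gS x\<bar> = 0"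
    by (subst (asm) integral_nonneg_eq_0_iff_AE) auto
  then show ?thesis
    by eventually_elim (use KS in \<open>auto simp: gS_def indicator_def split: if_splits\<close>)
qed

lemma open_compact_exhaustion:
  fixes \<Omega> :: "vec2 set"
  assumes "open \<Omega>"
  shows "\<exists>K :: nat \<Rightarrow> vec2 set. (\<forall>n. compact (K n)) \<and> (\<forall>n. K n \<subseteq> \<Omega>) \<and> (\<Union>n. K n) = \<Omega>"
  using open_Union_compact_subsets[OF assms] by metis

lemma locally_AE_zero:
  assumes "open \<Omega>" "loc_integrable \<Omega> g"
    and "\<And>\<phi>. test_fun \<Omega> \<phi> \<Longrightarrow> (LINT x:\<Omega>|lborel. g x * \<phi> x) = 0"
  shows "AE x in lborel. x \<in> \<Omega> \<longrightarrow> g x = 0"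
proof -
  obtain K :: "nat \<Rightarrow> vec2 set" where K: "\<And>n. compact (K n)" "\<And>n. K n \<subseteq> \<Omega>" "(\<Union>n. K n) = \<Omega>"
    using open_compact_exhaustion[OF assms(1)] by blast
  have "AE x in lborel. \<forall>n. x \<in> K n \<longrightarrow> g x = 0"
    unfolding AE_all_countable using locally_AE_zero_compact[OF assms K(1,2)] by blast
  then show ?thesis by eventually_elim (use K(3) in blast)
qed

text \<open>Local integrability gives measurability on compact sets only. The unions
  \<open>L n\<close> are compact and increasing, so their indicators converge pointwise to that of
  \<Omega>.\<close>

lemma loc_integrable_measurable:
  assumes "open \<Omega>" "loc_integrable \<Omega> g"
  shows "(\<lambda>x. indicator \<Omega> x * g x) \<in> borel_measurable borel"
proof -
  obtain K :: "nat \<Rightarrow> vec2 set" where K: "\<And>n. compact (K n)" "\<And>n. K n \<subseteq> \<Omega>" "(\<Union>n. K n) = \<Omega>"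
    using open_compact_exhaustion[OF assms(1)] by blast
  define L where "L n = (\<Union>i\<le>n. K i)" for n
  have L: "compact (L n)" "L n \<subseteq> \<Omega>" for n
    using K(1,2) by (auto simp: L_def intro!: compact_UN)
  have "(\<lambda>x. indicator (L n) x * g x) \<in> borel_measurable borel" for n
    using assms(2) L[of n] by (auto simp: loc_integrable_def set_integrable_def)
  moreover have "(\<lambda>n. indicator (L n) x * g x) \<longlonglongrightarrow> indicator \<Omega> x * g x" for x
  proof (cases "x \<in> \<Omega>")
    case True
    then obtain m where m: "x \<in> K m" using K(3) by blast
    have "\<forall>\<^sub>F n in sequentially. indicator (L n) x * g x = indicator \<Omega> x * g x"
      using eventually_ge_at_top[of m] by eventually_elim (use m True in \<open>auto simp: L_def indicator_def\<close>)
    then show ?thesis by (rule tendsto_eventually)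
  next
    case False
    then have "x \<notin> L n" for n using L(2)[of n] by blast
    with False show ?thesis by simp
  qed
  ultimately show ?thesis by (rule borel_measurable_LIMSEQ_real[rotated])
qed

subsection \<open>Completeness and Riesz representation\<close>

lemma l2_diff_le:
  assumes "sqint M f" "sqint M g"
  shows "\<bar>l2 M f - l2 M g\<bar> \<le> l2 M (\<lambda>x. f x - g x)"
  using l2_triangle[OF sqint_diff[OF assms] assms(2)] l2_triangle[OF sqint_diff[OF assms(2,1)] assms(1)]
    l2_minus_commute[of M f g]
  by simp

lemma l2_tendsto:
  assumes "\<And>n. sqint M (F n)" "sqint M g" "(\<lambda>n. l2 M (\<lambda>x. F n x - g x)) \<longlonglongrightarrow> 0"
  shows "(\<lambda>n. l2 M (F n)) \<longlonglongrightarrow> l2 M g"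
proof -
  have "(\<lambda>n. l2 M (F n) - l2 M g) \<longlonglongrightarrow> 0"
    by (rule Lim_null_comparison[OF _ assms(3)]) (simp add: l2_diff_le assms)
  then show ?thesis by (simp add: LIM_zero_iff)
qed

lemma integral_mult_tendsto:
  assumes "\<And>n. sqint M (F n)" "sqint M g" "(\<lambda>n. l2 M (\<lambda>x. F n x - g x)) \<longlonglongrightarrow> 0" and h: "sqint M h"
  shows "(\<lambda>n. \<integral>x. h x * F n x \<partial>M) \<longlonglongrightarrow> (\<integral>x. h x * g x \<partial>M)"
proof -
  have "(\<lambda>n. (\<integral>x. h x * F n x \<partial>M) - (\<integral>x. h x * g x \<partial>M)) \<longlonglongrightarrow> 0"
  proof (rule Lim_null_comparison)
    have "(\<integral>x. h x * F n x \<partial>M) - (\<integral>x. h x * g x \<partial>M) = (\<integral>x. h x * (F n x - g x) \<partial>M)" for n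
      using sqint_mult_integrable[OF h assms(1)] sqint_mult_integrable[OF h assms(2)]
      by (simp add: right_diff_distrib)
    then show "\<forall>\<^sub>F n in sequentially. norm ((\<integral>x. h x * F n x \<partial>M) - (\<integral>x. h x * g x \<partial>M))
        \<le> l2 M h * l2 M (\<lambda>x. F n x - g x)"
      using l2_Cauchy_Schwarz[OF h sqint_diff[OF assms(1,2)]] by simp
    show "(\<lambda>n. l2 M h * l2 M (\<lambda>x. F n x - g x)) \<longlonglongrightarrow> 0"
      using tendsto_mult_left[OF assms(3), of "l2 M h"] by simp
  qed
  then show ?thesis by (simp add: LIM_zero_iff)
qed

lemma sqint_nn_integral:
  "sqint M f \<Longrightarrow> (\<integral>\<^sup>+x. ennreal ((f x)\<^sup>2) \<partial>M) = ennreal ((l2 M f)\<^sup>2)"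
  by (simp add: sqint_def l2_power2 nn_integral_eq_integral)

lemma sqintI_nn_integral:
  assumes [measurable]: "f \<in> borel_measurable M" and le: "(\<integral>\<^sup>+x. ennreal ((f x)\<^sup>2) \<partial>M) \<le> ennreal (e\<^sup>2)"
    and "0 \<le> e"
  shows "sqint M f" "l2 M f \<le> e"
proof -
  have "integrable M (\<lambda>x. (f x)\<^sup>2)"
  proof (rule integrableI_bounded)
    show "(\<integral>\<^sup>+x. ennreal (norm ((f x)\<^sup>2)) \<partial>M) < \<infinity>"
      using le_less_trans[OF le ennreal_less_top] by simp
  qed measurable
  then show f: "sqint M f" by (simp add: sqint_def)
  have "(l2 M f)\<^sup>2 \<le> e\<^sup>2" using le sqint_nn_integral[OF f] by simp
  then show "l2 M f \<le> e" using \<open>0 \<le> e\<close> by (rule power2_le_imp_le)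
qed

text \<open>The weight \<open>2 ^ k\<close> is small enough that the integrals of \<open>D k\<close>
  stay summable, since 2^k (1/4)^k = 2^(-k), and large enough that a finite sum at \<open>x\<close>
  bounds the increments by a multiple of 2^(-k/2), a convergent geometric series.\<close>

lemma sqint_AE_convergent:
  assumes F: "\<And>n. sqint M (F n)" and d: "\<And>k. l2 M (\<lambda>x. F (Suc k) x - F k x) \<le> (1 / 2) ^ k"
  shows "AE x in M. convergent (\<lambda>k. F k x)"
proof -
  note [measurable] = sqint_measurable[OF F]
  define D where "D k x = ennreal (2 ^ k * (F (Suc k) x - F k x)\<^sup>2)" for k x
  have [measurable]: "D k \<in> borel_measurable M" for k unfolding D_def[abs_def] by measurable
  have D: "(\<integral>\<^sup>+x. D k x \<partial>M) \<le> ennreal ((1 / 2) ^ k)" for k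
  proof -
    have "(\<integral>\<^sup>+x. D k x \<partial>M) = ennreal (2 ^ k) * ennreal ((l2 M (\<lambda>x. F (Suc k) x - F k x))\<^sup>2)"
      unfolding sqint_nn_integral[OF sqint_diff[OF F F], symmetric] D_def
      by (subst nn_integral_cmult[symmetric]) (auto simp: ennreal_mult')
    also have "\<dots> \<le> ennreal (2 ^ k * ((1 / 2) ^ k)\<^sup>2)"
      using d[of k] by (subst ennreal_mult'[symmetric]) (auto intro!: ennreal_leI mult_left_mono power_mono)
    also have "2 ^ k * ((1 / 2) ^ k)\<^sup>2 = (1 / 2 :: real) ^ k"
      by (simp add: power_divide power2_eq_square)
    finally show ?thesis .
  qed
  have "(\<integral>\<^sup>+x. (\<Sum>k. D k x) \<partial>M) = (\<Sum>k. \<integral>\<^sup>+x. D k x \<partial>M)"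
    by (rule nn_integral_suminf) simp
  also have "\<dots> \<le> (\<Sum>k. ennreal ((1 / 2) ^ k))" by (intro suminf_le D) auto
  also have "\<dots> = ennreal (\<Sum>k. (1 / 2) ^ k)" by (rule suminf_ennreal2) (auto intro!: summable_geometric)
  also have "\<dots> < \<infinity>" by simp
  finally have "AE x in M. (\<Sum>k. D k x) \<noteq> \<infinity>" by (intro nn_integral_noteq_infinite) auto
  then show ?thesis
  proof eventually_elim
    case (elim x)
    then obtain c where c: "0 \<le> c" "(\<Sum>k. D k x) = ennreal c" by (cases "\<Sum>k. D k x") auto
    have b: "norm (F (Suc k) x - F k x) \<le> sqrt c * (1 / sqrt 2) ^ k" for k
    proof -
      have "D k x \<le> ennreal c"
        unfolding c(2)[symmetric] using sum_le_suminf[of "\<lambda>k. D k x" "{k}"] by simp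
      then have "2 ^ k * (F (Suc k) x - F k x)\<^sup>2 \<le> c" using c(1) by (simp add: D_def)
      then have "(F (Suc k) x - F k x)\<^sup>2 \<le> c / 2 ^ k" by (simp add: field_simps)
      then have "sqrt ((F (Suc k) x - F k x)\<^sup>2) \<le> sqrt (c / 2 ^ k)" by (rule real_sqrt_le_mono)
      then have "\<bar>F (Suc k) x - F k x\<bar> \<le> sqrt (c / 2 ^ k)" by (simp only: real_sqrt_abs)
      then show ?thesis by (simp add: real_sqrt_divide real_sqrt_power power_divide)
    qed
    have s: "summable (\<lambda>k. sqrt c * (1 / sqrt 2) ^ k)"
      by (intro summable_mult summable_geometric) simp
    have "summable (\<lambda>k. F (Suc k) x - F k x)"
      by (rule summable_comparison_test'[OF s, where N=0]) (rule b)
    then have "convergent (\<lambda>n. \<Sum>k<n. F (Suc k) x - F k x)" by (simp add: summable_iff_convergent)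
    moreover have "(\<lambda>n. \<Sum>k<n. F (Suc k) x - F k x) = (\<lambda>n. F n x - F 0 x)"
      by (rule ext) (rule sum_lessThan_telescope)
    ultimately have "convergent (\<lambda>n. F 0 x + (F n x - F 0 x))"
      by (intro convergent_add convergent_const) simp
    then show ?case by simp
  qed
qed

text \<open>Riesz-Fischer: \<open>g\<close> is the pointwise limit of a fast subsequence, and
  Fatou's lemma carries the Cauchy estimates over to the distance of every \<open>F n\<close> from
  \<open>g\<close>.\<close>

lemma L2_complete:
  assumes F: "\<And>n. sqint M (F n)"
    and C: "\<And>e. e > 0 \<Longrightarrow> \<exists>N. \<forall>m\<ge>N. \<forall>n\<ge>N. l2 M (\<lambda>x. F m x - F n x) \<le> e"
  obtains g where "sqint M g" "(\<lambda>n. l2 M (\<lambda>x. F n x - g x)) \<longlonglongrightarrow> 0"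
proof -
  have "\<exists>N. \<forall>m\<ge>N. \<forall>n\<ge>N. l2 M (\<lambda>x. F m x - F n x) \<le> (1 / 2) ^ k" for k
    by (rule C) simp
  then obtain N where N: "\<And>k m n. m \<ge> N k \<Longrightarrow> n \<ge> N k \<Longrightarrow> l2 M (\<lambda>x. F m x - F n x) \<le> (1 / 2) ^ k"
    by metis
  \<comment> \<open>Adding all earlier thresholds makes \<open>r\<close> nondecreasing and at least
    both \<open>k\<close> and \<open>N k\<close>.\<close>
  define r where "r k = k + (\<Sum>i\<le>k. N i)" for k
  have rN: "r k \<ge> N k" for k by (simp add: r_def sum.remove[of "{..k}" k])
  have rk: "r k \<ge> k" for k by (simp add: r_def)
  have rS: "r k \<le> r (Suc k)" for k by (simp add: r_def)
  have conv: "AE x in M. convergent (\<lambda>k. F (r k) x)"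
    by (rule sqint_AE_convergent[OF F]) (intro N order_trans[OF rN rS] rN)
  define g where "g x = lim (\<lambda>k. F (r k) x)" for x
  note [measurable] = sqint_measurable[OF F]
  have [measurable]: "g \<in> borel_measurable M"
    unfolding g_def[abs_def] by (rule borel_measurable_lim_metric) measurable
  have close: "(\<integral>\<^sup>+x. ennreal ((F n x - g x)\<^sup>2) \<partial>M) \<le> ennreal (e\<^sup>2)"
    if n: "\<And>m. m \<ge> N0 \<Longrightarrow> l2 M (\<lambda>x. F n x - F m x) \<le> e" for n e N0
  proof -
    have "(\<integral>\<^sup>+x. ennreal ((F n x - g x)\<^sup>2) \<partial>M) \<le> (\<integral>\<^sup>+x. liminf (\<lambda>k. ennreal ((F n x - F (r k) x)\<^sup>2)) \<partial>M)"
    proof (rule nn_integral_mono_AE)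
      show "AE x in M. ennreal ((F n x - g x)\<^sup>2) \<le> liminf (\<lambda>k. ennreal ((F n x - F (r k) x)\<^sup>2))"
        using conv
      proof eventually_elim
        case (elim x)
        then have "(\<lambda>k. F (r k) x) \<longlonglongrightarrow> g x" by (simp add: g_def convergent_LIMSEQ_iff)
        then have "(\<lambda>k. ennreal ((F n x - F (r k) x)\<^sup>2)) \<longlonglongrightarrow> ennreal ((F n x - g x)\<^sup>2)"
          by (intro tendsto_intros) auto
        then have "liminf (\<lambda>k. ennreal ((F n x - F (r k) x)\<^sup>2)) = ennreal ((F n x - g x)\<^sup>2)"
          by (intro lim_imp_Liminf) auto
        then show ?case by simp
      qed
    qed
    also have "\<dots> \<le> liminf (\<lambda>k. \<integral>\<^sup>+x. ennreal ((F n x - F (r k) x)\<^sup>2) \<partial>M)"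
      by (rule nn_integral_liminf) measurable
    also have "\<dots> = liminf (\<lambda>k. ennreal ((l2 M (\<lambda>x. F n x - F (r k) x))\<^sup>2))"
      by (simp add: sqint_nn_integral sqint_diff F)
    also have "\<dots> \<le> ennreal (e\<^sup>2)"
    proof (rule Liminf_le)
      show "\<forall>\<^sub>F k in sequentially. ennreal ((l2 M (\<lambda>x. F n x - F (r k) x))\<^sup>2) \<le> ennreal (e\<^sup>2)"
        using eventually_ge_at_top[of N0]
      proof eventually_elim
        case (elim k)
        then show ?case using n[of "r k"] rk[of k] by (intro ennreal_leI power_mono) auto
      qed
    qed simp
    finally show ?thesis .
  qed
  \<comment> \<open>At \<open>k = 0\<close> the Cauchy bound is 1, so \<open>g\<close> differs from
    \<open>F (N 0)\<close> by a square integrable function.\<close>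
  have sd: "sqint M (\<lambda>x. F (N 0) x - g x)"
    by (rule sqintI_nn_integral(1)[OF _ close[of "N 0" "N 0" 1]]) (use N[of 0] in auto)
  have g: "sqint M g" using sqint_diff[OF F[of "N 0"] sd] by simp
  have "(\<lambda>n. l2 M (\<lambda>x. F n x - g x)) \<longlonglongrightarrow> 0"
  proof (rule LIMSEQ_I)
    fix e :: real assume "e > 0"
    then obtain N0 where N0: "\<And>m n. m \<ge> N0 \<Longrightarrow> n \<ge> N0 \<Longrightarrow> l2 M (\<lambda>x. F m x - F n x) \<le> e / 2"
      using C[of "e / 2"] by auto
    have "l2 M (\<lambda>x. F n x - g x) \<le> e / 2" if "n \<ge> N0" for n
      by (rule sqintI_nn_integral(2)[OF _ close[of N0 n "e / 2"]]) (use N0 that \<open>e > 0\<close> in auto)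
    then show "\<exists>no. \<forall>n\<ge>no. norm (l2 M (\<lambda>x. F n x - g x) - 0) < e"
      using \<open>e > 0\<close> by (intro exI[of _ N0]) force
  qed
  with g that show thesis by blast
qed

lemma l2_parallelogram:
  assumes "sqint M f" "sqint M g"
  shows "(l2 M (\<lambda>x. f x - g x))\<^sup>2 = 2 * (l2 M f)\<^sup>2 + 2 * (l2 M g)\<^sup>2 - (l2 M (\<lambda>x. f x + g x))\<^sup>2"
proof -
  have s: "integrable M (\<lambda>x. (f x)\<^sup>2)" "integrable M (\<lambda>x. (g x)\<^sup>2)" "integrable M (\<lambda>x. (f x + g x)\<^sup>2)"
    using assms sqint_add[OF assms] by (auto simp: sqint_def)
  have "(l2 M (\<lambda>x. f x - g x))\<^sup>2 = (\<integral>x. 2 * (f x)\<^sup>2 + 2 * (g x)\<^sup>2 - (f x + g x)\<^sup>2 \<partial>M)"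
    unfolding l2_power2 by (rule Bochner_Integration.integral_cong) (auto simp: power2_eq_square algebra_simps)
  also have "\<dots> = 2 * (l2 M f)\<^sup>2 + 2 * (l2 M g)\<^sup>2 - (l2 M (\<lambda>x. f x + g x))\<^sup>2"
    using s by (simp add: l2_power2)
  finally show ?thesis .
qed

lemma l2_add_power2:
  assumes "sqint M f" "sqint M g"
  shows "(l2 M (\<lambda>x. f x + t * g x))\<^sup>2 = (l2 M f)\<^sup>2 + 2 * t * (\<integral>x. g x * f x \<partial>M) + t\<^sup>2 * (l2 M g)\<^sup>2"
proof -
  have s: "integrable M (\<lambda>x. (f x)\<^sup>2)" "integrable M (\<lambda>x. (g x)\<^sup>2)" "integrable M (\<lambda>x. g x * f x)"
    using assms sqint_mult_integrable[OF assms(2,1)] by (auto simp: sqint_def)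
  have "(l2 M (\<lambda>x. f x + t * g x))\<^sup>2 = (\<integral>x. (f x)\<^sup>2 + 2 * t * (g x * f x) + t\<^sup>2 * (g x)\<^sup>2 \<partial>M)"
    unfolding l2_power2 by (rule Bochner_Integration.integral_cong) (auto simp: power2_eq_square algebra_simps)
  also have "\<dots> = (l2 M f)\<^sup>2 + 2 * t * (\<integral>x. g x * f x \<partial>M) + t\<^sup>2 * (l2 M g)\<^sup>2"
    using s by (simp add: l2_power2)
  finally show ?thesis .
qed

text \<open>The representing function is the limit of a minimising sequence of the quadratic
  functional \<open>\<parallel>\<phi>\<parallel>\<^sup>2 / 2 - T \<phi>\<close>.\<close>

lemma L2_Riesz:
  fixes T :: "('a \<Rightarrow> real) \<Rightarrow> real"
  assumes S0: "(\<lambda>x. 0) \<in> S" and S: "\<And>\<phi>. \<phi> \<in> S \<Longrightarrow> sqint M \<phi>"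
    and S_lin: "\<And>\<phi> \<psi> t. \<phi> \<in> S \<Longrightarrow> \<psi> \<in> S \<Longrightarrow> (\<lambda>x. \<phi> x + t * \<psi> x) \<in> S"
    and T_lin: "\<And>\<phi> \<psi> t. \<phi> \<in> S \<Longrightarrow> \<psi> \<in> S \<Longrightarrow> T (\<lambda>x. \<phi> x + t * \<psi> x) = T \<phi> + t * T \<psi>"
    and T_bound: "\<And>\<phi>. \<phi> \<in> S \<Longrightarrow> \<bar>T \<phi>\<bar> \<le> C * l2 M \<phi>"
  obtains g where "sqint M g" "\<And>\<phi>. \<phi> \<in> S \<Longrightarrow> T \<phi> = (\<integral>x. g x * \<phi> x \<partial>M)"
proof -
  define E where "E \<phi> = (l2 M \<phi>)\<^sup>2 / 2 - T \<phi>" for \<phi>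
  have Eb: "E \<phi> \<ge> - (C\<^sup>2 / 2)" if "\<phi> \<in> S" for \<phi>
    using T_bound[OF that] sum_squares_bound[of C "l2 M \<phi>"] unfolding E_def by simp
  define m where "m = Inf (E ` S)"
  have bdd: "bdd_below (E ` S)" using Eb by (auto intro!: bdd_belowI)
  have mE: "m \<le> E \<phi>" if "\<phi> \<in> S" for \<phi> unfolding m_def by (rule cInf_lower[OF imageI[OF that] bdd])
  have "\<exists>\<phi>\<in>S. E \<phi> < m + 1 / real (Suc n)" for n
  proof -
    have "Inf (E ` S) < m + 1 / real (Suc n)" unfolding m_def by simp
    then show ?thesis using S0 bdd by (subst (asm) cInf_less_iff) auto
  qed
  then obtain F where F: "\<And>n. F n \<in> S" "\<And>n. E (F n) < m + 1 / real (Suc n)" by metis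
  note sF = S[OF F(1)]
  \<comment> \<open>By the parallelogram law the squared distance is a multiple of the energy excess
    of the two functions over their midpoint; the linear part \<open>T\<close> cancels, and the
    midpoint has energy at least \<open>m\<close>.\<close>
  have par: "(l2 M (\<lambda>x. F i x - F j x))\<^sup>2 \<le> 4 * (1 / real (Suc i) + 1 / real (Suc j))" for i j
  proof -
    \<comment> \<open>The midpoint, written in the shape \<open>\<phi> x + t * \<psi> x\<close> that
      \<open>S_lin\<close> accepts, applied twice.\<close>
    let ?h = "\<lambda>x. 0 + (1 / 2) * (F i x + 1 * F j x)"
    have h: "?h \<in> S" by (intro S_lin S0 F)
    have T0: "T (\<lambda>x. 0) = 0" using T_bound[OF S0] by (simp add: l2_def)
    have "T ?h = T (\<lambda>x. 0) + (1 / 2) * T (\<lambda>x. F i x + 1 * F j x)"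
      by (rule T_lin[OF S0 S_lin[OF F(1) F(1)]])
    then have Th: "T ?h = (T (F i) + T (F j)) / 2"
      using T_lin[OF F(1)[of i] F(1)[of j], of 1] T0 by simp
    have lh: "(l2 M ?h)\<^sup>2 = (l2 M (\<lambda>x. F i x + F j x))\<^sup>2 / 4"
    proof -
      have "l2 M ?h = 1 / 2 * l2 M (\<lambda>x. F i x + F j x)"
        using l2_cmult[of M "1 / 2" "\<lambda>x. F i x + F j x"] by simp
      then show ?thesis by (simp only: power_mult_distrib) (simp add: power_divide)
    qed
    have "(l2 M (\<lambda>x. F i x - F j x))\<^sup>2 = 4 * (E (F i) + E (F j) - 2 * E ?h)"
      unfolding E_def Th lh l2_parallelogram[OF sF sF] by (simp add: field_simps)
    also have "\<dots> \<le> 4 * (1 / real (Suc i) + 1 / real (Suc j))"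
      using F(2)[of i] F(2)[of j] mE[OF h] by simp
    finally show ?thesis .
  qed
  \<comment> \<open>The limit is sought among all square integrable functions; \<open>S\<close> need
    not be closed.\<close>
  obtain g where g: "sqint M g" "(\<lambda>n. l2 M (\<lambda>x. F n x - g x)) \<longlonglongrightarrow> 0"
  proof (rule L2_complete[OF sF])
    fix e :: real assume "e > 0"
    obtain N where N: "8 / e\<^sup>2 < real N" using reals_Archimedean2 by blast
    have "l2 M (\<lambda>x. F i x - F j x) \<le> e" if "i \<ge> N" "j \<ge> N" for i j
    proof -
      have "1 / real (Suc k) \<le> e\<^sup>2 / 8" if "k \<ge> N" for k
      proof -
        have "8 / e\<^sup>2 \<le> real (Suc k)" using N that by simp
        then show ?thesis using \<open>e > 0\<close> by (simp add: field_simps)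
      qed
      note k = this
      have "(l2 M (\<lambda>x. F i x - F j x))\<^sup>2 \<le> 4 * (1 / real (Suc i) + 1 / real (Suc j))" by (rule par)
      also have "\<dots> \<le> 4 * (e\<^sup>2 / 8 + e\<^sup>2 / 8)" by (intro mult_left_mono add_mono k that) simp
      also have "\<dots> = e\<^sup>2" by simp
      finally have "(l2 M (\<lambda>x. F i x - F j x))\<^sup>2 \<le> e\<^sup>2" .
      then show ?thesis by (rule power2_le_imp_le) (use \<open>e > 0\<close> in simp)
    qed
    then show "\<exists>N. \<forall>i\<ge>N. \<forall>j\<ge>N. l2 M (\<lambda>x. F i x - F j x) \<le> e" by blast
  qed
  have "T \<psi> = (\<integral>x. g x * \<psi> x \<partial>M)" if \<psi>: "\<psi> \<in> S" for \<psi>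
  proof -
    \<comment> \<open>Perturbing the minimising sequence by \<open>t * \<psi>\<close> gives in the
      limit a nonnegative quadratic in \<open>t\<close> without constant term, so its linear
      coefficient vanishes.\<close>
    let ?b = "((\<integral>x. \<psi> x * g x \<partial>M) - T \<psi>) / 2" and ?c = "(l2 M \<psi>)\<^sup>2 / 2"
    have "0 \<le> 0 + 2 * t * ?b + t\<^sup>2 * ?c" for t
    proof -
      have "(\<lambda>n. 1 / real (Suc n) + t * ((\<integral>x. \<psi> x * F n x \<partial>M) - T \<psi>) + t\<^sup>2 * ?c)
          \<longlonglongrightarrow> 0 + t * ((\<integral>x. \<psi> x * g x \<partial>M) - T \<psi>) + t\<^sup>2 * ?c"
        by (intro tendsto_intros LIMSEQ_Suc[OF lim_1_over_n] integral_mult_tendsto[OF sF g S[OF \<psi>]])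
      moreover have "0 \<le> 1 / real (Suc n) + t * ((\<integral>x. \<psi> x * F n x \<partial>M) - T \<psi>) + t\<^sup>2 * ?c" for n
      proof -
        have "m \<le> E (\<lambda>x. F n x + t * \<psi> x)" by (intro mE S_lin F \<psi>)
        also have "\<dots> = E (F n) + t * ((\<integral>x. \<psi> x * F n x \<partial>M) - T \<psi>) + t\<^sup>2 * ?c"
          unfolding E_def l2_add_power2[OF sF S[OF \<psi>]] T_lin[OF F(1) \<psi>] by (simp add: field_simps)
        finally show ?thesis using F(2)[of n] by linarith
      qed
      ultimately have "0 \<le> 0 + t * ((\<integral>x. \<psi> x * g x \<partial>M) - T \<psi>) + t\<^sup>2 * ?c"
        by (intro LIMSEQ_le_const) auto
      then show ?thesis by simp
    qed
    then have "?b\<^sup>2 \<le> 0 * ?c" by (rule nonneg_quadratic_imp) simp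
    then show ?thesis by (simp add: mult.commute)
  qed
  with g that show thesis by blast
qed

subsection \<open>Difference quotients\<close>

text \<open>The increment is not divided by the step; bounds carry a factor
  \<open>\<bar>t\<bar>\<close> instead, so a zero step needs no special treatment.\<close>

definition dif :: "vec2 \<Rightarrow> (vec2 \<Rightarrow> real) \<Rightarrow> vec2 \<Rightarrow> real" where
  "dif h f x = f (x + h) - f x"

lemma sqint_dif: "sqint lborel f \<Longrightarrow> sqint lborel (dif h f)"
  unfolding dif_def[abs_def] by (intro sqint_diff sqint_shift)

lemma test_fun_dif: "test_fun UNIV f \<Longrightarrow> test_fun UNIV (dif h f)"
  unfolding dif_def[abs_def] by (intro test_fun_diff test_fun_shift)

lemma pdiff_smooth2_shift: "smooth2 f \<Longrightarrow> pdiff (\<lambda>x. f (x + h)) j = (\<lambda>x. pdiff f j (x + h))"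
  using pdiff_smooth2_affine_arg[of f h 1 j] by (simp add: add.commute)

lemma smooth2_shift: "smooth2 f \<Longrightarrow> smooth2 (\<lambda>x. f (x + h))"
  using smooth2_affine_arg[of f h 1] by (simp add: add.commute)

lemma pdiff_dif: "smooth2 f \<Longrightarrow> pdiff (dif h f) j = dif h (pdiff f j)"
  unfolding dif_def[abs_def] by (simp add: pdiff_smooth2_diff smooth2_shift pdiff_smooth2_shift)

text \<open>Summation by parts, from translation invariance. Since \<open>dif\<close> carries no
  factor 1/h, its adjoint is \<open>dif (- h)\<close> without a change of sign.\<close>

lemma integral_dif_mult:
  assumes f: "sqint lborel f" and g: "sqint lborel g"
  shows "(\<integral>x. dif h f x * g x \<partial>lborel) = (\<integral>x. f x * dif (- h) g x \<partial>lborel)"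
proof -
  have [measurable]: "f \<in> borel_measurable borel" "g \<in> borel_measurable borel"
    using f g by (auto simp: sqint_def)
  have "(\<integral>x. f (x + h) * g (x + h + - h) \<partial>lborel) = (\<integral>x. f x * g (x + - h) \<partial>lborel)"
    by (rule integral_lborel_shift[of "\<lambda>x. f x * g (x + - h)"]) measurable
  then have eq: "(\<integral>x. f (x + h) * g x \<partial>lborel) = (\<integral>x. f x * g (x + - h) \<partial>lborel)" by simp
  have "(\<integral>x. dif h f x * g x \<partial>lborel) = (\<integral>x. f (x + h) * g x \<partial>lborel) - (\<integral>x. f x * g x \<partial>lborel)"
    unfolding dif_def left_diff_distrib
    by (intro Bochner_Integration.integral_diff sqint_mult_integrable sqint_shift f g)
  also have "\<dots> = (\<integral>x. f x * dif (- h) g x \<partial>lborel)"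
    unfolding dif_def right_diff_distrib eq
    by (intro Bochner_Integration.integral_diff[symmetric] sqint_mult_integrable sqint_shift f g)
  finally show ?thesis .
qed

lemma kint_line_derivative:
  assumes "integrable lborel f" "test_fun UNIV w"
  shows "((\<lambda>s. \<integral>x. f x * w (x + s *\<^sub>R axis k 1) \<partial>lborel) has_real_derivative
      (\<integral>x. f x * pdiff w k (x + s *\<^sub>R axis k 1) \<partial>lborel)) (at s)"
proof -
  let ?e = "axis k 1 :: vec2"
  have 1: "((\<lambda>s. s *\<^sub>R ?e) has_derivative (\<lambda>h. h *\<^sub>R ?e)) (at s)"
    by (auto intro!: derivative_eq_intros)
  have "((\<lambda>s. kint 1 f w (s *\<^sub>R ?e)) has_derivative
     (\<lambda>h. \<Sum>j\<in>UNIV. (h *\<^sub>R ?e) $ j * kint 1 f (pdiff w j) (s *\<^sub>R ?e))) (at s)"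
    by (rule has_derivative_compose[OF 1 kint_has_derivative[OF assms]])
  moreover have "(\<Sum>j\<in>UNIV. (h *\<^sub>R ?e) $ j * kint 1 f (pdiff w j) (s *\<^sub>R ?e)) =
      kint 1 f (pdiff w k) (s *\<^sub>R ?e) * h" for h
    by (simp add: axis_def if_distrib[of "\<lambda>z. _ * z"] if_distrib[of "\<lambda>z. z * _"] cong: if_cong)
  ultimately have "((\<lambda>s. kint 1 f w (s *\<^sub>R ?e)) has_real_derivative kint 1 f (pdiff w k) (s *\<^sub>R ?e)) (at s)"
    by (simp add: has_field_derivative_def)
  then show ?thesis by (simp add: kint_def add.commute)
qed

text \<open>Mean value inequality for the pairing of \<open>f\<close> with the translates of
  \<open>w\<close> along an axis: the derivative of this function of \<open>s\<close> is bounded by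
  Cauchy-Schwarz and translation invariance. The function \<open>f\<close> itself need not be
  differentiable, which is how the stress is handled.\<close>

lemma integral_mult_dif_le:
  assumes f: "sqint lborel f" "integrable lborel f" and w: "test_fun UNIV w"
  shows "\<bar>\<integral>x. f x * dif (t *\<^sub>R axis k 1) w x \<partial>lborel\<bar> \<le> \<bar>t\<bar> * (l2 lborel f * l2 lborel (pdiff w k))"
proof -
  let ?q = "\<lambda>s. \<integral>x. f x * w (x + s *\<^sub>R axis k 1) \<partial>lborel"
  have sp: "sqint lborel (pdiff w k)" by (rule test_fun_sqint[OF test_fun_pdiff[OF w]])
  have "norm (?q t - ?q 0) \<le> (l2 lborel f * l2 lborel (pdiff w k)) * norm (t - 0)"
  proof (rule field_differentiable_bound[of UNIV])
    fix s
    show "(?q has_field_derivative (\<integral>x. f x * pdiff w k (x + s *\<^sub>R axis k 1) \<partial>lborel)) (at s within UNIV)"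
      by (rule kint_line_derivative[OF f(2) w])
    show "norm (\<integral>x. f x * pdiff w k (x + s *\<^sub>R axis k 1) \<partial>lborel) \<le> l2 lborel f * l2 lborel (pdiff w k)"
      using l2_Cauchy_Schwarz[OF f(1) sqint_shift[OF sp, of "s *\<^sub>R axis k 1"]] by (simp add: l2_shift[OF sp])
  qed auto
  moreover have "?q t - ?q 0 = (\<integral>x. f x * dif (t *\<^sub>R axis k 1) w x \<partial>lborel)"
    unfolding dif_def right_diff_distrib
    using sqint_mult_integrable[OF f(1) sqint_shift[OF test_fun_sqint[OF w], of "t *\<^sub>R axis k 1"]]
      sqint_mult_integrable[OF f(1) test_fun_sqint[OF w]]
    by (subst Bochner_Integration.integral_diff) auto
  ultimately show ?thesis by (simp add: mult.commute)
qed

text \<open>Pair the increment with itself in \<open>integral_mult_dif_le\<close> and cancel one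
  factor of its norm.\<close>

lemma l2_dif_le:
  assumes w: "test_fun UNIV w"
  shows "l2 lborel (dif (t *\<^sub>R axis k 1) w) \<le> \<bar>t\<bar> * l2 lborel (pdiff w k)"
proof -
  let ?d = "dif (t *\<^sub>R axis k 1) w"
  have d: "test_fun UNIV ?d" by (rule test_fun_dif[OF w])
  have "(l2 lborel ?d)\<^sup>2 = (\<integral>x. ?d x * ?d x \<partial>lborel)"
    unfolding l2_power2 by (simp add: power2_eq_square)
  also have "\<dots> \<le> \<bar>t\<bar> * (l2 lborel ?d * l2 lborel (pdiff w k))"
    using integral_mult_dif_le[OF test_fun_sqint[OF d] test_fun_integrable[OF d] w, of t k] by linarith
  finally have "l2 lborel ?d * l2 lborel ?d \<le> l2 lborel ?d * (\<bar>t\<bar> * l2 lborel (pdiff w k))"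
    by (simp add: power2_eq_square mult.left_commute)
  then show ?thesis
    by (cases "l2 lborel ?d = 0") (auto simp: less_le)
qed

definition l2conv :: "(nat \<Rightarrow> vec2 \<Rightarrow> real) \<Rightarrow> (vec2 \<Rightarrow> real) \<Rightarrow> bool" where
  "l2conv F f \<longleftrightarrow> (\<forall>n. sqint lborel (F n)) \<and> sqint lborel f \<and> (\<lambda>n. l2 lborel (\<lambda>x. F n x - f x)) \<longlonglongrightarrow> 0"

lemma l2conv_l2: "l2conv F f \<Longrightarrow> (\<lambda>n. l2 lborel (F n)) \<longlonglongrightarrow> l2 lborel f"
  unfolding l2conv_def by (intro l2_tendsto) auto

lemma l2conv_integral:
  "l2conv F f \<Longrightarrow> sqint lborel h \<Longrightarrow> (\<lambda>n. \<integral>x. h x * F n x \<partial>lborel) \<longlonglongrightarrow> (\<integral>x. h x * f x \<partial>lborel)"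
  unfolding l2conv_def by (intro integral_mult_tendsto) auto

lemma l2conv_dif:
  assumes "l2conv F f"
  shows "l2conv (\<lambda>n. dif h (F n)) (dif h f)"
proof -
  have s: "sqint lborel (F n)" "sqint lborel f" for n using assms by (auto simp: l2conv_def)
  have le: "l2 lborel (\<lambda>x. dif h (F n) x - dif h f x) \<le> 2 * l2 lborel (\<lambda>x. F n x - f x)" for n
  proof -
    note d = sqint_diff[OF s(1)[of n] s(2)]
    have "(\<lambda>x. dif h (F n) x - dif h f x) = (\<lambda>x. (F n (x + h) - f (x + h)) - (F n x - f x))"
      by (rule ext) (simp add: dif_def)
    then show ?thesis
      using l2_triangle_diff[OF sqint_shift[OF d, of h] d] l2_shift[OF d, of h] by simp
  qed
  have "(\<lambda>n. 2 * l2 lborel (\<lambda>x. F n x - f x)) \<longlonglongrightarrow> 2 * 0"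
    using assms unfolding l2conv_def by (intro tendsto_mult_left) simp
  then have "(\<lambda>n. 2 * l2 lborel (\<lambda>x. F n x - f x)) \<longlonglongrightarrow> 0" by simp
  then have "(\<lambda>n. l2 lborel (\<lambda>x. dif h (F n) x - dif h f x)) \<longlonglongrightarrow> 0"
    by (rule Lim_null_comparison[rotated]) (simp add: le)
  with s show ?thesis by (simp add: l2conv_def sqint_dif)
qed

lemma l2conv_mult:
  assumes F: "l2conv F f" and h: "h \<in> borel_measurable borel" "\<And>x. \<bar>h x\<bar> \<le> C"
  shows "l2conv (\<lambda>n x. h x * F n x) (\<lambda>x. h x * f x)"
proof -
  have s: "sqint lborel (F n)" "sqint lborel f" for n using F by (auto simp: l2conv_def)
  have m: "sqint lborel (\<lambda>x. h x * q x)" if "sqint lborel q" for q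
    by (rule sqint_bounded_mult[OF that _ h(2)]) (simp add: h(1))
  have C: "C \<ge> 0" using h(2)[of 0] by linarith
  have le: "l2 lborel (\<lambda>x. h x * F n x - h x * f x) \<le> C * l2 lborel (\<lambda>x. F n x - f x)" for n
    unfolding right_diff_distrib[symmetric]
    by (rule l2_bound[OF sqint_diff[OF s] m[OF sqint_diff[OF s]] _ C]) (simp add: abs_mult h(2) mult_right_mono)
  have "(\<lambda>n. C * l2 lborel (\<lambda>x. F n x - f x)) \<longlonglongrightarrow> C * 0"
    using F unfolding l2conv_def by (intro tendsto_mult_left) simp
  then have "(\<lambda>n. C * l2 lborel (\<lambda>x. F n x - f x)) \<longlonglongrightarrow> 0" by simp
  then have "(\<lambda>n. l2 lborel (\<lambda>x. h x * F n x - h x * f x)) \<longlonglongrightarrow> 0"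
    by (rule Lim_null_comparison[rotated]) (simp add: le)
  with s show ?thesis by (simp add: l2conv_def m)
qed

text \<open>In terms of z = X/t the hypothesis reads c z^2 \<le> K (Q + z), and z > K/c + Q would
  give z (c z - K) > K Q. The products \<open>a = t * K\<close> and \<open>d = t * Q\<close> replace
  the division, so \<open>t = 0\<close> is included.\<close>

lemma quadratic_absorption:
  fixes c K Q X t :: real
  assumes "c > 0" "K \<ge> 0" "Q \<ge> 0" "X \<ge> 0" "t \<ge> 0" and le: "c * X\<^sup>2 \<le> t * (K * (t * Q + X))"
  shows "X \<le> t * (K / c + Q)"
proof (rule ccontr)
  assume "\<not> X \<le> t * (K / c + Q)"
  then have X: "t * (K / c + Q) < X" by (rule not_le_imp_less)
  define a d where "a = t * K" and "d = t * Q"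
  have a0: "a \<ge> 0" and d0: "d \<ge> 0" using assms by (simp_all add: a_def d_def)
  have cX: "a + c * d < c * X"
  proof -
    have "c * (t * (K / c + Q)) = t * (c * (K / c)) + c * (t * Q)" by (simp add: algebra_simps)
    also have "c * (K / c) = K" using \<open>c > 0\<close> by simp
    finally show ?thesis
      using mult_strict_left_mono[OF X \<open>c > 0\<close>] by (simp only: a_def d_def)
  qed
  have "X > 0"
  proof (rule le_less_trans[OF _ X])
    show "0 \<le> t * (K / c + Q)" using assms(1-5) by simp
  qed
  have "0 \<le> c * d" using \<open>c > 0\<close> d0 by simp
  then have "a * d \<le> (c * X) * d" using cX by (intro mult_right_mono[OF _ d0]) linarith
  moreover have "(a + c * d) * X < (c * X) * X" by (rule mult_strict_right_mono[OF cX \<open>X > 0\<close>])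
  moreover have "(c * X) * X \<le> a * d + a * X"
  proof -
    have "(c * X) * X = c * X\<^sup>2" by (simp add: power2_eq_square)
    also note le
    also have "t * (K * (t * Q + X)) = a * d + a * X" unfolding a_def d_def by (simp add: algebra_simps)
    finally show ?thesis .
  qed
  moreover have "(a + c * d) * X = a * X + (c * X) * d" by (simp add: algebra_simps)
  ultimately show False by linarith
qed

text \<open>The core estimate, detached from the particular functional: \<open>G\<close> is only
  square integrable, and its sole link to \<open>g\<close> is monotonicity between arbitrary points.
  The bound is linear in \<open>\<bar>t\<bar>\<close>, with \<open>Y\<close> independent of step and
  direction.\<close>

lemma monotone_system_difference_bound:
  fixes v :: "2 \<Rightarrow> vec2 \<Rightarrow> real" and g G :: "2 \<Rightarrow> 2 \<Rightarrow> vec2 \<Rightarrow> real"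
  assumes "open U" "compact S" and v0: "\<And>i x. x \<notin> S \<Longrightarrow> v i x = 0"
    and v: "\<And>i. sqint lborel (v i)" "\<And>i. integrable lborel (v i)"
    and g: "\<And>i j. sqint lborel (g i j)" "\<And>i j. integrable lborel (g i j)"
    and G: "\<And>i j. sqint lborel (G i j)" "\<And>i j. integrable lborel (G i j)"
    and weak: "\<And>i j \<phi>. test_fun UNIV \<phi> \<Longrightarrow>
      (\<integral>x. v i x * pdiff \<phi> j x \<partial>lborel) = - (\<integral>x. g i j x * \<phi> x \<partial>lborel)"
    and mono: "\<And>x y. c * (\<Sum>i\<in>UNIV. \<Sum>j\<in>UNIV. (g i j x - g i j y)\<^sup>2) \<le>
      (\<Sum>i\<in>UNIV. \<Sum>j\<in>UNIV. (G i j x - G i j y) * (g i j x - g i j y))"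
    and c: "c > 0"
    and eq: "\<And>\<phi>. (\<And>i. test_fun U (\<phi> i)) \<Longrightarrow>
      (\<Sum>i\<in>UNIV. \<Sum>j\<in>UNIV. \<integral>x. G i j x * pdiff (\<phi> i) j x \<partial>lborel) = 0"
    and \<eta>: "test_fun U \<eta>"
  obtains r Y where "r > 0" "\<And>t k i j. \<bar>t\<bar> < r \<Longrightarrow>
    l2 lborel (\<lambda>x. \<eta> x * dif (t *\<^sub>R axis k 1) (g i j) x) \<le> \<bar>t\<bar> * Y"
proof -
  have \<eta>U: "test_fun UNIV \<eta>" using \<eta> by (rule test_fun_mono) simp
  note s\<eta> = test_fun_smooth2[OF \<eta>]
  obtain T where T: "compact T" "T \<subseteq> U" "\<And>x. x \<notin> T \<Longrightarrow> \<eta> x = 0" using \<eta> by (auto simp: test_fun_iff)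
  \<comment> \<open>For steps shorter than \<open>r\<close> the support of \<open>\<eta>\<close> can
    be translated without leaving \<open>U\<close>, where alone the equation holds.\<close>
  obtain r where r: "r > 0" "(\<Union>x\<in>T. cball x r) \<subseteq> U"
    using compact_subset_open_imp_cball_epsilon_subset[OF T(1) \<open>open U\<close> T(2)] by blast
  have "\<forall>i. \<exists>F. (\<forall>n. test_fun UNIV (F n)) \<and> (\<lambda>n. l2 lborel (\<lambda>x. F n x - v i x)) \<longlonglongrightarrow> 0 \<and>
    (\<forall>j. (\<lambda>n. l2 lborel (\<lambda>x. pdiff (F n) j x - g i j x)) \<longlonglongrightarrow> 0)"
  proof
    fix i
    show "\<exists>F. (\<forall>n. test_fun UNIV (F n)) \<and> (\<lambda>n. l2 lborel (\<lambda>x. F n x - v i x)) \<longlonglongrightarrow> 0 \<and>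
      (\<forall>j. (\<lambda>n. l2 lborel (\<lambda>x. pdiff (F n) j x - g i j x)) \<longlonglongrightarrow> 0)"
    proof (rule smooth_approximation[of "v i" S "g i", OF v(1) v(2) \<open>compact S\<close> v0 g(1) g(2) weak])
      fix F
      assume "\<And>n. test_fun UNIV (F n)" "(\<lambda>n. l2 lborel (\<lambda>x. F n x - v i x)) \<longlonglongrightarrow> 0"
        "\<And>j. (\<lambda>n. l2 lborel (\<lambda>x. pdiff (F n) j x - g i j x)) \<longlonglongrightarrow> 0"
      then show ?thesis by (intro exI[of _ F] conjI allI)
    qed
  qed
  from choice[OF this] obtain F where F': "\<forall>i. (\<forall>n. test_fun UNIV (F i n)) \<and>
    (\<lambda>n. l2 lborel (\<lambda>x. F i n x - v i x)) \<longlonglongrightarrow> 0 \<and>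
    (\<forall>j. (\<lambda>n. l2 lborel (\<lambda>x. pdiff (F i n) j x - g i j x)) \<longlonglongrightarrow> 0)" ..
  have F: "\<And>i n. test_fun UNIV (F i n)" "\<And>i. (\<lambda>n. l2 lborel (\<lambda>x. F i n x - v i x)) \<longlonglongrightarrow> 0"
    "\<And>i j. (\<lambda>n. l2 lborel (\<lambda>x. pdiff (F i n) j x - g i j x)) \<longlonglongrightarrow> 0"
    using F' by simp_all
  note sF = test_fun_smooth2[OF F(1)]
  have Fv: "l2conv (F i) (v i)" for i
    using F(1,2) v(1) by (auto simp: l2conv_def intro: test_fun_sqint)
  have Fg: "l2conv (\<lambda>n. pdiff (F i n) j) (g i j)" for i j
    using F(1,3) g(1) by (auto simp: l2conv_def intro!: test_fun_sqint test_fun_pdiff)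
  \<comment> \<open>Half the gradient of \<open>\<eta>\<^sup>2\<close>. The factor
    \<open>\<eta>\<close> kept here reappears after one more differentiation.\<close>
  define \<theta> where "\<theta> j x = \<eta> x * pdiff \<eta> j x" for j x
  have \<theta>: "test_fun UNIV (\<theta> j)" for j
    unfolding \<theta>_def[abs_def] by (intro test_fun_smooth2_mult s\<eta> test_fun_pdiff \<eta>U)
  have "\<exists>M. M > 0 \<and> (\<forall>x. \<bar>2 * pdiff (\<theta> j) k x\<bar> \<le> M)" for j k
    using test_fun_bounded[OF test_fun_cmult[OF test_fun_pdiff[OF \<theta>]], of 2 j k] by metis
  then obtain M1 where M1: "\<And>j k. M1 j k > 0" "\<And>j k x. \<bar>2 * pdiff (\<theta> j) k x\<bar> \<le> M1 j k" by metis
  have "\<exists>M. M > 0 \<and> (\<forall>x. \<bar>2 * pdiff \<eta> j x\<bar> \<le> M)" for j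
    using test_fun_bounded[OF test_fun_cmult[OF test_fun_pdiff[OF \<eta>U]], of 2 j] by metis
  then obtain M2 where M2: "\<And>j. M2 j > 0" "\<And>j x. \<bar>2 * pdiff \<eta> j x\<bar> \<le> M2 j" by metis
  \<comment> \<open>One constant above every coefficient that occurs in the derivatives of the
    functions \<open>w i j n\<close> below.\<close>
  define M where "M = (\<Sum>j\<in>UNIV. \<Sum>k\<in>UNIV. M1 j k) + (\<Sum>j\<in>UNIV. M2 j)"
  have M1M: "M1 j k \<le> M" and M2M: "M2 j \<le> M" for j k
  proof -
    have "M1 j k \<le> (\<Sum>k\<in>UNIV. M1 j k)" by (rule member_le_sum) (auto intro: less_imp_le M1)
    also have "\<dots> \<le> (\<Sum>j\<in>UNIV. \<Sum>k\<in>UNIV. M1 j k)"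
      by (rule member_le_sum) (auto intro!: sum_nonneg simp: less_imp_le[OF M1(1)])
    finally have 1: "M1 j k \<le> (\<Sum>j\<in>UNIV. \<Sum>k\<in>UNIV. M1 j k)" .
    have 2: "M2 j \<le> (\<Sum>j\<in>UNIV. M2 j)" by (rule member_le_sum) (auto intro: less_imp_le M2)
    have "0 \<le> (\<Sum>j\<in>UNIV. \<Sum>k\<in>UNIV. M1 j k)" by (auto intro!: sum_nonneg simp: less_imp_le[OF M1(1)])
    then show "M1 j k \<le> M" "M2 j \<le> M" using 1 2 M2(1)[of j] by (auto simp: M_def)
  qed
  have M0: "M \<ge> 0" using M1(1)[of 1 1] M1M[of 1 1] by linarith
  define N where "N = (\<Sum>i\<in>UNIV. \<Sum>j\<in>UNIV. l2 lborel (G i j))"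
  define Q where "Q = (\<Sum>i\<in>UNIV. \<Sum>k\<in>UNIV. l2 lborel (g i k))"
  have N0: "N \<ge> 0" and Q0: "Q \<ge> 0" by (auto simp: N_def Q_def intro!: sum_nonneg)
  obtain B where B: "\<And>x. \<bar>\<eta> x\<bar> \<le> B" using test_fun_bounded[OF \<eta>] by metis
  have m\<eta>: "\<eta> \<in> borel_measurable borel" by (rule smooth2_measurable[OF s\<eta>])
  have bound: "l2 lborel (\<lambda>x. \<eta> x * dif (t *\<^sub>R axis k 1) (g i0 j0) x) \<le> \<bar>t\<bar> * (N * M / c + Q)"
    if t: "\<bar>t\<bar> < r" for t k i0 j0
  proof -
    define h :: vec2 where "h = t *\<^sub>R axis k 1"
    have nh: "norm h < r" using t by (simp add: h_def norm_axis_1)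
    note dsm = test_fun_smooth2[OF test_fun_dif[OF F(1)]]
    define \<psi> where "\<psi> i n x = (\<eta> x * \<eta> x) * dif h (F i n) x" for i n x
    have \<psi>: "test_fun UNIV (\<psi> i n)" for i n
      unfolding \<psi>_def[abs_def] by (intro test_fun_smooth2_mult smooth2_mult s\<eta> test_fun_dif F)
    have p\<psi>: "pdiff (\<psi> i n) j x = (\<eta> x)\<^sup>2 * dif h (pdiff (F i n) j) x + 2 * \<theta> j x * dif h (F i n) x" for i j n x
      unfolding \<psi>_def[abs_def] pdiff_smooth2_mult[OF smooth2_mult[OF s\<eta> s\<eta>] dsm] pdiff_smooth2_mult[OF s\<eta> s\<eta>]
        pdiff_dif[OF sF]
      by (simp add: \<theta>_def power2_eq_square algebra_simps)
    \<comment> \<open>The part of \<open>pdiff (\<psi> i n) j\<close> in which the derivative falls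
      on the cutoff.\<close>
    define w where "w i j n x = 2 * \<theta> j x * dif h (F i n) x" for i j n x
    have w: "test_fun UNIV (w i j n)" for i j n
      unfolding w_def[abs_def]
      by (intro test_fun_smooth2_mult smooth2_mult smooth2_const test_fun_smooth2[OF \<theta>] test_fun_dif F)
    have pw: "pdiff (w i j n) k = (\<lambda>x. (2 * pdiff (\<theta> j) k x) * dif h (F i n) x +
        (2 * pdiff \<eta> j x) * (\<eta> x * dif h (pdiff (F i n) k) x))" for i j n
      unfolding w_def[abs_def]
        pdiff_smooth2_mult[OF smooth2_mult[OF smooth2_const test_fun_smooth2[OF \<theta>]] dsm]
        pdiff_smooth2_mult[OF smooth2_const test_fun_smooth2[OF \<theta>]] pdiff_dif[OF sF]
      by (rule ext) (simp add: \<theta>_def algebra_simps)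
    have sd: "sqint lborel (dif h (F i n))" "sqint lborel (dif h (pdiff (F i n) j))" for i j n
      by (rule sqint_dif[OF test_fun_sqint[OF F(1)]] sqint_dif[OF test_fun_sqint[OF test_fun_pdiff[OF F(1)]]])+
    have s\<eta>d: "sqint lborel (\<lambda>x. \<eta> x * dif h (pdiff (F i n) j) x)" for i j n
      by (rule sqint_bounded_mult[OF sd(2) _ B]) (simp add: m\<eta>)
    \<comment> \<open>This is what makes absorption possible: second-order information on
      \<open>F i n\<close> enters only with the factor \<open>\<eta>\<close>, that is, through the
      quantity to be bounded.\<close>
    have lw: "l2 lborel (pdiff (w i j n) k) \<le>
        M * l2 lborel (dif h (F i n)) + M * l2 lborel (\<lambda>x. \<eta> x * dif h (pdiff (F i n) k) x)" for i j n
    proof -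
      have a: "\<bar>2 * pdiff (\<theta> j) k x\<bar> \<le> M" and b: "\<bar>2 * pdiff \<eta> j x\<bar> \<le> M" for x
        using M1(2)[of j k x] M1M[of j k] M2(2)[of j x] M2M[of j] by linarith+
      have ma: "(\<lambda>x. 2 * pdiff (\<theta> j) k x) \<in> borel_measurable lborel"
        and mb: "(\<lambda>x. 2 * pdiff \<eta> j x) \<in> borel_measurable lborel"
        using test_fun_measurable[OF test_fun_pdiff[OF \<theta>]] test_fun_measurable[OF test_fun_pdiff[OF \<eta>]] by simp_all
      note sa = sqint_bounded_mult[OF sd(1) ma a] and sb = sqint_bounded_mult[OF s\<eta>d mb b]
      have "l2 lborel (pdiff (w i j n) k) \<le> l2 lborel (\<lambda>x. (2 * pdiff (\<theta> j) k x) * dif h (F i n) x) +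
          l2 lborel (\<lambda>x. (2 * pdiff \<eta> j x) * (\<eta> x * dif h (pdiff (F i n) k) x))"
        unfolding pw by (rule l2_triangle[OF sa sb])
      also have "\<dots> \<le> M * l2 lborel (dif h (F i n)) + M * l2 lborel (\<lambda>x. \<eta> x * dif h (pdiff (F i n) k) x)"
      proof (rule add_mono)
        show "l2 lborel (\<lambda>x. (2 * pdiff (\<theta> j) k x) * dif h (F i n) x) \<le> M * l2 lborel (dif h (F i n))"
          by (rule l2_bound[OF sd(1) sa _ M0]) (metis a abs_ge_zero abs_mult mult_right_mono)
        show "l2 lborel (\<lambda>x. (2 * pdiff \<eta> j x) * (\<eta> x * dif h (pdiff (F i n) k) x))
            \<le> M * l2 lborel (\<lambda>x. \<eta> x * dif h (pdiff (F i n) k) x)"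
          by (rule l2_bound[OF s\<eta>d sb _ M0]) (metis b abs_ge_zero abs_mult mult_right_mono)
      qed
      finally show ?thesis .
    qed
    have sG: "sqint lborel (\<lambda>x. (\<eta> x)\<^sup>2 * dif h (G i j) x)" for i j
    proof (rule sqint_bounded_mult[OF sqint_dif[OF G(1)]])
      show "\<bar>(\<eta> x)\<^sup>2\<bar> \<le> B\<^sup>2" for x using power_mono[OF B[of x], of 2] by simp
    qed (use m\<eta> in \<open>simp add: borel_measurable_power\<close>)
    \<comment> \<open>The equation is tested with \<open>dif (- h) (\<psi> i n)\<close>. In the
      monotone part the difference is put on \<open>G\<close>; in the cutoff part it is left on the
      smooth \<open>w\<close>, because increments of \<open>G\<close> have no bound in terms of
      those of \<open>g\<close>.\<close>
    have main: "(\<Sum>i\<in>UNIV. \<Sum>j\<in>UNIV. \<integral>x. ((\<eta> x)\<^sup>2 * dif h (G i j) x) * dif h (pdiff (F i n) j) x \<partial>lborel) \<le>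
      (\<Sum>i\<in>UNIV. \<Sum>j\<in>UNIV. \<bar>t\<bar> * (l2 lborel (G i j) *
        (M * l2 lborel (dif h (F i n)) + M * l2 lborel (\<lambda>x. \<eta> x * dif h (pdiff (F i n) k) x))))" for n
    proof -
      have "(\<Sum>i\<in>UNIV. \<Sum>j\<in>UNIV. \<integral>x. G i j x * pdiff (dif (- h) (\<psi> i n)) j x \<partial>lborel) = 0"
      proof (rule eq)
        fix i
        show "test_fun U (dif (- h) (\<psi> i n))"
        proof (rule test_funI)
          \<comment> \<open>\<open>\<psi>\<close> vanishes off \<open>T\<close>, so its backward
            difference vanishes off \<open>T\<close> and the translate of \<open>T\<close> by
            \<open>h\<close>.\<close>
          show "compact ((\<Union>x\<in>T. {x}) \<union> ((+) h) ` T)"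
            using T(1) by (auto intro!: compact_Un compact_translation)
          show "(\<Union>x\<in>T. {x}) \<union> ((+) h) ` T \<subseteq> U"
          proof -
            have "h + x \<in> U" if "x \<in> T" for x
            proof -
              have "h + x \<in> cball x r" using nh by (simp add: dist_norm)
              with r(2) that show ?thesis by blast
            qed
            with T(2) show ?thesis by auto
          qed
          fix x assume x: "x \<notin> (\<Union>x\<in>T. {x}) \<union> ((+) h) ` T"
          have "x - h \<notin> T"
          proof
            assume "x - h \<in> T"
            then have "h + (x - h) \<in> ((+) h) ` T" by (rule imageI)
            with x show False by simp
          qed
          with x show "dif (- h) (\<psi> i n) x = 0" by (simp add: dif_def \<psi>_def T(3))
        qed (rule test_fun_smooth2[OF test_fun_dif[OF \<psi>]])
      qed
      moreover have "(\<integral>x. G i j x * pdiff (dif (- h) (\<psi> i n)) j x \<partial>lborel) =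
          (\<integral>x. ((\<eta> x)\<^sup>2 * dif h (G i j) x) * dif h (pdiff (F i n) j) x \<partial>lborel) +
          (\<integral>x. G i j x * dif (- h) (w i j n) x \<partial>lborel)" for i j
      proof -
        have "(\<integral>x. G i j x * pdiff (dif (- h) (\<psi> i n)) j x \<partial>lborel) =
            (\<integral>x. dif h (G i j) x * pdiff (\<psi> i n) j x \<partial>lborel)"
          unfolding pdiff_dif[OF test_fun_smooth2[OF \<psi>]]
          by (rule integral_dif_mult[symmetric, OF G(1) test_fun_sqint[OF test_fun_pdiff[OF \<psi>]]])
        also have "\<dots> = (\<integral>x. ((\<eta> x)\<^sup>2 * dif h (G i j) x) * dif h (pdiff (F i n) j) x + dif h (G i j) x * w i j n x \<partial>lborel)"
          by (rule Bochner_Integration.integral_cong) (simp_all add: p\<psi> w_def algebra_simps)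
        also have "\<dots> = (\<integral>x. ((\<eta> x)\<^sup>2 * dif h (G i j) x) * dif h (pdiff (F i n) j) x \<partial>lborel) +
            (\<integral>x. dif h (G i j) x * w i j n x \<partial>lborel)"
          by (intro Bochner_Integration.integral_add sqint_mult_integrable sG sd sqint_dif G test_fun_sqint[OF w])
        also have "(\<integral>x. dif h (G i j) x * w i j n x \<partial>lborel) = (\<integral>x. G i j x * dif (- h) (w i j n) x \<partial>lborel)"
          by (rule integral_dif_mult[OF G(1) test_fun_sqint[OF w]])
        finally show ?thesis .
      qed
      ultimately have "(\<Sum>i\<in>UNIV. \<Sum>j\<in>UNIV. \<integral>x. ((\<eta> x)\<^sup>2 * dif h (G i j) x) * dif h (pdiff (F i n) j) x \<partial>lborel) =
          (\<Sum>i\<in>UNIV. \<Sum>j\<in>UNIV. - (\<integral>x. G i j x * dif (- h) (w i j n) x \<partial>lborel))"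
        by (simp add: sum.distrib sum_negf)
      also have "\<dots> \<le> (\<Sum>i\<in>UNIV. \<Sum>j\<in>UNIV. \<bar>t\<bar> * (l2 lborel (G i j) *
        (M * l2 lborel (dif h (F i n)) + M * l2 lborel (\<lambda>x. \<eta> x * dif h (pdiff (F i n) k) x))))"
      proof (intro sum_mono)
        fix i j
        have "- (\<integral>x. G i j x * dif (- h) (w i j n) x \<partial>lborel) \<le>
            \<bar>- t\<bar> * (l2 lborel (G i j) * l2 lborel (pdiff (w i j n) k))"
          using integral_mult_dif_le[OF G w, of i j "- t" k i j n] by (simp add: h_def abs_le_iff)
        also have "\<dots> \<le> \<bar>t\<bar> * (l2 lborel (G i j) *
            (M * l2 lborel (dif h (F i n)) + M * l2 lborel (\<lambda>x. \<eta> x * dif h (pdiff (F i n) k) x)))"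
          unfolding abs_minus_cancel by (intro mult_left_mono lw) auto
        finally show "- (\<integral>x. G i j x * dif (- h) (w i j n) x \<partial>lborel) \<le> \<bar>t\<bar> * (l2 lborel (G i j) *
            (M * l2 lborel (dif h (F i n)) + M * l2 lborel (\<lambda>x. \<eta> x * dif h (pdiff (F i n) k) x)))" .
      qed
      finally show ?thesis .
    qed
    \<comment> \<open>The step \<open>h\<close> is fixed, so L2 convergence of the mollified
      gradients carries over to their increments on both sides.\<close>
    have lim: "(\<Sum>i\<in>UNIV. \<Sum>j\<in>UNIV. \<integral>x. ((\<eta> x)\<^sup>2 * dif h (G i j) x) * dif h (g i j) x \<partial>lborel) \<le>
      (\<Sum>i\<in>UNIV. \<Sum>j\<in>UNIV. \<bar>t\<bar> * (l2 lborel (G i j) *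
        (M * l2 lborel (dif h (v i)) + M * l2 lborel (\<lambda>x. \<eta> x * dif h (g i k) x))))"
    proof (rule LIMSEQ_le)
      show "(\<lambda>n. \<Sum>i\<in>UNIV. \<Sum>j\<in>UNIV. \<integral>x. ((\<eta> x)\<^sup>2 * dif h (G i j) x) * dif h (pdiff (F i n) j) x \<partial>lborel)
        \<longlonglongrightarrow> (\<Sum>i\<in>UNIV. \<Sum>j\<in>UNIV. \<integral>x. ((\<eta> x)\<^sup>2 * dif h (G i j) x) * dif h (g i j) x \<partial>lborel)"
        by (intro tendsto_sum l2conv_integral l2conv_dif Fg sG)
      show "(\<lambda>n. \<Sum>i\<in>UNIV. \<Sum>j\<in>UNIV. \<bar>t\<bar> * (l2 lborel (G i j) *
        (M * l2 lborel (dif h (F i n)) + M * l2 lborel (\<lambda>x. \<eta> x * dif h (pdiff (F i n) k) x))))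
        \<longlonglongrightarrow> (\<Sum>i\<in>UNIV. \<Sum>j\<in>UNIV. \<bar>t\<bar> * (l2 lborel (G i j) *
        (M * l2 lborel (dif h (v i)) + M * l2 lborel (\<lambda>x. \<eta> x * dif h (g i k) x))))"
        by (intro tendsto_sum tendsto_mult tendsto_add tendsto_const l2conv_l2 l2conv_dif Fv
            l2conv_mult[OF l2conv_dif[OF Fg] m\<eta> B])
    qed (use main in blast)
    have dv: "l2 lborel (dif h (v i)) \<le> \<bar>t\<bar> * l2 lborel (g i k)" for i
    proof (rule LIMSEQ_le)
      show "(\<lambda>n. l2 lborel (dif h (F i n))) \<longlonglongrightarrow> l2 lborel (dif h (v i))"
        by (intro l2conv_l2 l2conv_dif Fv)
      show "(\<lambda>n. \<bar>t\<bar> * l2 lborel (pdiff (F i n) k)) \<longlonglongrightarrow> \<bar>t\<bar> * l2 lborel (g i k)"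
        by (intro tendsto_mult tendsto_const l2conv_l2 Fg)
    qed (use l2_dif_le[OF F(1)] in \<open>auto simp: h_def\<close>)
    define X where "X = sqrt (\<Sum>i\<in>UNIV. \<Sum>j\<in>UNIV. (l2 lborel (\<lambda>x. \<eta> x * dif h (g i j) x))\<^sup>2)"
    have X0: "X \<ge> 0" by (auto simp: X_def intro!: sum_nonneg)
    have X2: "X\<^sup>2 = (\<Sum>i\<in>UNIV. \<Sum>j\<in>UNIV. (l2 lborel (\<lambda>x. \<eta> x * dif h (g i j) x))\<^sup>2)"
      unfolding X_def by (rule real_sqrt_pow2) (auto intro!: sum_nonneg)
    have lX: "l2 lborel (\<lambda>x. \<eta> x * dif h (g i j) x) \<le> X" for i j
    proof (rule power2_le_imp_le[OF _ X0])
      have "(l2 lborel (\<lambda>x. \<eta> x * dif h (g i j) x))\<^sup>2 \<le>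
          (\<Sum>j\<in>UNIV. (l2 lborel (\<lambda>x. \<eta> x * dif h (g i j) x))\<^sup>2)"
        by (rule member_le_sum) auto
      also have "\<dots> \<le> X\<^sup>2" unfolding X2 by (rule member_le_sum) (auto intro!: sum_nonneg)
      finally show "(l2 lborel (\<lambda>x. \<eta> x * dif h (g i j) x))\<^sup>2 \<le> X\<^sup>2" .
    qed
    have s\<eta>g: "sqint lborel (\<lambda>x. \<eta> x * dif h (g i j) x)" for i j
      by (rule sqint_bounded_mult[OF sqint_dif[OF g(1)] _ B]) (simp add: m\<eta>)
    have "c * X\<^sup>2 = (\<integral>x. (\<eta> x)\<^sup>2 * (c * (\<Sum>i\<in>UNIV. \<Sum>j\<in>UNIV. (dif h (g i j) x)\<^sup>2)) \<partial>lborel)"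
    proof -
      have "c * X\<^sup>2 = c * (\<integral>x. (\<Sum>i\<in>UNIV. \<Sum>j\<in>UNIV. (\<eta> x * dif h (g i j) x)\<^sup>2) \<partial>lborel)"
        using s\<eta>g unfolding X2 l2_power2
        by (simp add: Bochner_Integration.integral_sum Bochner_Integration.integrable_sum sqint_def)
      also have "\<dots> = (\<integral>x. c * (\<Sum>i\<in>UNIV. \<Sum>j\<in>UNIV. (\<eta> x * dif h (g i j) x)\<^sup>2) \<partial>lborel)" by simp
      also have "\<dots> = (\<integral>x. (\<eta> x)\<^sup>2 * (c * (\<Sum>i\<in>UNIV. \<Sum>j\<in>UNIV. (dif h (g i j) x)\<^sup>2)) \<partial>lborel)"
        by (rule Bochner_Integration.integral_cong)
          (simp_all add: power_mult_distrib sum_distrib_left mult.left_commute)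
      finally show ?thesis .
    qed
    \<comment> \<open>Monotonicity at the points \<open>x + h\<close> and \<open>x\<close>. It
      concerns \<open>g\<close> and \<open>G\<close>, not the mollified gradients, and hence is used
      only after the limit.\<close>
    also have "\<dots> \<le> (\<integral>x. (\<Sum>i\<in>UNIV. \<Sum>j\<in>UNIV. ((\<eta> x)\<^sup>2 * dif h (G i j) x) * dif h (g i j) x) \<partial>lborel)"
    proof (rule integral_mono)
      have "integrable lborel (\<lambda>x. c * (\<Sum>i\<in>UNIV. \<Sum>j\<in>UNIV. (\<eta> x * dif h (g i j) x)\<^sup>2))"
        using s\<eta>g by (auto simp: sqint_def)
      then show "integrable lborel (\<lambda>x. (\<eta> x)\<^sup>2 * (c * (\<Sum>i\<in>UNIV. \<Sum>j\<in>UNIV. (dif h (g i j) x)\<^sup>2)))"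
        by (rule Bochner_Integration.integrable_cong[THEN iffD1, rotated -1])
          (simp_all add: power_mult_distrib sum_distrib_left mult.left_commute)
      show "integrable lborel (\<lambda>x. \<Sum>i\<in>UNIV. \<Sum>j\<in>UNIV. ((\<eta> x)\<^sup>2 * dif h (G i j) x) * dif h (g i j) x)"
        by (intro Bochner_Integration.integrable_sum sqint_mult_integrable sG sqint_dif g)
      show "(\<eta> x)\<^sup>2 * (c * (\<Sum>i\<in>UNIV. \<Sum>j\<in>UNIV. (dif h (g i j) x)\<^sup>2)) \<le>
          (\<Sum>i\<in>UNIV. \<Sum>j\<in>UNIV. ((\<eta> x)\<^sup>2 * dif h (G i j) x) * dif h (g i j) x)" for x
        using mult_left_mono[OF mono[of "x + h" x], of "(\<eta> x)\<^sup>2"]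
        by (simp add: dif_def sum_distrib_left mult.assoc)
    qed
    also have "\<dots> = (\<Sum>i\<in>UNIV. \<Sum>j\<in>UNIV. \<integral>x. ((\<eta> x)\<^sup>2 * dif h (G i j) x) * dif h (g i j) x \<partial>lborel)"
      using sqint_mult_integrable[OF sG sqint_dif[OF g(1)]]
      by (simp add: Bochner_Integration.integral_sum Bochner_Integration.integrable_sum)
    also note lim
    also have "(\<Sum>i\<in>UNIV. \<Sum>j\<in>UNIV. \<bar>t\<bar> * (l2 lborel (G i j) *
        (M * l2 lborel (dif h (v i)) + M * l2 lborel (\<lambda>x. \<eta> x * dif h (g i k) x)))) \<le>
      (\<Sum>i\<in>UNIV. \<Sum>j\<in>UNIV. \<bar>t\<bar> * (l2 lborel (G i j) * (M * (\<bar>t\<bar> * Q) + M * X)))"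
    proof (intro sum_mono mult_left_mono add_mono lX M0)
      fix i :: 2
      have "l2 lborel (g i k) \<le> (\<Sum>k\<in>UNIV. l2 lborel (g i k))" by (rule member_le_sum) auto
      also have "\<dots> \<le> Q" unfolding Q_def by (rule member_le_sum) (auto intro!: sum_nonneg)
      finally have "\<bar>t\<bar> * l2 lborel (g i k) \<le> \<bar>t\<bar> * Q" by (rule mult_left_mono) simp
      with dv[of i] show "l2 lborel (dif h (v i)) \<le> \<bar>t\<bar> * Q" by linarith
    qed auto
    also have "\<dots> = \<bar>t\<bar> * (N * (M * (\<bar>t\<bar> * Q) + M * X))"
      by (simp only: N_def sum_distrib_left sum_distrib_right)
    also have "\<dots> = \<bar>t\<bar> * (N * M * (\<bar>t\<bar> * Q + X))" by (simp add: algebra_simps)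
    finally have "c * X\<^sup>2 \<le> \<bar>t\<bar> * (N * M * (\<bar>t\<bar> * Q + X))" .
    then have "X \<le> \<bar>t\<bar> * (N * M / c + Q)"
      by (intro quadratic_absorption c mult_nonneg_nonneg N0 M0 Q0 X0) auto
    with lX[of i0 j0] show ?thesis unfolding h_def by linarith
  qed
  from that[OF r(1) bound] show thesis .
qed

subsection \<open>Weak derivatives\<close>

text \<open>Pairing \<open>\<phi>\<close> with the translate of \<open>\<psi>\<close> by
  \<open>s\<close> equals pairing \<open>\<psi>\<close> with the translate of \<open>\<phi>\<close>
  by \<open>- s\<close>. Differentiating this identity at \<open>s = 0\<close> gives the
  formula.\<close>

lemma test_fun_integration_by_parts:
  assumes \<phi>: "test_fun UNIV \<phi>" and \<psi>: "test_fun UNIV \<psi>"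
  shows "(\<integral>x. \<phi> x * pdiff \<psi> j x \<partial>lborel) = - (\<integral>x. pdiff \<phi> j x * \<psi> x \<partial>lborel)"
proof -
  have d1: "((\<lambda>s. \<integral>x. \<phi> x * \<psi> (x + s *\<^sub>R axis j 1) \<partial>lborel) has_real_derivative
      (\<integral>x. \<phi> x * pdiff \<psi> j x \<partial>lborel)) (at 0)"
    using kint_line_derivative[OF test_fun_integrable[OF \<phi>] \<psi>, of j 0] by simp
  have "((\<lambda>s. \<integral>x. \<psi> x * \<phi> (x + (- s) *\<^sub>R axis j 1) \<partial>lborel) has_real_derivative
      (\<integral>x. \<psi> x * pdiff \<phi> j x \<partial>lborel) * (- 1)) (at 0)"
    by (rule DERIV_chain2[where f="\<lambda>s. \<integral>x. \<psi> x * \<phi> (x + s *\<^sub>R axis j 1) \<partial>lborel"])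
      (use kint_line_derivative[OF test_fun_integrable[OF \<psi>] \<phi>, of j 0] in
        \<open>auto intro!: derivative_eq_intros\<close>)
  moreover have "(\<integral>x. \<psi> x * \<phi> (x + (- s) *\<^sub>R axis j 1) \<partial>lborel) =
      (\<integral>x. \<phi> x * \<psi> (x + s *\<^sub>R axis j 1) \<partial>lborel)" for s
  proof -
    note [measurable] = test_fun_measurable[OF \<phi>] test_fun_measurable[OF \<psi>]
    have "(\<integral>x. \<psi> (x + s *\<^sub>R axis j 1) * \<phi> (x + s *\<^sub>R axis j 1 + (- s) *\<^sub>R axis j 1) \<partial>lborel) =
        (\<integral>x. \<psi> x * \<phi> (x + (- s) *\<^sub>R axis j 1) \<partial>lborel)"
      by (rule integral_lborel_shift[of "\<lambda>x. \<psi> x * \<phi> (x + (- s) *\<^sub>R axis j 1)"]) measurable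
    then show ?thesis by (simp add: mult.commute)
  qed
  ultimately have "((\<lambda>s. \<integral>x. \<phi> x * \<psi> (x + s *\<^sub>R axis j 1) \<partial>lborel) has_real_derivative
      - (\<integral>x. \<psi> x * pdiff \<phi> j x \<partial>lborel)) (at 0)" by simp
  from DERIV_unique[OF d1 this] show ?thesis by (simp add: mult.commute)
qed

lemma set_integral_mult_test_fun:
  assumes "test_fun \<Omega> \<phi>"
  shows "(LINT x:\<Omega>|lborel. f x * \<phi> x) = (\<integral>x. f x * \<phi> x \<partial>lborel)"
proof -
  have "(\<lambda>x. indicator \<Omega> x *\<^sub>R (f x * \<phi> x)) = (\<lambda>x. f x * \<phi> x)"
    using test_fun_outside[OF assms] by (auto simp: indicator_def fun_eq_iff)
  then show ?thesis by (simp only: set_lebesgue_integral_def)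
qed

lemma loc_integrable_mult_test_fun:
  assumes "loc_integrable \<Omega> g" "test_fun \<Omega> \<phi>"
  shows "integrable lborel (\<lambda>x. g x * \<phi> x)"
proof -
  obtain S where S: "compact S" "S \<subseteq> \<Omega>" "\<And>x. x \<notin> S \<Longrightarrow> \<phi> x = 0"
    using assms(2) by (auto simp: test_fun_iff)
  obtain M where M: "\<And>x. \<bar>\<phi> x\<bar> \<le> M" using test_fun_bounded[OF assms(2)] by metis
  have "integrable lborel (\<lambda>x. (indicator S x *\<^sub>R g x) * \<phi> x)"
    using assms(1) S test_fun_measurable[OF assms(2)]
    by (intro integrable_mult_bounded[OF _ _ M]) (auto simp: loc_integrable_def set_integrable_def)
  moreover have "(\<lambda>x. (indicator S x *\<^sub>R g x) * \<phi> x) = (\<lambda>x. g x * \<phi> x)"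
    using S(3) by (auto simp: indicator_def fun_eq_iff)
  ultimately show ?thesis by simp
qed

lemma L2_on_iff_sqint: "L2_on \<Omega> f \<longleftrightarrow> sqint lborel (\<lambda>x. indicator \<Omega> x * f x)"
proof -
  have "(\<lambda>x. (indicator \<Omega> x * f x)\<^sup>2) = (\<lambda>x. indicator \<Omega> x * (f x)\<^sup>2)"
    by (auto simp: indicator_def fun_eq_iff)
  then show ?thesis by (simp add: L2_on_def sqint_def set_borel_measurable_def set_integrable_def)
qed

lemma sqint_compact_support_integrable:
  fixes f :: "vec2 \<Rightarrow> real"
  assumes f: "sqint lborel f" and S: "compact S" "\<And>x. x \<notin> S \<Longrightarrow> f x = 0"
  shows "integrable lborel f"
proof (rule Bochner_Integration.integrable_bound)
  have "S \<in> sets lborel" using S by (simp add: borel_closed compact_imp_closed)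
  then show "integrable lborel (\<lambda>x. indicator S x + (f x)\<^sup>2)"
    using f emeasure_compact_finite[OF S(1)] by (simp add: sqint_def integrable_indicator_iff)
  have "\<bar>f x\<bar> \<le> indicator S x + (f x)\<^sup>2" for x
  proof (cases "x \<in> S")
    case True
    have "0 \<le> (\<bar>f x\<bar> - 1)\<^sup>2" by simp
    then have "2 * \<bar>f x\<bar> \<le> 1 + (f x)\<^sup>2" by (simp add: power2_diff)
    with True show ?thesis by simp
  qed (simp add: S(2))
  then show "AE x in lborel. norm (f x) \<le> norm (indicator S x + (f x)\<^sup>2)"
    by (auto intro: order_trans)
qed (use f in \<open>simp add: sqint_def\<close>)

lemma sqint_loc_integrable:
  assumes "sqint lborel f"
  shows "loc_integrable \<Omega> f"
  unfolding loc_integrable_def set_integrable_def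
proof (intro allI impI)
  fix K assume K: "compact K \<and> K \<subseteq> \<Omega>"
  then have [measurable]: "K \<in> sets borel" by (simp add: borel_closed compact_imp_closed)
  have "sqint lborel (\<lambda>x. indicator K x * f x)"
    by (rule sqint_bounded_mult[OF assms, of _ 1]) (auto simp: indicator_def)
  then have "integrable lborel (\<lambda>x. indicator K x * f x)"
    using K by (intro sqint_compact_support_integrable[of _ K]) auto
  then show "integrable lborel (\<lambda>x. indicator K x *\<^sub>R f x)" by simp
qed

lemma loc_integrable_cong:
  assumes "\<And>x. x \<in> \<Omega> \<Longrightarrow> f x = g x"
  shows "loc_integrable \<Omega> f \<longleftrightarrow> loc_integrable \<Omega> g"
proof -
  have "set_integrable lborel K f \<longleftrightarrow> set_integrable lborel K g" if "K \<subseteq> \<Omega>" for K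
    using that assms by (intro set_integrable_cong) auto
  then show ?thesis unfolding loc_integrable_def by blast
qed

lemma sqint_indicator:
  fixes f :: "vec2 \<Rightarrow> real"
  assumes "sqint lborel f" "open V"
  shows "sqint lborel (\<lambda>x. indicator V x * f x)"
proof (rule sqint_bounded_mult[OF assms(1)])
  show "indicator V \<in> borel_measurable lborel" using assms(2) by simp
  show "\<bar>indicator V x :: real\<bar> \<le> 1" for x by (simp add: indicator_def)
qed

lemma L2_on_subset:
  assumes "L2_on \<Omega> f" "open V" "V \<subseteq> \<Omega>"
  shows "L2_on V f"
proof -
  have "sqint lborel (\<lambda>x. indicator V x * (indicator \<Omega> x * f x))"
    using assms by (intro sqint_indicator[of "\<lambda>x. indicator \<Omega> x * f x" V]) (simp_all add: L2_on_iff_sqint)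
  moreover have "(\<lambda>x. indicator V x * (indicator \<Omega> x * f x)) = (\<lambda>x. indicator V x * f x)"
    using assms(3) by (auto simp: indicator_def fun_eq_iff)
  ultimately show ?thesis by (simp only: L2_on_iff_sqint)
qed

lemma loc_integrable_subset: "loc_integrable \<Omega> f \<Longrightarrow> V \<subseteq> \<Omega> \<Longrightarrow> loc_integrable V f"
  unfolding loc_integrable_def by blast

lemma weak_partial_subset:
  assumes "weak_partial \<Omega> f j g" "V \<subseteq> \<Omega>"
  shows "weak_partial V f j g"
  unfolding weak_partial_def
proof (intro conjI allI impI)
  fix \<phi> assume \<phi>: "test_fun V \<phi>"
  then have \<phi>': "test_fun \<Omega> \<phi>" using assms(2) by (rule test_fun_mono)
  with assms(1) have "(LINT x:\<Omega>|lborel. f x * pdiff \<phi> j x) = - (LINT x:\<Omega>|lborel. g x * \<phi> x)"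
    by (simp add: weak_partial_def)
  then show "(LINT x:V|lborel. f x * pdiff \<phi> j x) = - (LINT x:V|lborel. g x * \<phi> x)"
    by (simp add: set_integral_mult_test_fun \<phi> \<phi>' test_fun_pdiff)
qed (use assms loc_integrable_subset in \<open>auto simp: weak_partial_def\<close>)

lemma weak_partial_unique:
  assumes "open \<Omega>" "weak_partial \<Omega> f j g" "weak_partial \<Omega> f j g'"
  shows "AE x in lborel. x \<in> \<Omega> \<longrightarrow> g x = g' x"
proof -
  have l: "loc_integrable \<Omega> g" "loc_integrable \<Omega> g'" using assms by (auto simp: weak_partial_def)
  have "AE x in lborel. x \<in> \<Omega> \<longrightarrow> g x - g' x = 0"
  proof (rule locally_AE_zero[OF assms(1)])
    show "loc_integrable \<Omega> (\<lambda>x. g x - g' x)"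
      using l unfolding loc_integrable_def by (blast intro: set_integral_diff(1))
    fix \<phi> assume \<phi>: "test_fun \<Omega> \<phi>"
    have "(\<integral>x. g x * \<phi> x - g' x * \<phi> x \<partial>lborel) = (\<integral>x. g x * \<phi> x \<partial>lborel) - (\<integral>x. g' x * \<phi> x \<partial>lborel)"
      by (intro Bochner_Integration.integral_diff loc_integrable_mult_test_fun[OF _ \<phi>] l)
    also have "\<dots> = 0"
      using assms \<phi> by (simp add: weak_partial_def set_integral_mult_test_fun)
    finally show "(LINT x:\<Omega>|lborel. (g x - g' x) * \<phi> x) = 0"
      by (subst set_integral_mult_test_fun[OF \<phi>]) (simp only: left_diff_distrib)
  qed
  then show ?thesis by simp
qed

lemma test_fun_weak_partial:
  assumes \<phi>: "test_fun \<Omega> \<phi>"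
  shows "weak_partial \<Omega> \<phi> j (pdiff \<phi> j)"
  unfolding weak_partial_def
proof (intro conjI allI impI)
  show "loc_integrable \<Omega> \<phi>" "loc_integrable \<Omega> (pdiff \<phi> j)"
    by (intro sqint_loc_integrable test_fun_sqint[OF \<phi>] test_fun_sqint[OF test_fun_pdiff[OF \<phi>]])+
  fix \<psi> assume \<psi>: "test_fun \<Omega> \<psi>"
  show "(LINT x:\<Omega>|lborel. \<phi> x * pdiff \<psi> j x) = - (LINT x:\<Omega>|lborel. pdiff \<phi> j x * \<psi> x)"
    unfolding set_integral_mult_test_fun[OF \<psi>] set_integral_mult_test_fun[OF test_fun_pdiff[OF \<psi>]]
    by (intro test_fun_integration_by_parts test_fun_mono[OF \<phi>] test_fun_mono[OF \<psi>]) auto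
qed

lemma test_fun_L2_on:
  assumes "open \<Omega>" "test_fun \<Omega> \<phi>"
  shows "L2_on \<Omega> \<phi>"
  unfolding L2_on_iff_sqint by (rule sqint_indicator[OF test_fun_sqint[OF assms(2)] assms(1)])

lemma wgrad_weak_grad:
  assumes "W12 \<Omega> u"
  shows "weak_partial \<Omega> (\<lambda>x. u x $ i) j (\<lambda>x. wgrad \<Omega> u x $ i $ j)"
proof -
  have "\<forall>i j. \<exists>g. weak_partial \<Omega> (\<lambda>x. u x $ i) j g"
    using assms by (auto simp: W12_def W12s_def)
  then obtain g where g: "\<And>i j. weak_partial \<Omega> (\<lambda>x. u x $ i) j (g i j)" by metis
  have "weak_grad \<Omega> u (\<lambda>x. \<chi> i j. g i j x)" using g by (simp add: weak_grad_def)
  then have "weak_grad \<Omega> u (wgrad \<Omega> u)" unfolding wgrad_def by (rule someI[of "weak_grad \<Omega> u"])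
  then show ?thesis by (simp add: weak_grad_def)
qed

text \<open>\<open>W12\<close> asserts that some weak derivative is square integrable, whereas
  \<open>wgrad\<close> is selected by \<open>SOME\<close>; uniqueness almost everywhere transfers
  the property. Borel measurability has to come separately, from local integrability, because
  equality almost everywhere does not preserve it.\<close>

lemma wgrad_L2_on:
  assumes "open \<Omega>" "W12 \<Omega> u"
  shows "L2_on \<Omega> (\<lambda>x. wgrad \<Omega> u x $ i $ j)"
proof -
  obtain g where g: "weak_partial \<Omega> (\<lambda>x. u x $ i) j g" "L2_on \<Omega> g"
    using assms(2) unfolding W12_def W12s_def by blast
  let ?d = "\<lambda>x. indicator \<Omega> x * wgrad \<Omega> u x $ i $ j"
  have ae: "AE x in lborel. x \<in> \<Omega> \<longrightarrow> wgrad \<Omega> u x $ i $ j = g x"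
    by (rule weak_partial_unique[OF assms(1) wgrad_weak_grad[OF assms(2)] g(1)])
  have [measurable]: "?d \<in> borel_measurable borel"
    using wgrad_weak_grad[OF assms(2), of i j]
    by (intro loc_integrable_measurable[OF assms(1)]) (simp add: weak_partial_def)
  have s: "sqint lborel (\<lambda>x. indicator \<Omega> x * g x)" using g(2) by (simp add: L2_on_iff_sqint)
  then have [measurable]: "(\<lambda>x. indicator \<Omega> x * g x) \<in> borel_measurable borel" by (simp add: sqint_def)
  have "integrable lborel (\<lambda>x. (?d x)\<^sup>2) \<longleftrightarrow> integrable lborel (\<lambda>x. (indicator \<Omega> x * g x)\<^sup>2)"
  proof (rule integrable_cong_AE)
    show "AE x in lborel. (?d x)\<^sup>2 = (indicator \<Omega> x * g x)\<^sup>2"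
      using ae by eventually_elim (simp add: indicator_def)
  qed measurable
  with s have "sqint lborel ?d" by (simp add: sqint_def)
  then show ?thesis by (simp add: L2_on_iff_sqint)
qed

lemma test_vec_W12:
  assumes "open \<Omega>" "test_vec \<Omega> \<psi>"
  shows "W12 \<Omega> \<psi>"
  unfolding W12_def W12s_def
proof (intro allI conjI)
  fix i j
  have t: "test_fun \<Omega> (\<lambda>x. \<psi> x $ i)" using assms(2) by (simp add: test_vec_def)
  show "L2_on \<Omega> (\<lambda>x. \<psi> x $ i)" by (rule test_fun_L2_on[OF assms(1) t])
  show "\<exists>g. weak_partial \<Omega> (\<lambda>x. \<psi> x $ i) j g \<and> L2_on \<Omega> g"
    using test_fun_weak_partial[OF t] test_fun_L2_on[OF assms(1) test_fun_pdiff[OF t]] by blast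
qed

lemma test_vec_W012:
  assumes "open \<Omega>" "test_vec \<Omega> \<psi>"
  shows "W012 \<Omega> \<psi>"
  unfolding W012_def
proof (intro conjI exI[of _ "\<lambda>n. \<psi>"])
  show "(\<lambda>n. W12_dist2 \<Omega> \<psi> \<psi>) \<longlonglongrightarrow> 0"
    by (simp add: W12_dist2_def)
qed (use assms test_vec_W12 in auto)

section \<open>The nonlinear map and the tested equation\<close>

text \<open>Since \<open>cof2\<close> is the gradient of the determinant, this is the gradient of
  |A|^2/2 + \<rho>(det A) when \<open>\<sigma>\<close> is the derivative of
  \<open>\<rho>\<close>.\<close>

definition stress :: "(real \<Rightarrow> real) \<Rightarrow> mat2 \<Rightarrow> mat2" where
  "stress \<sigma> A = A + \<sigma> (det A) *\<^sub>R cof2 A"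

lemma stress_0: "stress \<sigma> 0 = 0"
  by (simp add: stress_def cof2_def vec_eq_iff)

text \<open>With \<open>a = \<sigma> (det A)\<close> and \<open>b = \<sigma> (det B)\<close>, the contribution of the cofactor terms is
  \<open>(a - b) (det A - det B) + (a + b) det (A - B)\<close>; the first summand is nonnegative
  and \<open>2 \<bar>det M\<bar> \<le> |M|\<^sup>2\<close>.\<close>

lemma stress_strongly_monotone:
  assumes mono: "mono \<sigma>" and \<sigma>: "\<And>s. 0 \<le> \<sigma> s" "\<And>s. \<sigma> s \<le> \<gamma>"
  shows "(1 - \<gamma>) * (\<Sum>i\<in>UNIV. \<Sum>j\<in>UNIV. (A $ i $ j - B $ i $ j)\<^sup>2) \<le>
    (\<Sum>i\<in>UNIV. \<Sum>j\<in>UNIV. (stress \<sigma> A $ i $ j - stress \<sigma> B $ i $ j) * (A $ i $ j - B $ i $ j))"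
proof -
  define a b where "a = \<sigma> (det A)" and "b = \<sigma> (det B)"
  have sA: "stress \<sigma> A $ i $ j = A $ i $ j + a * cof2 A $ i $ j"
    and sB: "stress \<sigma> B $ i $ j = B $ i $ j + b * cof2 B $ i $ j" for i j
    by (simp_all add: stress_def a_def b_def)
  define n where "n = (\<Sum>i\<in>UNIV. \<Sum>j\<in>UNIV. (A $ i $ j - B $ i $ j)\<^sup>2)"
  have "(\<Sum>i\<in>UNIV. \<Sum>j\<in>UNIV. (stress \<sigma> A $ i $ j - stress \<sigma> B $ i $ j) * (A $ i $ j - B $ i $ j)) =
      n + (a - b) * (det A - det B) + (a + b) * det (A - B)"
    unfolding sA sB by (simp add: n_def sum_2 cof2_def det_2 power2_eq_square algebra_simps)
  moreover have "0 \<le> (a - b) * (det A - det B)"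
    using monoD[OF mono, of "det A" "det B"] monoD[OF mono, of "det B" "det A"]
    by (cases "det A \<le> det B") (auto simp: a_def b_def zero_le_mult_iff)
  moreover have "- (\<gamma> * n) \<le> (a + b) * det (A - B)"
  proof -
    have "2 * \<bar>x * w - y * z\<bar> \<le> x\<^sup>2 + y\<^sup>2 + (z\<^sup>2 + w\<^sup>2)" for x y z w :: real
    proof -
      \<comment> \<open>For the matrix M with rows (x, y) and (z, w) these sums of squares are |M|^2
        - 2 det M and |M|^2 + 2 det M.\<close>
      have "0 \<le> (x - w)\<^sup>2 + (y + z)\<^sup>2" "0 \<le> (x + w)\<^sup>2 + (y - z)\<^sup>2" by simp_all
      then have "2 * (x * w - y * z) \<le> x\<^sup>2 + y\<^sup>2 + (z\<^sup>2 + w\<^sup>2)" "- (2 * (x * w - y * z)) \<le> x\<^sup>2 + y\<^sup>2 + (z\<^sup>2 + w\<^sup>2)"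
        by (simp_all add: power2_diff power2_sum algebra_simps)
      then show ?thesis by linarith
    qed
    from this[of "(A - B) $ 1 $ 1" "(A - B) $ 2 $ 2" "(A - B) $ 1 $ 2" "(A - B) $ 2 $ 1"]
    have d: "2 * \<bar>det (A - B)\<bar> \<le> n" by (simp add: det_2 n_def sum_2)
    have ab: "0 \<le> a + b" "a + b \<le> 2 * \<gamma>" using \<sigma>[of "det A"] \<sigma>[of "det B"] by (auto simp: a_def b_def)
    have "(a + b) * \<bar>det (A - B)\<bar> \<le> 2 * \<gamma> * \<bar>det (A - B)\<bar>" using ab by (intro mult_right_mono) auto
    also have "\<dots> \<le> \<gamma> * n" using mult_left_mono[OF d, of \<gamma>] ab by simp
    finally have le: "(a + b) * \<bar>det (A - B)\<bar> \<le> \<gamma> * n" .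
    have "(a + b) * (- det (A - B)) \<le> (a + b) * \<bar>det (A - B)\<bar>"
      using ab(1) by (intro mult_left_mono) auto
    with le show ?thesis by simp
  qed
  ultimately show ?thesis by (simp add: n_def[symmetric] left_diff_distrib)
qed

lemma stress_component:
  "stress \<sigma> A $ i $ j = A $ i $ j + \<sigma> (det A) * cof2 A $ i $ j"
  by (simp add: stress_def)

text \<open>In two dimensions the entries of \<open>cof2 A\<close> are those of \<open>A\<close> up
  to sign and order, so a bounded \<open>\<sigma>\<close> yields linear growth.\<close>

lemma sqint_stress:
  fixes A :: "vec2 \<Rightarrow> mat2"
  assumes A: "\<And>i j. sqint lborel (\<lambda>x. A x $ i $ j)" and \<sigma>: "\<sigma> \<in> borel_measurable borel"
    "\<And>s. \<bar>\<sigma> s\<bar> \<le> \<gamma>"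
  shows "sqint lborel (\<lambda>x. stress \<sigma> (A x) $ i $ j)"
  unfolding stress_component
proof (rule sqint_add[OF A])
  have [measurable]: "(\<lambda>x. A x $ i $ j) \<in> borel_measurable borel" for i j
    using A[of i j] by (simp add: sqint_def)
  have "(\<lambda>x. det (A x)) \<in> borel_measurable borel" unfolding det_2 by measurable
  then have m: "(\<lambda>x. \<sigma> (det (A x))) \<in> borel_measurable lborel"
    using measurable_compose[OF _ \<sigma>(1)] by simp
  have "sqint lborel (\<lambda>x. cof2 (A x) $ i $ j)"
    using A[of 1 1] A[of 1 2] A[of 2 1] A[of 2 2] sqint_cmult[OF A[of 2 1], of "-1"] sqint_cmult[OF A[of 1 2], of "-1"]
    using exhaust_2[of i] exhaust_2[of j] by (auto simp: cof2_def)
  then show "sqint lborel (\<lambda>x. \<sigma> (det (A x)) * cof2 (A x) $ i $ j)"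
    by (rule sqint_bounded_mult[OF _ m \<sigma>(2)])
qed

text \<open>Stationarity speaks of \<open>wgrad\<close> of the test function, which agrees with the
  classical partial derivatives only almost everywhere in \<Omega>; the set integral is rewritten
  over the plane by means of the indicator.\<close>

lemma stationary_test_equation:
  assumes "open \<Omega>" "stationary \<Omega> \<rho> u0 u" and \<sigma>: "deriv \<rho> \<in> borel_measurable borel"
    "\<And>s. \<bar>deriv \<rho> s\<bar> \<le> \<gamma>" and \<phi>: "\<And>i. test_fun \<Omega> (\<phi> i)"
  shows "(\<Sum>i\<in>UNIV. \<Sum>j\<in>UNIV. \<integral>x. (indicator \<Omega> x * stress (deriv \<rho>) (wgrad \<Omega> u x) $ i $ j) *
      pdiff (\<phi> i) j x \<partial>lborel) = 0"
proof -
  define \<psi> where "\<psi> x = (\<chi> i. \<phi> i x)" for x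
  have t: "test_vec \<Omega> \<psi>" using \<phi> by (simp add: test_vec_def \<psi>_def)
  have W: "W12 \<Omega> u" using assms(2) by (simp add: stationary_def admissible_def)
  note W\<psi> = test_vec_W12[OF assms(1) t]
  let ?P = "\<lambda>x. stress (deriv \<rho>) (wgrad \<Omega> u x)" and ?D = "wgrad \<Omega> \<psi>"
  have z: "(LINT x:\<Omega>|lborel. ?P x \<bullet> ?D x) = 0"
    using assms(2) test_vec_W012[OF assms(1) t] by (simp add: stationary_def stress_def)
  \<comment> \<open>Extension of the gradient by zero. As \<open>stress\<close> maps 0 to 0, it
    commutes with this extension, and \<open>sqint_stress\<close> applies on the whole
    plane.\<close>
  define A where "A x = (\<chi> i j. indicator \<Omega> x * wgrad \<Omega> u x $ i $ j)" for x
  have sA: "sqint lborel (\<lambda>x. A x $ i $ j)" for i j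
    using wgrad_L2_on[OF assms(1) W, of i j] by (simp add: A_def L2_on_iff_sqint)
  have AP: "stress (deriv \<rho>) (A x) $ i $ j = indicator \<Omega> x * ?P x $ i $ j" for x i j
  proof -
    have "A x = (if x \<in> \<Omega> then wgrad \<Omega> u x else 0)" by (simp add: A_def vec_eq_iff)
    then show ?thesis by (simp add: stress_0)
  qed
  have sP: "sqint lborel (\<lambda>x. indicator \<Omega> x * ?P x $ i $ j)" for i j
    using sqint_stress[OF sA \<sigma>, of i j] by (simp add: AP)
  have sD: "sqint lborel (\<lambda>x. indicator \<Omega> x * ?D x $ i $ j)" for i j
    using wgrad_L2_on[OF assms(1) W\<psi>, of i j] by (simp add: L2_on_iff_sqint)
  have ae: "AE x in lborel. x \<in> \<Omega> \<longrightarrow> ?D x $ i $ j = pdiff (\<phi> i) j x" for i j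
    using weak_partial_unique[OF assms(1) wgrad_weak_grad[OF W\<psi>] test_fun_weak_partial]
      \<phi>[of i] by (simp add: \<psi>_def)
  have "AE x in lborel. \<forall>i j. x \<in> \<Omega> \<longrightarrow> ?D x $ i $ j = pdiff (\<phi> i) j x"
    unfolding AE_all_countable using ae by blast
  then have "AE x in lborel. (\<Sum>i\<in>UNIV. \<Sum>j\<in>UNIV. (indicator \<Omega> x * ?P x $ i $ j) * (indicator \<Omega> x * ?D x $ i $ j)) =
      (\<Sum>i\<in>UNIV. \<Sum>j\<in>UNIV. (indicator \<Omega> x * ?P x $ i $ j) * pdiff (\<phi> i) j x)"
    by eventually_elim (auto simp: indicator_def)
  then have eq: "(\<integral>x. (\<Sum>i\<in>UNIV. \<Sum>j\<in>UNIV. (indicator \<Omega> x * ?P x $ i $ j) * (indicator \<Omega> x * ?D x $ i $ j)) \<partial>lborel) =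
      (\<integral>x. (\<Sum>i\<in>UNIV. \<Sum>j\<in>UNIV. (indicator \<Omega> x * ?P x $ i $ j) * pdiff (\<phi> i) j x) \<partial>lborel)"
    by (rule integral_cong_AE[rotated 2])
      (intro borel_measurable_sum borel_measurable_times sqint_measurable sP sD
        test_fun_sqint[OF test_fun_pdiff[OF \<phi>]])+
  have "(\<Sum>i\<in>UNIV. \<Sum>j\<in>UNIV. (indicator \<Omega> x * ?P x $ i $ j) * (indicator \<Omega> x * ?D x $ i $ j)) =
      indicator \<Omega> x *\<^sub>R (?P x \<bullet> ?D x)" for x
    by (simp add: inner_vec_def indicator_def)
  with eq z have "(\<integral>x. (\<Sum>i\<in>UNIV. \<Sum>j\<in>UNIV. (indicator \<Omega> x * ?P x $ i $ j) * pdiff (\<phi> i) j x) \<partial>lborel) = 0"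
    by (simp only: set_lebesgue_integral_def)
  moreover have "integrable lborel (\<lambda>x. (indicator \<Omega> x * ?P x $ i $ j) * pdiff (\<phi> i) j x)" for i j
    by (rule sqint_mult_integrable[OF sP test_fun_sqint[OF test_fun_pdiff[OF \<phi>]]])
  ultimately show ?thesis
    by (simp add: Bochner_Integration.integral_sum Bochner_Integration.integrable_sum)
qed

lemma deriv_abs_le:
  fixes q :: "real \<Rightarrow> real"
  assumes "(q has_real_derivative d) (at 0)" "r > 0" "\<And>s. \<bar>s\<bar> < r \<Longrightarrow> \<bar>q s - q 0\<bar> \<le> \<bar>s\<bar> * B"
  shows "\<bar>d\<bar> \<le> B"
proof -
  have "((\<lambda>s. \<bar>(q s - q 0) / (s - 0)\<bar>) \<longlongrightarrow> \<bar>d\<bar>) (at 0)"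
    using assms(1) unfolding has_field_derivative_iff by (rule tendsto_rabs)
  moreover have "\<forall>\<^sub>F s in at 0. \<bar>(q s - q 0) / (s - 0)\<bar> \<le> B"
    unfolding eventually_at using assms(2,3)
    by (intro exI[of _ r]) (auto simp: abs_divide divide_le_eq mult.commute dist_real_def)
  ultimately show ?thesis by (rule tendsto_upperbound) simp
qed

text \<open>The functional \<open>T\<close> is, up to sign, the derivative at 0 of pairing
  \<open>f\<close> with translates of \<open>\<phi>\<close>. Moving the increment onto
  \<open>f\<close> bounds it by \<open>Y * l2 lborel \<phi>\<close>; inserting \<open>\<eta>\<close>
  is harmless because \<open>\<eta>\<close> is 1 where \<open>\<phi>\<close> lives. The Riesz
  representative of \<open>T\<close> is the weak derivative.\<close>

lemma weak_partial_of_difference_bound: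
  fixes f :: "vec2 \<Rightarrow> real"
  assumes "open V" and f: "sqint lborel f" "integrable lborel f" and \<eta>: "\<And>x. x \<in> V \<Longrightarrow> \<eta> x = 1"
    and s\<eta>: "\<And>t. sqint lborel (\<lambda>x. \<eta> x * dif (t *\<^sub>R axis k 1) f x)"
    and r: "r > 0" "\<And>t. \<bar>t\<bar> < r \<Longrightarrow> l2 lborel (\<lambda>x. \<eta> x * dif (t *\<^sub>R axis k 1) f x) \<le> \<bar>t\<bar> * Y"
  obtains h where "weak_partial V f k h" "L2_on V h"
proof -
  define T where "T \<phi> = - (\<integral>x. f x * pdiff \<phi> k x \<partial>lborel)" for \<phi>
  have U: "test_fun UNIV \<phi>" if "test_fun V \<phi>" for \<phi> using that by (rule test_fun_mono) simp
  obtain h where h: "sqint lborel h" "\<And>\<phi>. \<phi> \<in> Collect (test_fun V) \<Longrightarrow> T \<phi> = (\<integral>x. h x * \<phi> x \<partial>lborel)"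
  proof (rule L2_Riesz[of "Collect (test_fun V)" lborel T Y])
    show "(\<lambda>x. 0) \<in> Collect (test_fun V)"
      by (auto intro: test_funI[of _ "{}"] smooth2_const)
    fix \<phi> assume "\<phi> \<in> Collect (test_fun V)"
    then have \<phi>: "test_fun V \<phi>" by simp
    show "sqint lborel \<phi>" by (rule test_fun_sqint[OF \<phi>])
    have "\<bar>\<integral>x. f x * pdiff \<phi> k x \<partial>lborel\<bar> \<le> Y * l2 lborel \<phi>"
    proof (rule deriv_abs_le[OF _ r(1)])
      show "((\<lambda>s. \<integral>x. f x * \<phi> (x + s *\<^sub>R axis k 1) \<partial>lborel) has_real_derivative
          (\<integral>x. f x * pdiff \<phi> k x \<partial>lborel)) (at 0)"
        using kint_line_derivative[OF f(2) U[OF \<phi>], of k 0] by simp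
      fix s :: real assume s: "\<bar>s\<bar> < r"
      note s\<phi> = test_fun_sqint[OF \<phi>]
      \<comment> \<open>Translating \<open>\<phi>\<close> by \<open>s\<close> corresponds to
        differencing \<open>f\<close> with step \<open>- s\<close>; the double negation matches the
        form of \<open>integral_dif_mult\<close>.\<close>
      have "(\<integral>x. f x * \<phi> (x + s *\<^sub>R axis k 1) \<partial>lborel) - (\<integral>x. f x * \<phi> (x + 0 *\<^sub>R axis k 1) \<partial>lborel) =
          (\<integral>x. f x * dif (- ((- s) *\<^sub>R axis k 1)) \<phi> x \<partial>lborel)"
        unfolding dif_def right_diff_distrib
        using sqint_mult_integrable[OF f(1) sqint_shift[OF s\<phi>, of "s *\<^sub>R axis k 1"]] sqint_mult_integrable[OF f(1) s\<phi>]
        by (subst Bochner_Integration.integral_diff) auto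
      also have "\<dots> = (\<integral>x. dif ((- s) *\<^sub>R axis k 1) f x * \<phi> x \<partial>lborel)"
        by (rule integral_dif_mult[OF f(1) s\<phi>, symmetric])
      also have "\<dots> = (\<integral>x. (\<eta> x * dif ((- s) *\<^sub>R axis k 1) f x) * \<phi> x \<partial>lborel)"
      proof (rule Bochner_Integration.integral_cong[OF refl])
        show "dif ((- s) *\<^sub>R axis k 1) f x * \<phi> x = (\<eta> x * dif ((- s) *\<^sub>R axis k 1) f x) * \<phi> x" for x
          using \<eta>[of x] test_fun_outside[OF \<phi>, of x] by (cases "x \<in> V") auto
      qed
      also have "\<bar>\<dots>\<bar> \<le> l2 lborel (\<lambda>x. \<eta> x * dif ((- s) *\<^sub>R axis k 1) f x) * l2 lborel \<phi>"
        by (rule l2_Cauchy_Schwarz[OF s\<eta> s\<phi>])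
      also have "\<dots> \<le> (\<bar>- s\<bar> * Y) * l2 lborel \<phi>"
        by (rule mult_right_mono[OF r(2)]) (use s in auto)
      finally show "\<bar>(\<integral>x. f x * \<phi> (x + s *\<^sub>R axis k 1) \<partial>lborel) -
          (\<integral>x. f x * \<phi> (x + 0 *\<^sub>R axis k 1) \<partial>lborel)\<bar> \<le> \<bar>s\<bar> * (Y * l2 lborel \<phi>)" by simp
    qed
    then show "\<bar>T \<phi>\<bar> \<le> Y * l2 lborel \<phi>" by (simp add: T_def)
  next
    fix \<phi> \<psi> :: "vec2 \<Rightarrow> real" and t :: real
    assume "\<phi> \<in> Collect (test_fun V)" "\<psi> \<in> Collect (test_fun V)"
    then have \<phi>: "test_fun V \<phi>" and \<psi>: "test_fun V \<psi>" by auto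
    show "(\<lambda>x. \<phi> x + t * \<psi> x) \<in> Collect (test_fun V)"
      using test_fun_add[OF \<phi> test_fun_cmult[OF \<psi>]] by simp
    have "pdiff (\<lambda>x. \<phi> x + t * \<psi> x) k = (\<lambda>x. pdiff \<phi> k x + t * pdiff \<psi> k x)"
      by (simp add: pdiff_smooth2_add pdiff_smooth2_mult smooth2_mult smooth2_const test_fun_smooth2[OF \<phi>] test_fun_smooth2[OF \<psi>])
    then show "T (\<lambda>x. \<phi> x + t * \<psi> x) = T \<phi> + t * T \<psi>"
      using sqint_mult_integrable[OF f(1) test_fun_sqint[OF test_fun_pdiff[OF \<phi>], of k]]
        sqint_mult_integrable[OF f(1) test_fun_sqint[OF test_fun_pdiff[OF \<psi>], of k]]
      by (simp add: T_def distrib_left mult.left_commute[of _ t])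
  next
    fix h assume "sqint lborel h" "\<And>\<phi>. \<phi> \<in> Collect (test_fun V) \<Longrightarrow> T \<phi> = (\<integral>x. h x * \<phi> x \<partial>lborel)"
    then show thesis by (rule that)
  qed
  have "weak_partial V f k h"
    unfolding weak_partial_def
  proof (intro conjI allI impI sqint_loc_integrable f(1) h(1))
    fix \<phi> assume \<phi>: "test_fun V \<phi>"
    show "(LINT x:V|lborel. f x * pdiff \<phi> k x) = - (LINT x:V|lborel. h x * \<phi> x)"
      using h(2)[of \<phi>] \<phi> by (simp add: set_integral_mult_test_fun test_fun_pdiff T_def)
  qed
  moreover have "L2_on V h"
    unfolding L2_on_iff_sqint by (rule sqint_indicator[OF h(1) assms(1)])
  ultimately show thesis using that by blast
qed

section \<open>Regularity, monotonicity and bounds of the derivative of the convex function\<close>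

lemma smooth1_DERIV:
  assumes "smooth1 \<rho>"
  shows "(\<rho> has_real_derivative deriv \<rho> x) (at x)"
proof -
  have "((deriv ^^ 0) \<rho>) differentiable (at x)" using assms unfolding smooth1_def by blast
  then show ?thesis by (simp add: DERIV_deriv_iff_real_differentiable)
qed

lemma smooth1_deriv_measurable:
  assumes "smooth1 \<rho>"
  shows "deriv \<rho> \<in> borel_measurable borel"
proof (rule borel_measurable_continuous_onI)
  have "((deriv ^^ 1) \<rho>) differentiable (at x)" for x using assms unfolding smooth1_def by blast
  then show "continuous_on UNIV (deriv \<rho>)"
    by (simp add: continuous_at_imp_continuous_on differentiable_imp_continuous_within)
qed

lemma convex_on_deriv_mono:
  assumes "convex_on UNIV \<rho>" and d: "\<And>x. (\<rho> has_real_derivative deriv \<rho> x) (at x)"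
  shows "mono (deriv \<rho>)"
proof (rule monoI)
  fix x y :: real assume "x \<le> y"
  have "deriv \<rho> x * (y - x) \<le> \<rho> y - \<rho> x"
    by (rule convex_on_imp_above_tangent[OF assms(1)]) (use d in auto)
  moreover have "deriv \<rho> y * (x - y) \<le> \<rho> x - \<rho> y"
    by (rule convex_on_imp_above_tangent[OF assms(1)]) (use d in auto)
  ultimately have "deriv \<rho> x * (y - x) \<le> deriv \<rho> y * (y - x)" by (simp add: algebra_simps)
  with \<open>x \<le> y\<close> show "deriv \<rho> x \<le> deriv \<rho> y" by (cases "x = y") auto
qed

text \<open>The derivative is 0 left of \<open>a\<close> and \<open>\<gamma>\<close> right of
  \<open>b\<close>; monotonicity compares \<open>s\<close> with a point at least one unit beyond the
  relevant end, where the function is affine on a whole neighbourhood.\<close>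

lemma deriv_bounds_of_asymptotes:
  fixes a b :: real
  assumes mono: "mono (deriv \<rho>)"
    and "\<And>s. s \<le> a \<Longrightarrow> \<rho> s = 0" "\<And>s. s \<ge> b \<Longrightarrow> \<rho> s = \<gamma> * s + \<kappa>"
  shows "0 \<le> deriv \<rho> s" "deriv \<rho> s \<le> \<gamma>"
proof -
  have l: "deriv \<rho> x = 0" if "x < a" for x :: real
  proof (rule DERIV_imp_deriv)
    have "((\<lambda>x. 0) has_real_derivative 0) (at x)" by simp
    then show "(\<rho> has_real_derivative 0) (at x)"
      by (rule has_field_derivative_transform_within_open[where S="{..<a}"]) (use that assms(2) in auto)
  qed
  have r: "deriv \<rho> x = \<gamma>" if "x > b" for x :: real
  proof (rule DERIV_imp_deriv)
    have "((\<lambda>x. \<gamma> * x + \<kappa>) has_real_derivative \<gamma>) (at x)" by (auto intro!: derivative_eq_intros)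
    then show "(\<rho> has_real_derivative \<gamma>) (at x)"
      by (rule has_field_derivative_transform_within_open[where S="{b<..}"]) (use that assms(3) in auto)
  qed
  show "0 \<le> deriv \<rho> s"
    using monoD[OF mono, of "min s (a - 1)" s] l[of "min s (a - 1)"] by simp
  show "deriv \<rho> s \<le> \<gamma>"
    using monoD[OF mono, of s "max s (b + 1)"] r[of "max s (b + 1)"] by simp
qed

section \<open>Localisation and second weak derivatives\<close>

text \<open>The weak product rule. For an arbitrary \<open>\<phi>\<close> on the plane,
  \<open>\<phi> * \<zeta>\<close> has compact support in \<Omega> and is admissible in the weak
  formula, so the product with \<open>\<zeta>\<close> has weak derivatives on the whole
  plane.\<close>

lemma weak_partial_cutoff:
  assumes w: "weak_partial \<Omega> f j d" and \<zeta>: "test_fun \<Omega> \<zeta>" and \<phi>: "test_fun UNIV \<phi>"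
    and f: "sqint lborel (\<lambda>x. indicator \<Omega> x * f x)" and d: "sqint lborel (\<lambda>x. indicator \<Omega> x * d x)"
  shows "(\<integral>x. (\<zeta> x * (indicator \<Omega> x * f x)) * pdiff \<phi> j x \<partial>lborel) =
    - (\<integral>x. (\<zeta> x * (indicator \<Omega> x * d x) + pdiff \<zeta> j x * (indicator \<Omega> x * f x)) * \<phi> x \<partial>lborel)"
proof -
  let ?f = "\<lambda>x. indicator \<Omega> x * f x" and ?d = "\<lambda>x. indicator \<Omega> x * d x"
  note s\<zeta> = test_fun_smooth2[OF \<zeta>] and s\<phi> = test_fun_smooth2[OF \<phi>]
  have t: "test_fun \<Omega> (\<lambda>x. \<phi> x * \<zeta> x)" by (rule test_fun_smooth2_mult[OF s\<phi> \<zeta>])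
  have t1: "test_fun \<Omega> (\<lambda>x. \<phi> x * pdiff \<zeta> j x)" by (rule test_fun_smooth2_mult[OF s\<phi> test_fun_pdiff[OF \<zeta>]])
  have t2: "test_fun \<Omega> (\<lambda>x. pdiff \<phi> j x * \<zeta> x)" by (rule test_fun_smooth2_mult[OF smooth2_pdiff[OF s\<phi>] \<zeta>])
  have i: "integrable lborel (\<lambda>x. ?f x * (\<phi> x * pdiff \<zeta> j x))" "integrable lborel (\<lambda>x. ?f x * (pdiff \<phi> j x * \<zeta> x))"
    "integrable lborel (\<lambda>x. ?d x * (\<phi> x * \<zeta> x))"
    by (intro sqint_mult_integrable f d test_fun_sqint[OF t] test_fun_sqint[OF t1] test_fun_sqint[OF t2])+
  have out: "(LINT x:\<Omega>|lborel. q x * \<psi> x) = (\<integral>x. (indicator \<Omega> x * q x) * \<psi> x \<partial>lborel)" for q \<psi> :: "vec2 \<Rightarrow> real"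
    by (simp add: set_lebesgue_integral_def mult.assoc)
  have "(\<integral>x. ?f x * (\<phi> x * pdiff \<zeta> j x + pdiff \<phi> j x * \<zeta> x) \<partial>lborel) = - (\<integral>x. ?d x * (\<phi> x * \<zeta> x) \<partial>lborel)"
  proof -
    have "(LINT x:\<Omega>|lborel. f x * pdiff (\<lambda>x. \<phi> x * \<zeta> x) j x) = - (LINT x:\<Omega>|lborel. d x * (\<phi> x * \<zeta> x))"
      using w t unfolding weak_partial_def by blast
    then show ?thesis unfolding out pdiff_smooth2_mult[OF s\<phi> s\<zeta>] .
  qed
  then have "(\<integral>x. ?f x * (\<phi> x * pdiff \<zeta> j x) \<partial>lborel) + (\<integral>x. ?f x * (pdiff \<phi> j x * \<zeta> x) \<partial>lborel) =
      - (\<integral>x. ?d x * (\<phi> x * \<zeta> x) \<partial>lborel)"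
    unfolding distrib_left by (subst (asm) Bochner_Integration.integral_add[OF i(1,2)])
  moreover have "(\<integral>x. (\<zeta> x * ?d x + pdiff \<zeta> j x * ?f x) * \<phi> x \<partial>lborel) =
      (\<integral>x. ?d x * (\<phi> x * \<zeta> x) \<partial>lborel) + (\<integral>x. ?f x * (\<phi> x * pdiff \<zeta> j x) \<partial>lborel)"
    by (subst Bochner_Integration.integral_add[OF i(3,1), symmetric])
      (rule Bochner_Integration.integral_cong, simp_all add: algebra_simps)
  moreover have "(\<integral>x. (\<zeta> x * ?f x) * pdiff \<phi> j x \<partial>lborel) = (\<integral>x. ?f x * (pdiff \<phi> j x * \<zeta> x) \<partial>lborel)"
    by (rule Bochner_Integration.integral_cong) (simp_all add: algebra_simps)
  ultimately show ?thesis by linarith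
qed

text \<open>Two cutoffs are nested. \<open>\<zeta>\<close> is 1 on the neighbourhood
  \<open>K\<close> of the closure of \<open>V\<close> and makes \<open>u\<close> a function on the
  plane; \<open>\<eta>\<close> is supported in the interior \<open>U\<close> of \<open>K\<close>,
  where the localised problem coincides with the original one, and is 1 on \<open>V\<close>, where
  the derivatives are wanted.\<close>

lemma stationary_gradient_weak_partial:
  assumes "open \<Omega>" and st: "stationary \<Omega> \<rho> u0 u"
    and \<rho>: "deriv \<rho> \<in> borel_measurable borel" "mono (deriv \<rho>)"
      "\<And>s. 0 \<le> deriv \<rho> s" "\<And>s. deriv \<rho> s \<le> \<gamma>" "\<gamma> < 1"
    and V: "open V" "compact (closure V)" "closure V \<subseteq> \<Omega>"
  shows "\<exists>h. weak_partial V (\<lambda>x. wgrad \<Omega> u x $ i $ j) k h \<and> L2_on V h"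
proof -
  have W: "W12 \<Omega> u" using st by (simp add: stationary_def admissible_def)
  obtain e where e: "e > 0" "(\<Union>x\<in>closure V. cball x e) \<subseteq> \<Omega>"
    using compact_subset_open_imp_cball_epsilon_subset[OF V(2) \<open>open \<Omega>\<close> V(3)] by blast
  define K where "K = {x + z |x z. x \<in> closure V \<and> z \<in> cball 0 e}"
  have K: "compact K" unfolding K_def by (intro compact_sums V compact_cball)
  have ballK: "cball x e \<subseteq> K" if "x \<in> closure V" for x
  proof
    fix y assume "y \<in> cball x e"
    then have "y = x + (y - x)" "y - x \<in> cball 0 e" by (auto simp: dist_norm norm_minus_commute)
    with that show "y \<in> K" unfolding K_def by blast
  qed
  have K\<Omega>: "K \<subseteq> \<Omega>"
  proof
    fix y assume "y \<in> K"
    then obtain x z where "x \<in> closure V" "y = x + z" "norm z \<le> e" by (auto simp: K_def)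
    then have "y \<in> cball x e" by (simp add: dist_norm)
    with e(2) \<open>x \<in> closure V\<close> show "y \<in> \<Omega>" by blast
  qed
  define U where "U = interior K"
  have VU: "closure V \<subseteq> U"
  proof
    fix x assume "x \<in> closure V"
    then have "ball x e \<subseteq> K" using ballK ball_subset_cball by blast
    then show "x \<in> U" unfolding U_def using e(1) by (meson centre_in_ball interior_maximal open_ball subsetD)
  qed
  have U: "open U" "U \<subseteq> K" by (auto simp: U_def interior_subset)
  obtain \<zeta> where \<zeta>: "test_fun \<Omega> \<zeta>" "\<And>x. x \<in> K \<Longrightarrow> \<zeta> x = 1"
    using ex_cutoff[OF K \<open>open \<Omega>\<close> K\<Omega>] by metis
  obtain \<eta> where \<eta>: "test_fun U \<eta>" "\<And>x. x \<in> closure V \<Longrightarrow> \<eta> x = 1" "\<And>x. \<bar>\<eta> x\<bar> \<le> 1"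
    using ex_cutoff[OF V(2) U(1) VU] by metis
  obtain S where S: "compact S" "\<And>x. x \<notin> S \<Longrightarrow> \<zeta> x = 0" "\<And>x j. x \<notin> S \<Longrightarrow> pdiff \<zeta> j x = 0"
  proof -
    obtain S where S: "compact S" "\<And>x. x \<notin> S \<Longrightarrow> \<zeta> x = 0" using \<zeta>(1) by (auto simp: test_fun_iff)
    have "pdiff \<zeta> j x = 0" if "x \<notin> S" for x j
      using that S by (intro pdiff_eq_0_if_open[of "- S" x \<zeta> 0]) (auto simp: compact_imp_closed)
    with S that show thesis by blast
  qed
  define D where "D = wgrad \<Omega> u"
  have sf: "sqint lborel (\<lambda>x. indicator \<Omega> x * u x $ i)" for i
    using W by (auto simp: W12_def W12s_def L2_on_iff_sqint)
  have sD: "sqint lborel (\<lambda>x. indicator \<Omega> x * D x $ i $ j)" for i j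
    using wgrad_L2_on[OF \<open>open \<Omega>\<close> W, of i j] by (simp add: L2_on_iff_sqint D_def)
  have mult: "sqint lborel (\<lambda>x. \<psi> x * q x)" if m: "test_fun \<Omega> \<psi>" "sqint lborel q" for \<psi> q
  proof -
    obtain M where M: "\<And>x. \<bar>\<psi> x\<bar> \<le> M" using test_fun_bounded[OF m(1)] by metis
    show ?thesis
      by (rule sqint_bounded_mult[OF m(2) _ M]) (simp add: test_fun_measurable[OF m(1)])
  qed
  define v where "v i x = \<zeta> x * (indicator \<Omega> x * u x $ i)" for i x
  define g where "g i j x = \<zeta> x * (indicator \<Omega> x * D x $ i $ j) + pdiff \<zeta> j x * (indicator \<Omega> x * u x $ i)" for i j x
  define A where "A x = (\<chi> i j. g i j x)" for x
  \<comment> \<open>The nonlinear map is applied to the cut-off gradient instead of being cut off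
    itself, which keeps the monotonicity inequality valid for all pairs of points.\<close>
  define G where "G i j x = stress (deriv \<rho>) (A x) $ i $ j" for i j x
  have v0: "v i x = 0" and g0: "g i j x = 0" and G0: "G i j x = 0" if "x \<notin> S" for i j x
  proof -
    show "v i x = 0" using S(2)[OF that] by (simp add: v_def)
    have *: "g i j x = 0" for i j using S(2,3)[OF that] by (simp add: g_def)
    then show "g i j x = 0" .
    from * have "A x = 0" by (simp add: A_def vec_eq_iff)
    then show "G i j x = 0" by (simp add: G_def stress_0)
  qed
  have sv: "sqint lborel (v i)" for i unfolding v_def[abs_def] by (rule mult[OF \<zeta>(1) sf])
  have sg: "sqint lborel (g i j)" for i j
    unfolding g_def[abs_def] by (intro sqint_add mult[OF \<zeta>(1)] mult[OF test_fun_pdiff[OF \<zeta>(1)]] sf sD)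
  have \<rho>_abs: "\<bar>deriv \<rho> s\<bar> \<le> \<gamma>" for s using \<rho>(3,4)[of s] by simp
  have sG: "sqint lborel (G i j)" for i j
    unfolding G_def[abs_def] by (rule sqint_stress[OF _ \<rho>(1) \<rho>_abs]) (simp add: A_def sg)
  note int = sqint_compact_support_integrable[OF _ S(1)]
  have iv: "integrable lborel (v i)" and ig: "integrable lborel (g i j)" and iG: "integrable lborel (G i j)" for i j
    by (rule int[OF sv v0] int[OF sg g0] int[OF sG G0]; assumption)+
  \<comment> \<open>Here the openness of \<open>U\<close> matters: \<open>\<zeta>\<close> is
    constant near each point of \<open>U\<close>, so the product-rule term with its derivative
    disappears.\<close>
  have gD: "g i j x = D x $ i $ j" if "x \<in> U" for i j x
  proof -
    have "x \<in> K" "x \<in> \<Omega>" using that U(2) K\<Omega> by auto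
    moreover have "pdiff \<zeta> j x = 0"
      by (rule pdiff_eq_0_if_open[OF U(1) that, of \<zeta> 1]) (use U(2) \<zeta>(2) in blast)
    ultimately show ?thesis using \<zeta>(2)[of x] by (simp add: g_def)
  qed
  have GD: "G i j x = indicator \<Omega> x * stress (deriv \<rho>) (D x) $ i $ j" if "x \<in> U" for i j x
  proof -
    have "A x = D x" by (simp add: A_def vec_eq_iff gD[OF that])
    moreover have "x \<in> \<Omega>" using that U(2) K\<Omega> by auto
    ultimately show ?thesis by (simp add: G_def)
  qed
  obtain r Y where r: "r > 0" "\<And>t k i j. \<bar>t\<bar> < r \<Longrightarrow>
      l2 lborel (\<lambda>x. \<eta> x * dif (t *\<^sub>R axis k 1) (g i j) x) \<le> \<bar>t\<bar> * Y"
  proof (rule monotone_system_difference_bound[OF U(1) S(1) v0 sv iv sg ig sG iG _ _ _ _ \<eta>(1)])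
    show "(\<integral>x. v i x * pdiff \<phi> j x \<partial>lborel) = - (\<integral>x. g i j x * \<phi> x \<partial>lborel)"
      if "test_fun UNIV \<phi>" for i j \<phi>
      unfolding v_def g_def D_def
      by (rule weak_partial_cutoff[OF wgrad_weak_grad[OF W] \<zeta>(1) that sf sD[unfolded D_def]])
    show "(1 - \<gamma>) * (\<Sum>i\<in>UNIV. \<Sum>j\<in>UNIV. (g i j x - g i j y)\<^sup>2) \<le>
        (\<Sum>i\<in>UNIV. \<Sum>j\<in>UNIV. (G i j x - G i j y) * (g i j x - g i j y))" for x y
      using stress_strongly_monotone[OF \<rho>(2-4), of "A x" "A y"] by (simp add: A_def G_def)
    show "0 < 1 - \<gamma>" using \<rho>(5) by simp
    show "(\<Sum>i\<in>UNIV. \<Sum>j\<in>UNIV. \<integral>x. G i j x * pdiff (\<phi> i) j x \<partial>lborel) = 0"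
      if \<phi>: "\<And>i. test_fun U (\<phi> i)" for \<phi>
    proof -
      have \<phi>\<Omega>: "test_fun \<Omega> (\<phi> i)" for i by (rule test_fun_mono[OF \<phi>]) (use U(2) K\<Omega> in blast)
      have "(\<lambda>x. G i j x * pdiff (\<phi> i) j x) =
          (\<lambda>x. (indicator \<Omega> x * stress (deriv \<rho>) (D x) $ i $ j) * pdiff (\<phi> i) j x)" for i j
      proof
        fix x
        show "G i j x * pdiff (\<phi> i) j x = (indicator \<Omega> x * stress (deriv \<rho>) (D x) $ i $ j) * pdiff (\<phi> i) j x"
          using GD[of x i j] test_fun_outside[OF test_fun_pdiff[OF \<phi>], of x i j] by (cases "x \<in> U") auto
      qed
      then show ?thesis
        using stationary_test_equation[OF \<open>open \<Omega>\<close> st \<rho>(1) \<rho>_abs \<phi>\<Omega>] by (simp only: D_def)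
    qed
  next
    fix r Y assume "0 < r" "\<And>t k i j. \<bar>t\<bar> < r \<Longrightarrow>
      l2 lborel (\<lambda>x. \<eta> x * dif (t *\<^sub>R axis k 1) (g i j) x) \<le> \<bar>t\<bar> * Y"
    then show thesis by (rule that)
  qed
  have s\<eta>: "sqint lborel (\<lambda>x. \<eta> x * dif (t *\<^sub>R axis k 1) (g i j) x)" for t
    using sqint_bounded_mult[OF sqint_dif[OF sg] _ \<eta>(3)] test_fun_measurable[OF \<eta>(1)] by simp
  have \<eta>V: "\<eta> x = 1" if "x \<in> V" for x using \<eta>(2) that closure_subset by blast
  obtain h where h: "weak_partial V (g i j) k h" "L2_on V h"
    using weak_partial_of_difference_bound[OF V(1) sg ig \<eta>V s\<eta> r] by blast
  have eq: "g i j x = D x $ i $ j" if "x \<in> V" for x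
    using gD[of x i j] that VU closure_subset by blast
  have "(LINT x:V|lborel. D x $ i $ j * q x) = (LINT x:V|lborel. g i j x * q x)" for q :: "vec2 \<Rightarrow> real"
    unfolding set_lebesgue_integral_def
    by (rule Bochner_Integration.integral_cong) (auto simp: indicator_def eq)
  with h(1) loc_integrable_cong[of V "g i j" "\<lambda>x. D x $ i $ j"] eq
  have "weak_partial V (\<lambda>x. D x $ i $ j) k h" unfolding weak_partial_def by simp
  with h(2) show ?thesis unfolding D_def by blast
qed

theorem theorem1p2:
  fixes \<Omega> :: "vec2 set" and \<rho> :: "real \<Rightarrow> real" and \<gamma> s0 \<kappa> :: real
    and u0 u :: "vec2 \<Rightarrow> vec2"
  assumes "open \<Omega>" and "bounded \<Omega>" and "lipschitz_boundary \<Omega>"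
    and "0 < \<gamma>" and "\<gamma> < 1" and "s0 \<ge> 0" and "\<kappa> \<ge> - \<gamma> * s0"
    and "smooth1 \<rho>" and "convex_on UNIV \<rho>"
    and "\<And>s. s \<le> 0 \<Longrightarrow> \<rho> s = 0"
    and "\<And>s. s \<ge> s0 \<Longrightarrow> \<rho> s = \<gamma> * s + \<kappa>"
    and "W12 \<Omega> u0"
    and "stationary \<Omega> \<rho> u0 u"
  shows "W22_loc \<Omega> u"
  unfolding W22_loc_def
proof (intro allI impI)
  fix V assume "open V \<and> compact (closure V) \<and> closure V \<subseteq> \<Omega>"
  then have V: "open V" "compact (closure V)" "closure V \<subseteq> \<Omega>" by auto
  have V\<Omega>: "V \<subseteq> \<Omega>" using V(3) closure_subset by blast
  have W: "W12 \<Omega> u" using assms(13) by (simp add: stationary_def admissible_def)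
  have mono: "mono (deriv \<rho>)" by (rule convex_on_deriv_mono[OF assms(9) smooth1_DERIV[OF assms(8)]])
  have b: "0 \<le> deriv \<rho> s" "deriv \<rho> s \<le> \<gamma>" for s
    using deriv_bounds_of_asymptotes[OF mono, of 0 s0 \<gamma> \<kappa> s] assms(10,11) by auto
  have wp: "weak_partial V (\<lambda>x. u x $ i) j (\<lambda>x. wgrad \<Omega> u x $ i $ j)" for i j
    by (rule weak_partial_subset[OF wgrad_weak_grad[OF W] V\<Omega>])
  have DL: "L2_on V (\<lambda>x. wgrad \<Omega> u x $ i $ j)" for i j
    by (rule L2_on_subset[OF wgrad_L2_on[OF assms(1) W] V(1) V\<Omega>])
  have uL: "L2_on V (\<lambda>x. u x $ i)" for i
    using W L2_on_subset[OF _ V(1) V\<Omega>] by (auto simp: W12_def W12s_def)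
  show "W22 V u"
    unfolding W22_def
  \<comment> \<open>The gradient selected on \<Omega> also serves on \<open>V\<close>:
    \<open>W22\<close> asks for some weak gradient, so no comparison with \<open>wgrad V u\<close>
    arises.\<close>
  proof (intro conjI exI[of _ "wgrad \<Omega> u"] allI)
    show "W12 V u" unfolding W12_def W12s_def using uL wp DL by blast
    show "weak_grad V u (wgrad \<Omega> u)" unfolding weak_grad_def using wp by blast
    show "W12s V (\<lambda>x. wgrad \<Omega> u x $ i $ j)" for i j
      unfolding W12s_def
      using DL stationary_gradient_weak_partial[OF assms(1,13) smooth1_deriv_measurable[OF assms(8)] mono b assms(5) V]
      by blast
  qed
qed

end
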